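(* Let $X$ be a separable complex Fréchet space whose topology is given by a countable system of norms $\{p_n\}_{n\in\mathbb{N}}$, and let $Y$ be a (complex) Banach space. Suppose that for every $n\in\mathbb{N}$ the normed space $X_n=(X,p_n)$ admits a uniformly $*$-analytic and separating function. Let $f:X\to Y$ be a uniformly continuous function for which there exists $k\in\mathbb{N}$ such that $f$ is uniformly continuous on $X_k=(X,p_k)$. Then $f$ is approximated by $*$-analytic functions uniformly on all of $X$: for every $\varepsilon>0$ there is a $*$-analytic map $H:X\to Y$ such that $\|f(x)-H(x)\|<\varepsilon$ for all $x\in X$.
   Context: A Fréchet space is a locally convex topological vector space metrizable by a complete metric. "With a countable system of norms $\{p_n\}$" means that each $p_n$ is a norm on $X$, that the topology of $X$ is the weakest one for which all $p_n$ are continuous, and that the metric $\rho(x,y)=\sum_n 2^{-n}\frac{p_n(x-y)}{1+p_n(x-y)}$ is complete. $X_n=(X,p_n)$ is the vector space $X$ with the single norm $p_n$ (not necessarily complete). Uniform continuity on $X$ is with respect to $\rho$, and on $X_k$ with respect to $p_k$. Let $X,Y$ be complex vector spaces. A map $B_n:X^n\to Y$ is $*$-$n$-linear if $B_n(x_1,\dots,x_n)=\sum_{k+m=n}c_{km}B_{km}(x_1,\dots,x_k,x_{k+1},\dots,x_{k+m})$, where each $B_{km}:X^{k+m}\to Y$ is linear in each of $x_1,\dots,x_k$ and antilinear (conjugate-linear) in each of $x_{k+1},\dots,x_{k+m}$, and $c_{km}\in\{0,1\}$. An $n$-homogeneous $*$-polynomial is a map $F_n:X\to Y$ of the form $F_n(x)=B_n(x,\dots,x)$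 with $B_n$ $*$-$n$-linear (for $n=0$, a constant); the zero map is allowed. A map $F:X\to Y$ from a complex topological vector space $X$ to a complex normed space $Y$ is $*$-analytic if for every $x\in X$ there are a neighbourhood $V$ of $0$ in $X$ and continuous $n$-homogeneous $*$-polynomials $F_n:X\to Y$ ($n\ge 0$) such that $F(x+h)=\sum_{n=0}^\infty F_n(h)$ for $h\in V$, the series converging uniformly on $V$ in the norm of $Y$. A function $Q:Z\to\mathbb{C}$ on a complex normed space $Z$, of the form $Q(x)=\sum_{n=1}^\infty Q_n(x)$ for all $x\in Z$ with $Q_n$ continuous $n$-homogeneous $*$-polynomials, is uniformly $*$-analytic and separating if: (1) there is $R_Q>0$ such that the series $\sum_{n=1}^\infty Q_n(x)$ converges uniformly on the ball of radius $R_Q$ centred at any point $x_0\in Z$; (2) there is $\alpha\in\mathbb{R}$ such that the set $\{x\in Z: |Q(x)|<\alpha\}$ is nonempty and contained in the open unit ball of $Z$. *)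

theory Defs
  imports "HOL-Analysis.Analysis"
begin

class scaleC = scaleR +
  fixes scaleC :: "complex \<Rightarrow> 'a \<Rightarrow> 'a" (infixr "*\<^sub>C" 75)
  assumes scaleR_scaleC: "scaleR r = scaleC (complex_of_real r)"

class complex_vector = scaleC + ab_group_add +
  assumes scaleC_add_right: "a *\<^sub>C (x + y) = a *\<^sub>C x + a *\<^sub>C y"
    and scaleC_add_left: "(a + b) *\<^sub>C x = a *\<^sub>C x + b *\<^sub>C x"
    and scaleC_scaleC: "a *\<^sub>C (b *\<^sub>C x) = (a * b) *\<^sub>C x"
    and scaleC_one: "1 *\<^sub>C x = x"

subclass (in complex_vector) real_vector
  by standard
    (simp_all add: scaleR_scaleC scaleC_add_right scaleC_add_left scaleC_scaleC scaleC_one)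

class complex_normed_vector = complex_vector + real_normed_vector +
  assumes norm_scaleC: "norm (a *\<^sub>C x) = cmod a * norm x"

class complex_banach = complex_normed_vector + banach

instantiation complex :: complex_banach
begin

definition scaleC_complex :: "complex \<Rightarrow> complex \<Rightarrow> complex"
  where "scaleC_complex a x = a * x"

instance
  by standard
    (auto simp: scaleC_complex_def scaleR_conv_of_real norm_mult algebra_simps)

end

definition is_norm :: "('a::complex_vector \<Rightarrow> real) \<Rightarrow> bool"
  where "is_norm p \<longleftrightarrow>
    (\<forall>x. 0 \<le> p x) \<and> (\<forall>x. p x = 0 \<longleftrightarrow> x = 0) \<and>
    (\<forall>c x. p (c *\<^sub>C x) = cmod c * p x) \<and> (\<forall>x y. p (x + y) \<le> p x + p y)"

definition norm_metric :: "('a::complex_vector \<Rightarrow> real) \<Rightarrow> 'a metric"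
  where "norm_metric p = metric (UNIV, \<lambda>x y. p (x - y))"

definition rho :: "(nat \<Rightarrow> 'a::complex_vector \<Rightarrow> real) \<Rightarrow> 'a \<Rightarrow> 'a \<Rightarrow> real"
  where "rho p x y = (\<Sum>n. (1/2) ^ n * (p n (x - y) / (1 + p n (x - y))))"

definition rho_metric :: "(nat \<Rightarrow> 'a::complex_vector \<Rightarrow> real) \<Rightarrow> 'a metric"
  where "rho_metric p = metric (UNIV, rho p)"

text \<open>The weakest vector space topology for which all the norms are continuous. By translation
  invariance it is the weakest topology for which all maps \<open>y \<mapsto> p n (y - x)\<close> are
  continuous, so it is generated by the open balls of all the norms around all points.\<close>

definition norms_topology :: "(nat \<Rightarrow> 'a::complex_vector \<Rightarrow> real) \<Rightarrow> 'a topology"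
  where "norms_topology p = topology_generated_by {{y. p n (y - x) < r} | n x r. r > 0}"

definition frechet_norm_system :: "(nat \<Rightarrow> 'a::complex_vector \<Rightarrow> real) \<Rightarrow> bool"
  where "frechet_norm_system p \<longleftrightarrow> (\<forall>n. is_norm (p n)) \<and> mcomplete_of (rho_metric p)"

text \<open>\<^const>\<open>metric\<close> is only meaningful on pairs that form a metric space; this is the case here.\<close>

lemma is_norm_uminus: "is_norm p \<Longrightarrow> p (- x) = p x"
proof -
  assume p: "is_norm p"
  have "(- 1) *\<^sub>C x = - x"
    using scaleR_minus1_left[of x] by (simp add: scaleR_scaleC)
  moreover have "p ((- 1) *\<^sub>C x) = p x"
    using p unfolding is_norm_def by simp
  ultimately show ?thesis by simp
qed

lemma is_norm_minus_commute: "is_norm p \<Longrightarrow> p (x - y) = p (y - x)"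
  using is_norm_uminus[of p "x - y"] by simp

lemma is_norm_triangle: "is_norm p \<Longrightarrow> p (x - z) \<le> p (x - y) + p (y - z)"
proof -
  assume p: "is_norm p"
  have "p ((x - y) + (y - z)) \<le> p (x - y) + p (y - z)"
    using p unfolding is_norm_def by blast
  then show ?thesis by simp
qed

lemma Metric_space_norm: "is_norm p \<Longrightarrow> Metric_space UNIV (\<lambda>x y. p (x - y))"
proof
  assume p: "is_norm p"
  show "0 \<le> p (x - y)" "(p (x - y) = 0) = (x = y)" for x y
    using p unfolding is_norm_def by auto
  show "p (x - y) = p (y - x)" for x y
    using p by (rule is_norm_minus_commute)
  show "p (x - z) \<le> p (x - y) + p (y - z)" for x y z
    using p by (rule is_norm_triangle)
qed

lemma summable_rho:
  assumes "\<And>n. is_norm (p n)"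
  shows "summable (\<lambda>n. (1/2) ^ n * (p n x / (1 + p n x)))"
proof (rule summable_comparison_test')
  show "summable (\<lambda>n. (1/2::real) ^ n)"
    by (simp add: summable_geometric)
  fix n :: nat
  have "0 \<le> p n x" using assms unfolding is_norm_def by blast
  then have "p n x / (1 + p n x) \<le> 1" "0 \<le> p n x / (1 + p n x)" by simp_all
  then show "norm ((1/2) ^ n * (p n x / (1 + p n x))) \<le> (1/2) ^ n"
    unfolding real_norm_def abs_mult
    by (metis abs_of_nonneg mult_left_le zero_le_power zero_le_divide_1_iff zero_le_numeral)
qed

lemma Metric_space_rho:
  assumes p: "\<And>n. is_norm (p n)"
  shows "Metric_space UNIV (rho p)"
proof
  have pos: "0 \<le> p n x" for n x using p unfolding is_norm_def by blast
  have nonneg: "0 \<le> (1/2) ^ n * (p n x / (1 + p n x))" for n x using pos by simp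
  show "0 \<le> rho p x y" for x y
    unfolding rho_def by (intro suminf_nonneg summable_rho p nonneg)
  show "rho p x y = rho p y x" for x y
    unfolding rho_def is_norm_minus_commute[OF p, of _ x y] by (rule refl)
  show "rho p x y = 0 \<longleftrightarrow> x = y" for x y
  proof
    assume "rho p x y = 0"
    then have "(1/2) ^ 0 * (p 0 (x - y) / (1 + p 0 (x - y))) = 0"
      unfolding rho_def using suminf_eq_zero_iff[OF summable_rho[OF p] nonneg] by blast
    then have "p 0 (x - y) = 0" using pos[of 0 "x - y"] by auto
    then have "x - y = 0" using p[of 0] unfolding is_norm_def by blast
    then show "x = y" by simp
  next
    assume "x = y"
    moreover have "p n 0 = 0" for n using p unfolding is_norm_def by blast
    ultimately show "rho p x y = 0" by (simp add: rho_def)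
  qed
  show "rho p x z \<le> rho p x y + rho p y z" for x y z
  proof -
    have mono: "a / (1 + a) \<le> b / (1 + b) + c / (1 + c)"
      if "a \<le> b + c" "0 \<le> a" "0 \<le> b" "0 \<le> c" for a b c :: real
    proof -
      have "a / (1 + a) \<le> (b + c) / (1 + (b + c))"
        using that by (simp add: divide_simps) (simp add: algebra_simps)
      also have "\<dots> = b / (1 + (b + c)) + c / (1 + (b + c))"
        by (simp add: add_divide_distrib)
      also have "\<dots> \<le> b / (1 + b) + c / (1 + c)"
        using that by (intro add_mono divide_left_mono) auto
      finally show ?thesis .
    qed
    show ?thesis
      unfolding rho_def suminf_add[OF summable_rho[OF p] summable_rho[OF p]]
    proof (rule suminf_le)
      show "(1/2) ^ n * (p n (x - z) / (1 + p n (x - z)))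
        \<le> (1/2) ^ n * (p n (x - y) / (1 + p n (x - y)))
          + (1/2) ^ n * (p n (y - z) / (1 + p n (y - z)))" for n
        unfolding distrib_left[symmetric]
        by (rule mult_left_mono[OF mono[OF is_norm_triangle[OF p] pos pos pos]]) simp
    qed (rule summable_rho[OF p] summable_add[OF summable_rho[OF p] summable_rho[OF p]])+
  qed
qed

text \<open>Maps on n-tuples are functions on lists, of which only the values at lists of length n
  matter.\<close>

definition clinear_map :: "('a::complex_vector \<Rightarrow> 'b::complex_vector) \<Rightarrow> bool"
  where "clinear_map g \<longleftrightarrow>
    (\<forall>x y. g (x + y) = g x + g y) \<and> (\<forall>c x. g (c *\<^sub>C x) = c *\<^sub>C g x)"

definition antilinear_map :: "('a::complex_vector \<Rightarrow> 'b::complex_vector) \<Rightarrow> bool"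
  where "antilinear_map g \<longleftrightarrow>
    (\<forall>x y. g (x + y) = g x + g y) \<and> (\<forall>c x. g (c *\<^sub>C x) = cnj c *\<^sub>C g x)"

definition km_linear ::
    "nat \<Rightarrow> nat \<Rightarrow> ('a::complex_vector list \<Rightarrow> 'b::complex_vector) \<Rightarrow> bool"
  where "km_linear k m B \<longleftrightarrow>
    (\<forall>xs. length xs = k + m \<longrightarrow>
      (\<forall>i<k. clinear_map (\<lambda>v. B (xs[i := v]))) \<and>
      (\<forall>i\<in>{k..<k + m}. antilinear_map (\<lambda>v. B (xs[i := v]))))"

definition star_n_linear ::
    "nat \<Rightarrow> ('a::complex_vector list \<Rightarrow> 'b::complex_vector) \<Rightarrow> bool"
  where "star_n_linear n B \<longleftrightarrow>
    (\<exists>(c :: nat \<Rightarrow> nat \<Rightarrow> complex) Bkm.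
      (\<forall>k m. k + m = n \<longrightarrow> c k m \<in> {0, 1} \<and> km_linear k m (Bkm k m)) \<and>
      (\<forall>xs. length xs = n \<longrightarrow>
        B xs = (\<Sum>(k, m) | k + m = n. c k m *\<^sub>C Bkm k m xs)))"

definition star_polynomial ::
    "nat \<Rightarrow> ('a::complex_vector \<Rightarrow> 'b::complex_vector) \<Rightarrow> bool"
  where "star_polynomial n F \<longleftrightarrow>
    (\<exists>B. star_n_linear n B \<and> (\<forall>x. F x = B (replicate n x)))"

definition star_analytic ::
    "'a::complex_vector topology \<Rightarrow> ('a \<Rightarrow> 'b::complex_normed_vector) \<Rightarrow> bool"
  where "star_analytic T F \<longleftrightarrow>
    (\<forall>x. \<exists>V Fn.
      (\<exists>U. openin T U \<and> 0 \<in> U \<and> U \<subseteq> V) \<and>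
      (\<forall>n. star_polynomial n (Fn n) \<and> continuous_map T euclidean (Fn n)) \<and>
      uniform_limit V (\<lambda>N h. \<Sum>n<N. Fn n h) (\<lambda>h. F (x + h)) sequentially)"

text \<open>The normed space is the vector space \<^typ>\<open>'a\<close> with the norm \<open>p\<close>.\<close>

definition uniformly_star_analytic_separating ::
    "('a::complex_vector \<Rightarrow> real) \<Rightarrow> ('a \<Rightarrow> complex) \<Rightarrow> bool"
  where "uniformly_star_analytic_separating p Q \<longleftrightarrow>
    (\<exists>Qn.
      (\<forall>n\<ge>1. star_polynomial n (Qn n) \<and>
        continuous_map (mtopology_of (norm_metric p)) euclidean (Qn n)) \<and>
      (\<forall>x. (\<lambda>N. \<Sum>n=1..N. Qn n x) \<longlonglongrightarrow> Q x) \<and>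
      (\<exists>R>0. \<forall>x0. uniform_limit {x. p (x - x0) < R} (\<lambda>N x. \<Sum>n=1..N. Qn n x) Q sequentially)) \<and>
    (\<exists>\<alpha>::real. {x. cmod (Q x) < \<alpha>} \<noteq> {} \<and> {x. cmod (Q x) < \<alpha>} \<subseteq> {x. p x < 1})"

end

theory Submission
  imports Defs
begin

text \<open>
  Fix \<open>k\<close> such that \<open>f\<close> is uniformly continuous for the norm \<open>p k\<close>. Balls of \<open>p k\<close> are open in the
  Frechet topology, so the points that are dense there are dense for \<open>p k\<close>, and a function that is
  locally a sum of polynomials with bounds in terms of \<open>p k\<close> is *-analytic on the Frechet space
  (\<open>star_analytic_if_germ\<close>). It remains to approximate \<open>f\<close> on the separable normed space \<open>(X, p k)\<close>,
  by a partition of unity as in Kurzweil's theorem.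

  Let \<open>f\<close> oscillate by less than \<open>\<epsilon> / 4\<close> on balls of radius \<open>d\<close>, and let \<open>X n\<close> be a dense sequence.
  A separating function \<open>Q\<close> yields analytic bumps \<open>V n\<close> with values in \<open>(0, 1]\<close>, at least \<open>3/4\<close> near
  \<open>X n\<close> and at most \<open>2/5\<close> at distance \<open>d\<close> or more from it (\<open>analytic_bump\<close>). The function \<open>\<psi> n\<close> has to be
  large where \<open>n\<close> is the first index with \<open>V n x \<ge> 1/2\<close>, and tiny off the ball around \<open>X n\<close>.
  In the coordinates \<open>z j = V j x\<close> the first condition says that \<open>(z 0, ..., z n)\<close> lies in a box;
  the indicator function of this box is replaced by a finite sum of narrow Gaussians
  \<open>exp (\<kappa> n * (a n / 200 - (\<Sum>j\<le>n. a j * (V j x - \<omega> j)\<^sup>2)))\<close> with centres \<open>\<omega>\<close> in a fine finite net of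
  the box. Gaussians are the right profile because a perturbation of \<open>x\<close> by a complexified vector
  changes the exponent only by \<open>\<kappa> n\<close> times the perturbation of the quadratic form. The weights
  \<open>a j\<close> decrease so fast that this perturbation is small uniformly in \<open>n\<close>, whereas the form itself
  stays away from \<open>0\<close> as soon as some earlier \<open>V m x\<close> is at least \<open>3/4\<close>. Hence
  \<open>\<psi> n\<close> decays near \<open>x\<close> like \<open>exp (- \<kappa> n * c)\<close> even after complexification, and \<open>\<kappa> n\<close> may be taken
  as large as needed (\<open>analytic_partition\<close>). Then
  \<open>H x = (\<Sum>n. \<psi> n x *\<^sub>R f (X n)) /\<^sub>R (\<Sum>n. \<psi> n x)\<close> is an average of values of \<open>f\<close>, dominated by points
  near \<open>x\<close>. As \<open>f\<close> may be unbounded, \<open>\<psi> n\<close> carries the factor \<open>V n\<close>, which decays like the inverse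
  of the distance to \<open>X n\<close>, while \<open>f\<close> grows at most linearly (\<open>germ_approximation\<close>).

  Complexification is replaced by power series. A \<^emph>\<open>germ\<close> is a sequence of multi-additive
  forms \<open>A\<close> with \<open>norm (A xs) \<le> C * wt (length xs) * (\<Prod>x\<leftarrow>xs. p x / r)\<close>, representing
  \<open>h \<mapsto> (\<Sum>n. A (replicate n h))\<close> for \<open>p h < r\<close>. Germs can be added, multiplied, summed over infinite
  families and substituted into power series, with explicit control of \<open>C\<close>; and \<open>C\<close> plays the part
  of a supremum over a complex ball of radius \<open>r\<close>. A germ without constant term has small \<open>C\<close> on a
  small ball (\<open>germ_increment\<close>).

  That the radius can be the same for the bumps around all points is where the hypothesis on \<open>Q\<close>
  enters. Uniform convergence of \<open>\<Sum>n. Q n x\<close> on balls of one radius bounds the terms, uniformly in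
  \<open>n\<close>, on a tube around the segment from \<open>0\<close> to \<open>24 *\<^sub>R y\<close>, hence by homogeneity gives a factor
  \<open>24 ^ (- n)\<close> on a tube around the segment from \<open>0\<close> to \<open>y\<close>. This beats the constants of
  the polarization formula for \<open>Q n\<close>, and so the series can be expanded again around \<open>y\<close>
  (\<open>germ_homogeneous_series\<close>).
\<close>

section \<open>Weights and double series\<close>

text \<open>A majorant in product form replaces absolute convergence of the double series; this way the lemma
  also applies in Banach spaces without a product.\<close>

lemma double_sums:
  fixes f :: "nat \<Rightarrow> nat \<Rightarrow> 'b::banach"
  assumes bound: "\<And>i n. norm (f i n) \<le> c i * d n"
    and c: "summable c" and d: "summable d" and c0: "\<And>i. 0 \<le> c i"
    and G: "\<And>i. f i sums G i"
  shows "summable G" and "(\<lambda>n. \<Sum>i. f i n) sums (\<Sum>i. G i)"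
proof -
  define t where "t N = (\<Sum>n. d n) - (\<Sum>n<N. d n)" for N
  have rest: "norm (G i - (\<Sum>n<N. f i n)) \<le> c i * t N" for i N
  proof -
    have sd: "summable (\<lambda>n. c i * d (n + N))"
      using d by (intro summable_mult) (simp add: summable_iff_shift)
    have sf: "summable (\<lambda>n. norm (f i (n + N)))"
      by (rule summable_comparison_test'[OF sd]) (use bound in auto)
    have "G i - (\<Sum>n<N. f i n) = (\<Sum>n. f i (n + N))"
      using suminf_minus_initial_segment[OF sums_summable[OF G], of i N] sums_unique[OF G[of i]]
      by simp
    also have "norm \<dots> \<le> (\<Sum>n. c i * d (n + N))"
      by (rule order_trans[OF summable_norm[OF sf]]) (intro suminf_le sf sd bound)
    also have "\<dots> = c i * t N"
      using suminf_mult[of "\<lambda>n. d (n + N)" "c i"] suminf_minus_initial_segment[OF d, of N] d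
      by (simp add: t_def summable_iff_shift)
    finally show ?thesis .
  qed
  have sct: "summable (\<lambda>i. c i * t N)" for N
    using c by (rule summable_mult2)
  show SG: "summable G"
    by (rule summable_comparison_test'[OF sct[of 0]]) (use rest[of _ 0] in simp)
  have sf: "summable (\<lambda>i. f i n)" for n
    by (rule summable_comparison_test'[OF summable_mult2[OF c, of "d n"]]) (use bound in simp)
  have est: "norm ((\<Sum>n<N. \<Sum>i. f i n) - (\<Sum>i. G i)) \<le> (\<Sum>i. c i) * t N" for N
  proof -
    have S: "summable (\<lambda>i. \<Sum>n<N. f i n)" by (intro summable_sum sf)
    have sn: "summable (\<lambda>i. norm (G i - (\<Sum>n<N. f i n)))"
      by (rule summable_comparison_test'[OF sct[of N]]) (use rest in simp)
    have "(\<Sum>n<N. \<Sum>i. f i n) = (\<Sum>i. \<Sum>n<N. f i n)"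
      by (rule suminf_sum[symmetric]) (rule sf)
    then have "norm ((\<Sum>n<N. \<Sum>i. f i n) - (\<Sum>i. G i)) = norm (\<Sum>i. G i - (\<Sum>n<N. f i n))"
      using suminf_diff[OF SG S] by (simp add: norm_minus_commute)
    also have "\<dots> \<le> (\<Sum>i. c i * t N)"
      by (rule order_trans[OF summable_norm[OF sn]]) (intro suminf_le sn sct rest)
    also have "\<dots> = (\<Sum>i. c i) * t N" using suminf_mult2[OF c] by simp
    finally show ?thesis .
  qed
  have "t \<longlonglongrightarrow> (\<Sum>n. d n) - (\<Sum>n. d n)"
    unfolding t_def by (intro tendsto_intros summable_LIMSEQ d)
  then have "(\<lambda>N. (\<Sum>i. c i) * t N) \<longlonglongrightarrow> 0"
    using tendsto_mult_right_zero by auto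
  then have "(\<lambda>N. (\<Sum>n<N. \<Sum>i. f i n) - (\<Sum>i. G i)) \<longlonglongrightarrow> 0"
    by (rule Lim_null_comparison[rotated]) (use est in simp)
  then show "(\<lambda>n. \<Sum>i. f i n) sums (\<Sum>i. G i)"
    unfolding sums_def by (rule LIM_zero_cancel)
qed

lemma scaleC_scaleR_commute: "a *\<^sub>C (r *\<^sub>R x) = r *\<^sub>R (a *\<^sub>C (x::'a::complex_vector))"
  by (simp add: scaleR_scaleC scaleC_scaleC mult.commute)

lemma bounded_linear_scaleC_left: "bounded_linear (\<lambda>a. a *\<^sub>C (y::'b::complex_normed_vector))"
proof (rule bounded_linear_intro[where K = "norm y"])
  show "(a + b) *\<^sub>C y = a *\<^sub>C y + b *\<^sub>C y" for a b by (rule scaleC_add_left)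
  show "(r *\<^sub>R a) *\<^sub>C y = r *\<^sub>R (a *\<^sub>C y)" for r a
    by (simp add: scaleR_scaleC scaleC_scaleC scaleC_complex_def)
qed (simp add: norm_scaleC)

text \<open>A convolution of two inverse-square sequences is again bounded by such a sequence. The factor
  \<open>8\<close> makes the constant in \<open>wt_convolution\<close> equal to \<open>1\<close>, so that bounds
  \<open>C * wt n\<close> on coefficients multiply exactly as absolute values do.\<close>

definition wt :: "nat \<Rightarrow> real" where "wt n = 1 / (8 * (real n + 1)\<^sup>2)"

lemma wt_pos: "0 < wt n" and wt_0: "wt 0 = 1/8"
  by (auto simp: wt_def)

lemma sum_inverse_squares_le: "(\<Sum>k\<le>n. 1 / (real k + 1)\<^sup>2) \<le> 2 - 1 / (real n + 1)"
proof (induction n)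
  case (Suc n)
  have "1 / (real n + 2)\<^sup>2 \<le> 1 / ((real n + 1) * (real n + 2))"
    by (intro divide_left_mono) (auto simp: power2_eq_square)
  also have "\<dots> = 1 / (real n + 1) - 1 / (real n + 2)" by (simp add: field_simps)
  finally show ?case using Suc by (simp add: add.commute)
qed simp

lemma summable_wt: "summable wt" and suminf_wt_le: "(\<Sum>n. wt n) \<le> 1/4"
proof -
  have le: "(\<Sum>k<n. wt k) \<le> 1/4" for n
  proof -
    have "(\<Sum>k<n. wt k) \<le> (\<Sum>k\<le>n. wt k)"
      by (rule sum_mono2) (auto intro: less_imp_le wt_pos)
    also have "\<dots> = (\<Sum>k\<le>n. 1 / (real k + 1)\<^sup>2) / 8"
      by (simp add: wt_def sum_divide_distrib mult.commute)
    also have "\<dots> \<le> 2 / 8"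
      by (intro divide_right_mono order_trans[OF sum_inverse_squares_le]) auto
    finally show ?thesis by simp
  qed
  show "summable wt"
    by (rule summableI_nonneg_bounded[OF _ le]) (auto intro: less_imp_le wt_pos)
  then show "(\<Sum>n. wt n) \<le> 1/4"
    by (rule suminf_le_const) (rule le)
qed

text \<open>Write \<open>a = k + 1\<close> and \<open>b = n - k + 1\<close>. As \<open>a + b = n + 2\<close>, the inequality
  \<open>(a + b)\<^sup>2 \<le> 2 * (a\<^sup>2 + b\<^sup>2)\<close> bounds \<open>1 / (a\<^sup>2 * b\<^sup>2)\<close> by a multiple of
  \<open>(1 / a\<^sup>2 + 1 / b\<^sup>2) / (n + 1)\<^sup>2\<close>, and the sum of inverse squares is at most \<open>2\<close>.\<close>

lemma wt_convolution: "(\<Sum>k\<le>n. wt k * wt (n - k)) \<le> wt n"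
proof -
  have term_le: "wt k * wt (n - k) \<le>
      (1 / (32 * (real n + 1)\<^sup>2)) * (1 / (real k + 1)\<^sup>2 + 1 / (real (n - k) + 1)\<^sup>2)" if "k \<le> n" for k
  proof -
    define a b where "a = real k + 1" and "b = real (n - k) + 1"
    have frac: "(2 * u) / (64 * v * w) = (1 / (32 * v)) * (u / w)" for u v w :: real by simp
    have ab: "a > 0" "b > 0" "a + b = real n + 2" using that by (auto simp: a_def b_def of_nat_diff)
    have "(a + b)\<^sup>2 \<le> 2 * (a\<^sup>2 + b\<^sup>2)"
      using sum_squares_bound[of a b] by (simp add: power2_sum)
    moreover have "(real n + 1)\<^sup>2 \<le> (a + b)\<^sup>2" unfolding ab(3) by (intro power_mono) auto
    ultimately have le: "(real n + 1)\<^sup>2 \<le> 2 * (a\<^sup>2 + b\<^sup>2)" by linarith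
    have eq: "1 / a\<^sup>2 + 1 / b\<^sup>2 = (a\<^sup>2 + b\<^sup>2) / (a\<^sup>2 * b\<^sup>2)" using ab by (simp add: field_simps)
    have "wt k * wt (n - k) = 1 / (64 * (a\<^sup>2 * b\<^sup>2))" by (simp add: wt_def a_def b_def)
    also have "\<dots> \<le> (1 / (32 * (real n + 1)\<^sup>2)) * ((a\<^sup>2 + b\<^sup>2) / (a\<^sup>2 * b\<^sup>2))"
    proof -
      have "1 / (64 * (a\<^sup>2 * b\<^sup>2)) = (real n + 1)\<^sup>2 / (64 * (real n + 1)\<^sup>2 * (a\<^sup>2 * b\<^sup>2))" by simp
      also have "\<dots> \<le> (2 * (a\<^sup>2 + b\<^sup>2)) / (64 * (real n + 1)\<^sup>2 * (a\<^sup>2 * b\<^sup>2))"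
        using le by (intro divide_right_mono) auto
      also have "\<dots> = (1 / (32 * (real n + 1)\<^sup>2)) * ((a\<^sup>2 + b\<^sup>2) / (a\<^sup>2 * b\<^sup>2))"
        using frac[of "a\<^sup>2 + b\<^sup>2" "(real n + 1)\<^sup>2" "a\<^sup>2 * b\<^sup>2"] by simp
      finally show ?thesis .
    qed
    finally show ?thesis unfolding eq[unfolded a_def b_def] unfolding a_def b_def .
  qed
  have refl: "(\<Sum>k\<le>n. 1 / (real (n - k) + 1)\<^sup>2) = (\<Sum>k\<le>n. 1 / (real k + 1)\<^sup>2)"
    by (rule sum.reindex_bij_witness[where i = "\<lambda>k. n - k" and j = "\<lambda>k. n - k"]) auto
  have two: "(\<Sum>k\<le>n. 1 / (real k + 1)\<^sup>2) \<le> 2"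
    by (rule order_trans[OF sum_inverse_squares_le]) auto
  have "(\<Sum>k\<le>n. wt k * wt (n - k)) \<le>
      (\<Sum>k\<le>n. (1 / (32 * (real n + 1)\<^sup>2)) * (1 / (real k + 1)\<^sup>2 + 1 / (real (n - k) + 1)\<^sup>2))"
    by (rule sum_mono) (use term_le in auto)
  also have "\<dots> = (1 / (32 * (real n + 1)\<^sup>2)) * (2 * (\<Sum>k\<le>n. 1 / (real k + 1)\<^sup>2))"
    unfolding sum_distrib_left[symmetric] sum.distrib refl by simp
  also have "\<dots> \<le> (1 / (32 * (real n + 1)\<^sup>2)) * (2 * 2)"
    using two by (intro mult_left_mono) auto
  also have "\<dots> = wt n" by (simp add: wt_def)
  finally show ?thesis .
qed

section \<open>Germs of analytic functions\<close>

text \<open>Only additivity is recorded: together with a bound by a product of norms it implies homogeneity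
  over the reals (see \<open>additive_real_homogeneous\<close>).\<close>

definition madd :: "nat \<Rightarrow> ('a::ab_group_add list \<Rightarrow> 'b::ab_group_add) \<Rightarrow> bool"
  where "madd n A \<longleftrightarrow> (\<forall>us vs x y. Suc (length us + length vs) = n \<longrightarrow>
    A (us @ (x + y) # vs) = A (us @ x # vs) + A (us @ y # vs))"

lemma maddD: "madd n A \<Longrightarrow> Suc (length us + length vs) = n \<Longrightarrow>
    A (us @ (x + y) # vs) = A (us @ x # vs) + A (us @ y # vs)"
  by (simp add: madd_def)

lemma madd_zero: assumes "madd n A" "Suc (length us + length vs) = n" shows "A (us @ 0 # vs) = 0"
  using maddD[OF assms, of 0 0] by simp

lemma madd_zero_replicate: "madd n A \<Longrightarrow> 0 < n \<Longrightarrow> A (replicate n 0) = 0"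
  using madd_zero[of n A "[]" "replicate (n - 1) 0"] by (cases n) auto

locale normed_by =
  fixes p :: "'a::complex_vector \<Rightarrow> real"
  assumes is_norm: "is_norm p"
begin

lemma p_nonneg [simp]: "0 \<le> p x" and p_eq_0 [simp]: "p x = 0 \<longleftrightarrow> x = 0"
  and p_triangle: "p (x + y) \<le> p x + p y" and p_scaleR [simp]: "p (r *\<^sub>R x) = \<bar>r\<bar> * p x"
  using is_norm by (auto simp: is_norm_def scaleR_scaleC)

lemma p_zero [simp]: "p 0 = 0" by simp

lemma p_minus [simp]: "p (- x) = p x"
  using is_norm by (rule is_norm_uminus)

definition pr :: "real \<Rightarrow> 'a list \<Rightarrow> real"
  where "pr r xs = (\<Prod>x\<leftarrow>xs. p x / r)"

lemma pr_simps [simp]: "pr r [] = 1" "pr r (x # xs) = p x / r * pr r xs"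
    "pr r (xs @ ys) = pr r xs * pr r ys" "pr r (replicate n x) = (p x / r) ^ n"
  by (auto simp: pr_def prod_list_replicate)

lemma pr_nonneg [simp]: "0 \<le> r \<Longrightarrow> 0 \<le> pr r xs"
  by (induction xs) auto

text \<open>The forms of all degrees are kept in a single function on lists, and they need not be symmetric.
  Thus the product of two germs is a sum over the ways to cut a list in two, and
  infinite sums can be taken form by form, without recovering forms from their
  diagonals.\<close>

definition germ :: "real \<Rightarrow> real \<Rightarrow> ('a \<Rightarrow> 'b::complex_banach) \<Rightarrow> bool"
  where "germ r C G \<longleftrightarrow> 0 < r \<and> (\<exists>A. (\<forall>n. madd n A) \<and>
    (\<forall>xs. norm (A xs) \<le> C * wt (length xs) * pr r xs) \<and>
    (\<forall>h. p h < r \<longrightarrow> (\<lambda>n. A (replicate n h)) sums G h))"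

lemma germI:
  assumes "0 < r" "\<And>n. madd n A" "\<And>xs. norm (A xs) \<le> C * wt (length xs) * pr r xs"
    "\<And>h. p h < r \<Longrightarrow> (\<lambda>n. A (replicate n h)) sums G h"
  shows "germ r C G"
  unfolding germ_def by (intro conjI exI[of _ A] allI impI assms)

lemma germE:
  assumes "germ r C G"
  obtains A where "0 < r" "\<And>n. madd n A" "\<And>xs. norm (A xs) \<le> C * wt (length xs) * pr r xs"
    "\<And>h. p h < r \<Longrightarrow> (\<lambda>n. A (replicate n h)) sums G h" "0 \<le> C"
proof -
  obtain A where A: "0 < r" "\<And>n. madd n A" "\<And>xs. norm (A xs) \<le> C * wt (length xs) * pr r xs"
    "\<And>h. p h < r \<Longrightarrow> (\<lambda>n. A (replicate n h)) sums G h"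
    using assms unfolding germ_def by blast
  have "0 \<le> C" using A(3)[of "[]"] by (simp add: wt_0) (smt (verit) norm_ge_zero)
  then show ?thesis using A that by blast
qed

lemma pr_diag_le: "p h < r \<Longrightarrow> (p h / r) ^ n \<le> 1"
proof -
  assume "p h < r"
  then have "0 < r" using p_nonneg[of h] by linarith
  then show ?thesis using \<open>p h < r\<close> by (intro power_le_one) auto
qed

lemma diag_bound:
  assumes "0 \<le> C" "\<And>xs. norm (A xs) \<le> C * wt (length xs) * pr r xs" "p h < r"
  shows "norm (A (replicate n h)) \<le> C * wt n"
proof -
  have "norm (A (replicate n h)) \<le> C * wt n * (p h / r) ^ n" using assms(2)[of "replicate n h"] by simp
  also have "\<dots> \<le> C * wt n * 1"
    using assms pr_diag_le[OF assms(3)] wt_pos[of n] by (intro mult_left_mono) auto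
  finally show ?thesis by simp
qed

lemma germ_cong:
  assumes "germ r C G" "\<And>h. p h < r \<Longrightarrow> G h = G' h" shows "germ r C G'"
  using assms unfolding germ_def by auto

lemma germ_mono:
  assumes "germ r C G" "0 < r'" "r' \<le> r" "C \<le> C'" shows "germ r' C' G"
proof -
  obtain A where A: "0 < r" "\<And>n. madd n A" "\<And>xs. norm (A xs) \<le> C * wt (length xs) * pr r xs"
    "\<And>h. p h < r \<Longrightarrow> (\<lambda>n. A (replicate n h)) sums G h" "0 \<le> C"
    using assms(1) by (rule germE) blast
  have pr: "pr r xs \<le> pr r' xs" for xs
  proof (induction xs)
    case (Cons x xs)
    have "p x / r * pr r xs \<le> p x / r' * pr r' xs"
      using assms A(1) Cons by (intro mult_mono divide_left_mono) auto
    then show ?case by simp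
  qed simp
  show ?thesis
  proof (rule germI[OF assms(2) A(2)])
    show "norm (A xs) \<le> C' * wt (length xs) * pr r' xs" for xs
      using assms A(1,5) wt_pos[of "length xs"]
      by (intro order_trans[OF A(3)] mult_mono pr) auto
    show "(\<lambda>n. A (replicate n h)) sums G h" if "p h < r'" for h
      using that assms A(4) by auto
  qed
qed

lemma germ_norm_le: assumes "germ r C G" "p h < r" shows "norm (G h) \<le> C"
proof -
  obtain A where A: "0 < r" "\<And>n. madd n A" "\<And>xs. norm (A xs) \<le> C * wt (length xs) * pr r xs"
    "\<And>h. p h < r \<Longrightarrow> (\<lambda>n. A (replicate n h)) sums G h" "0 \<le> C"
    using assms(1) by (rule germE) blast
  note d = diag_bound[OF A(5,3) assms(2)]
  have s: "summable (\<lambda>n. C * wt n)" by (intro summable_mult summable_wt)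
  have sn: "summable (\<lambda>n. norm (A (replicate n h)))"
    by (rule summable_comparison_test'[OF s]) (use d in simp)
  have "norm (G h) = norm (\<Sum>n. A (replicate n h))" using A(4)[OF assms(2)] by (simp add: sums_iff)
  also have "\<dots> \<le> (\<Sum>n. C * wt n)"
    by (rule order_trans[OF summable_norm[OF sn]]) (intro suminf_le sn s d)
  also have "\<dots> = C * (\<Sum>n. wt n)" by (rule suminf_mult[OF summable_wt])
  also have "\<dots> \<le> C * 1" using A(5) suminf_wt_le by (intro mult_left_mono) auto
  finally show ?thesis by simp
qed

text \<open>The factor \<open>8\<close> is \<open>1 / wt 0\<close>.\<close>

lemma germ_const: assumes "0 < r" shows "germ r (8 * norm c) (\<lambda>h. c)"
proof (rule germI[OF assms, where A = "\<lambda>xs. if xs = [] then c else 0"])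
  show "norm (if xs = [] then c else 0) \<le> 8 * norm c * wt (length xs) * pr r xs" for xs
    using assms wt_pos[of "length xs"] by (auto simp: wt_0)
  show "(\<lambda>n. if replicate n h = [] then c else 0) sums c" for h :: 'a
    using sums_If_finite_set[of "{0::nat}" "\<lambda>_. c"] by simp
qed (simp add: madd_def)

lemma germ_bounded_linear:
  assumes "germ r C G" "bounded_linear L" "0 \<le> K" "\<And>y. norm (L y) \<le> K * norm y"
  shows "germ r (K * C) (\<lambda>h. L (G h))"
proof -
  obtain A where A: "0 < r" "\<And>n. madd n A" "\<And>xs. norm (A xs) \<le> C * wt (length xs) * pr r xs"
    "\<And>h. p h < r \<Longrightarrow> (\<lambda>n. A (replicate n h)) sums G h" "0 \<le> C"
    using assms(1) by (rule germE) blast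
  interpret L: bounded_linear L by fact
  show ?thesis
  proof (rule germI[OF A(1), where A = "\<lambda>xs. L (A xs)"])
    show "madd n (\<lambda>xs. L (A xs))" for n using A(2)[of n] by (auto simp: madd_def L.add)
    show "norm (L (A xs)) \<le> K * C * wt (length xs) * pr r xs" for xs
      using mult_left_mono[OF A(3) assms(3), of xs] assms(4)[of "A xs"] by (simp add: mult.assoc)
    show "(\<lambda>n. L (A (replicate n h))) sums L (G h)" if "p h < r" for h
      using A(4)[OF that] by (rule L.sums)
  qed
qed

lemma germ_suminf:
  fixes G :: "nat \<Rightarrow> 'a \<Rightarrow> 'b::complex_banach"
  assumes "\<And>i. germ r (C i) (G i)" "summable C"
  shows "germ r (\<Sum>i. C i) (\<lambda>h. \<Sum>i. G i h)"
    and "\<And>h. p h < r \<Longrightarrow> summable (\<lambda>i. G i h)"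
proof -
  have "\<forall>i. \<exists>A. 0 < r \<and> (\<forall>n. madd n A) \<and> (\<forall>xs. norm (A xs) \<le> C i * wt (length xs) * pr r xs) \<and>
    (\<forall>h. p h < r \<longrightarrow> (\<lambda>n. A (replicate n h)) sums G i h) \<and> 0 \<le> C i"
  proof
    fix i show "\<exists>A. 0 < r \<and> (\<forall>n. madd n A) \<and> (\<forall>xs. norm (A xs) \<le> C i * wt (length xs) * pr r xs) \<and>
      (\<forall>h. p h < r \<longrightarrow> (\<lambda>n. A (replicate n h)) sums G i h) \<and> 0 \<le> C i"
      using assms(1)[of i] by (rule germE) blast
  qed
  then obtain A where A: "0 < r" "\<And>i n. madd n (A i)"
    "\<And>i xs. norm (A i xs) \<le> C i * wt (length xs) * pr r xs"
    "\<And>i h. p h < r \<Longrightarrow> (\<lambda>n. A i (replicate n h)) sums G i h" "\<And>i. 0 \<le> C i"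
    by metis
  have sC: "summable (\<lambda>i. C i * wt (length xs) * pr r xs)" for xs
    using assms(2) by (intro summable_mult2)
  have sn: "summable (\<lambda>i. norm (A i xs))" for xs
    by (rule summable_comparison_test'[OF sC[of xs]]) (use A(3) in simp)
  note sA = summable_norm_cancel[OF sn]
  have db: "norm (A i (replicate n h)) \<le> C i * wt n" if "p h < r" for i n h
    by (rule diag_bound[OF A(5) A(3) that])
  note ds = double_sums[where c = C and d = wt, OF db assms(2) summable_wt A(5) A(4)]
  show "germ r (\<Sum>i. C i) (\<lambda>h. \<Sum>i. G i h)"
  proof (rule germI[OF A(1), where A = "\<lambda>xs. \<Sum>i. A i xs"])
    show "madd n (\<lambda>xs. \<Sum>i. A i xs)" for n
      unfolding madd_def by (auto simp: suminf_add[OF sA sA] maddD[OF A(2)])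
    show "norm (\<Sum>i. A i xs) \<le> (\<Sum>i. C i) * wt (length xs) * pr r xs" for xs
    proof -
      have "norm (\<Sum>i. A i xs) \<le> (\<Sum>i. C i * wt (length xs) * pr r xs)"
        by (rule order_trans[OF summable_norm[OF sn]]) (intro suminf_le sn sC A(3))
      also have "\<dots> = (\<Sum>i. C i) * wt (length xs) * pr r xs"
        using suminf_mult2[OF assms(2), of "wt (length xs) * pr r xs"] by (simp add: mult.assoc)
      finally show ?thesis .
    qed
    show "(\<lambda>n. \<Sum>i. A i (replicate n h)) sums (\<Sum>i. G i h)" if "p h < r" for h
      by (rule ds(2)[OF that that])
  qed
  show "summable (\<lambda>i. G i h)" if "p h < r" for h
    by (rule ds(1)[OF that that])
qed

lemma germ_add:
  assumes "germ r C G" "germ r D F"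
  shows "germ r (C + D) (\<lambda>h. G h + F h)"
proof -
  define E where "E i = (if i = 0 then C else if i = 1 then D else 0)" for i :: nat
  define K where "K i = (if i = 0 then G else if i = 1 then F else (\<lambda>h. 0))" for i :: nat
  have two: "(\<lambda>i. if i = 0 then a else if i = 1 then b else 0) sums (a + b)"
    for a b :: "'c::real_normed_vector"
    using sums_finite[of "{0,1::nat}" "\<lambda>i. if i = 0 then a else if i = 1 then b else 0"] by simp
  have r: "0 < r" using assms(1) by (simp add: germ_def)
  have "germ r (E i) (K i)" for i
    using assms germ_const[OF r, of "0::'b"] by (auto simp: E_def K_def)
  moreover have "E sums (C + D)" unfolding E_def by (rule two)
  moreover have "(\<lambda>i. K i h) sums (G h + F h)" for h
    using two[of "G h" "F h"] by (rule subst[where P = "\<lambda>f. f sums _", rotated]) (auto simp: K_def)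
  ultimately have "germ r (C + D) (\<lambda>h. \<Sum>i. K i h)" "(\<Sum>i. K i h) = G h + F h" for h
    using germ_suminf(1)[of r E K] by (auto simp: sums_iff)
  then show ?thesis by simp
qed

lemma germ_sum:
  assumes "finite I" "0 < r" "\<And>i. i \<in> I \<Longrightarrow> germ r (C i) (G i)"
  shows "germ r (\<Sum>i\<in>I. C i) (\<lambda>h. \<Sum>i\<in>I. G i h)"
  using assms(1,3)
proof (induction I)
  case empty
  then show ?case using germ_const[OF assms(2), of 0] by simp
next
  case (insert i I)
  then show ?case using germ_add[of r "C i" "G i"] by simp
qed

lemma germ_cmult:
  assumes "germ r C (G :: 'a \<Rightarrow> complex)"
  shows "germ r (cmod c * C) (\<lambda>h. c * G h)"
  by (rule germ_bounded_linear[OF assms bounded_linear_mult_right[of c] norm_ge_zero])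
    (rule eq_refl[OF norm_mult])

lemma germ_cnj:
  assumes "germ r C G" shows "germ r C (\<lambda>h. cnj (G h))"
  using germ_bounded_linear[OF assms bounded_linear_cnj, of 1] by simp

lemma germ_scaleC:
  fixes y :: "'b::complex_banach"
  assumes "germ r C G" shows "germ r (norm y * C) (\<lambda>h. G h *\<^sub>C y)"
  by (rule germ_bounded_linear[OF assms bounded_linear_scaleC_left[of y] norm_ge_zero])
    (simp add: norm_scaleC)

lemma germ_mult:
  assumes "germ r C F" "germ r D (G :: 'a \<Rightarrow> complex)"
  shows "germ r (C * D) (\<lambda>h. F h * G h)"
proof -
  obtain A where A: "0 < r" "\<And>n. madd n A" "\<And>xs. norm (A xs) \<le> C * wt (length xs) * pr r xs"
    "\<And>h. p h < r \<Longrightarrow> (\<lambda>n. A (replicate n h)) sums F h" "0 \<le> C"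
    using assms(1) by (rule germE) blast
  obtain B where B: "\<And>n. madd n B" "\<And>xs. norm (B xs) \<le> D * wt (length xs) * pr r xs"
    "\<And>h. p h < r \<Longrightarrow> (\<lambda>n. B (replicate n h)) sums G h" "0 \<le> D"
    using assms(2) by (rule germE) blast
  define P where "P xs = (\<Sum>k\<le>length xs. A (take k xs) * B (drop k xs))" for xs
  show ?thesis
  proof (rule germI[OF A(1), where A = P])
    show "madd n P" for n
      unfolding madd_def
    proof (intro allI impI)
      fix us vs :: "'a list" and x y :: 'a
      have "A (take k (us @ (x + y) # vs)) * B (drop k (us @ (x + y) # vs)) =
          A (take k (us @ x # vs)) * B (drop k (us @ x # vs)) +
          A (take k (us @ y # vs)) * B (drop k (us @ y # vs))" for k
      proof (cases "k \<le> length us")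
        case True
        then show ?thesis
          using maddD[OF B(1) refl, of "drop k us" x y vs] by (simp add: distrib_left)
      next
        case False
        then obtain l where "k - length us = Suc l" by (cases "k - length us") auto
        then show ?thesis using False
          maddD[OF A(2) refl, of us x y "take l vs"] by (simp add: distrib_right)
      qed
      then show "P (us @ (x + y) # vs) = P (us @ x # vs) + P (us @ y # vs)"
        by (simp add: P_def sum.distrib)
    qed
    show "norm (P xs) \<le> C * D * wt (length xs) * pr r xs" for xs
    proof -
      have le: "norm (A (take k xs) * B (drop k xs)) \<le>
          C * D * pr r xs * (wt k * wt (length xs - k))" if "k \<le> length xs" for k
      proof -
        have "pr r xs = pr r (take k xs) * pr r (drop k xs)" by (simp flip: pr_simps(3))
        moreover have "norm (A (take k xs) * B (drop k xs)) \<le>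
          (C * wt (length (take k xs)) * pr r (take k xs)) * (D * wt (length (drop k xs)) * pr r (drop k xs))"
          unfolding norm_mult using A(1,5) wt_pos[of "length (take k xs)"]
          by (intro mult_mono A(3) B(2)) (auto intro!: mult_nonneg_nonneg less_imp_le wt_pos)
        ultimately show ?thesis using that by (simp add: min_absorb2 mult_ac)
      qed
      have "norm (P xs) \<le> (\<Sum>k\<le>length xs. C * D * pr r xs * (wt k * wt (length xs - k)))"
        unfolding P_def by (rule sum_norm_le) (use le in auto)
      also have "\<dots> \<le> C * D * pr r xs * wt (length xs)"
        unfolding sum_distrib_left[symmetric] using A(1,5) B(4)
        by (intro mult_left_mono wt_convolution) auto
      finally show ?thesis by (simp add: mult_ac)
    qed
    show "(\<lambda>n. P (replicate n h)) sums (F h * G h)" if h: "p h < r" for h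
    proof -
      have "summable (\<lambda>n. norm (A (replicate n h)))"
        by (rule summable_comparison_test'[OF summable_mult[OF summable_wt, of C]])
          (use diag_bound[OF A(5,3) h] in simp)
      moreover have "summable (\<lambda>n. norm (B (replicate n h)))"
        by (rule summable_comparison_test'[OF summable_mult[OF summable_wt, of D]])
          (use diag_bound[OF B(4,2) h] in simp)
      ultimately have "(\<lambda>n. \<Sum>k\<le>n. A (replicate k h) * B (replicate (n - k) h)) sums
          ((\<Sum>n. A (replicate n h)) * (\<Sum>n. B (replicate n h)))"
        by (rule Cauchy_product_sums)
      then show ?thesis
        using A(4)[OF h] B(3)[OF h] by (simp add: P_def sums_unique[symmetric] min_absorb1)
    qed
  qed
qed

text \<open>The factor \<open>8\<close> is needed for exponent \<open>0\<close> only, where the power is a constant.\<close>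

lemma germ_power:
  assumes "germ r C (G :: 'a \<Rightarrow> complex)"
  shows "germ r (8 * C ^ k) (\<lambda>h. G h ^ k)"
proof -
  have r: "0 < r" using assms by (simp add: germ_def)
  have C: "0 \<le> C" using assms by (rule germE)
  have "germ r (C ^ Suc k) (\<lambda>h. G h ^ Suc k)" for k
  proof (induction k)
    case (Suc k)
    then show ?case using germ_mult[OF assms] by simp
  qed (use assms in simp)
  then have S: "germ r (8 * C ^ Suc k) (\<lambda>h. G h ^ Suc k)" for k
    by (rule germ_mono[OF _ r order_refl]) (use C in auto)
  show ?thesis
  proof (cases k)
    case 0
    then show ?thesis using germ_const[OF r, of "1::complex"] by simp
  next
    case (Suc l)
    then show ?thesis using S[of l] by simp
  qed
qed

text \<open>All powers have the same radius, so the composition is an infinite sum of germs, whatever the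
  constant term of \<open>G\<close> is.\<close>

lemma germ_compose:
  assumes "germ r C (G :: 'a \<Rightarrow> complex)" "(\<lambda>k. cmod (c k) * C ^ k) sums s"
  shows "germ r (8 * s) (\<lambda>h. \<Sum>k. c k * G h ^ k)"
proof -
  have "germ r (cmod (c k) * (8 * C ^ k)) (\<lambda>h. c k * G h ^ k)" for k
    by (intro germ_cmult germ_power assms(1))
  moreover have "(\<lambda>k. cmod (c k) * (8 * C ^ k)) sums (8 * s)"
    using sums_mult[OF assms(2), of 8] by (simp add: mult_ac)
  ultimately show ?thesis
    using germ_suminf(1)[of r "\<lambda>k. cmod (c k) * (8 * C ^ k)" "\<lambda>k h. c k * G h ^ k"]
    by (simp add: sums_iff)
qed

lemma germ_exp:
  assumes "germ r C (G :: 'a \<Rightarrow> complex)" shows "germ r (8 * exp C) (\<lambda>h. exp (G h))"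
proof -
  have "(\<lambda>k. cmod (1 / fact k) * C ^ k) sums exp C"
    using exp_converges[of C] by (simp add: norm_divide field_simps)
  from germ_compose[OF assms this] show ?thesis
    by (simp add: exp_def scaleR_conv_of_real field_simps)
qed

lemma germ_inverse:
  assumes "germ r C (G :: 'a \<Rightarrow> complex)" "C < 1"
  shows "germ r (8 / (1 - C)) (\<lambda>h. 1 / (1 - G h))"
proof -
  have C: "0 \<le> C" using assms(1) by (rule germE)
  have "(\<lambda>k. cmod 1 * C ^ k) sums (1 / (1 - C))" using geometric_sums[of C] C assms(2) by simp
  from germ_compose[OF assms(1) this] have "germ r (8 / (1 - C)) (\<lambda>h. \<Sum>k. 1 * G h ^ k)" by simp
  then show ?thesis
  proof (rule germ_cong)
    fix h assume "p h < r"
    then have "cmod (G h) < 1" using germ_norm_le[OF assms(1)] assms(2) by fastforce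
    then show "(\<Sum>k. 1 * G h ^ k) = 1 / (1 - G h)" by (simp add: suminf_geometric)
  qed
qed

text \<open>Every form of positive degree gains a factor \<open>t\<close> when the radius shrinks by \<open>t\<close>. This is the
  continuity statement used below to make perturbations small.\<close>

lemma germ_increment:
  fixes G :: "'a \<Rightarrow> 'b::complex_banach"
  assumes "germ r C G" "0 < t" "t \<le> 1"
  shows "germ (t * r) (t * C) (\<lambda>h. G h - G 0)"
proof -
  obtain A where A: "0 < r" "\<And>n. madd n A" "\<And>xs. norm (A xs) \<le> C * wt (length xs) * pr r xs"
    "\<And>h. p h < r \<Longrightarrow> (\<lambda>n. A (replicate n h)) sums G h" "0 \<le> C"
    using assms(1) by (rule germE) blast
  define B where "B xs = (if xs = [] then 0 else A xs)" for xs
  have G0: "G 0 = A []"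
  proof -
    have "(\<lambda>n. A (replicate n 0)) sums A []"
      using sums_finite[of "{0::nat}" "\<lambda>n. A (replicate n 0)"] madd_zero_replicate[OF A(2)] by simp
    then show ?thesis using A(4)[of 0] A(1) sums_unique2 by fastforce
  qed
  have pr: "pr r xs \<le> t * pr (t * r) xs" if "xs \<noteq> []" for xs
  proof -
    have eq: "pr r xs = t ^ length xs * pr (t * r) xs" for xs
      using assms(2) by (induction xs) (auto simp: field_simps)
    have "t ^ length xs \<le> t ^ 1" using assms that by (intro power_decreasing) (auto simp: Suc_le_eq)
    then show ?thesis unfolding eq using assms A(1) by (intro mult_right_mono) auto
  qed
  show ?thesis
  proof (rule germI[where A = B])
    show "0 < t * r" using assms A(1) by simp
    show "madd n B" for n using A(2)[of n] by (auto simp: madd_def B_def)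
    show "norm (B xs) \<le> t * C * wt (length xs) * pr (t * r) xs" for xs
    proof (cases "xs = []")
      case False
      have "norm (A xs) \<le> C * wt (length xs) * pr r xs" by (rule A(3))
      also have "\<dots> \<le> C * wt (length xs) * (t * pr (t * r) xs)"
        using A(5) wt_pos[of "length xs"] False by (intro mult_left_mono pr) auto
      finally show ?thesis using False by (simp add: B_def mult_ac)
    qed (use assms A(5) wt_pos[of 0] in \<open>simp add: B_def\<close>)
    show "(\<lambda>n. B (replicate n h)) sums (G h - G 0)" if "p h < t * r" for h
    proof -
      have "t * r \<le> 1 * r" using assms A(1) by (intro mult_right_mono) auto
      then have "(\<lambda>n. A (replicate n h)) sums G h" using that A(4) by simp
      moreover have "(\<lambda>n. if n = 0 then A [] else 0) sums A []"
        using sums_single[of 0 "\<lambda>_. A []"] by simp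
      ultimately have "(\<lambda>n. A (replicate n h) - (if n = 0 then A [] else 0)) sums (G h - A [])"
        by (rule sums_diff)
      moreover have "A (replicate n h) - (if n = 0 then A [] else 0) = B (replicate n h)" for n
        by (simp add: B_def)
      ultimately show ?thesis by (simp add: G0)
    qed
  qed
qed

lemma germ_rescale:
  assumes "germ r C G" "0 < d"
  shows "germ (d * r) C (\<lambda>h. G (h /\<^sub>R d))"
proof -
  obtain A where A: "0 < r" "\<And>n. madd n A" "\<And>xs. norm (A xs) \<le> C * wt (length xs) * pr r xs"
    "\<And>h. p h < r \<Longrightarrow> (\<lambda>n. A (replicate n h)) sums G h" "0 \<le> C"
    using assms(1) by (rule germE) blast
  show ?thesis
  proof (rule germI[where A = "\<lambda>xs. A (map (\<lambda>x. x /\<^sub>R d) xs)"])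
    show "0 < d * r" using A assms by simp
    show "madd n (\<lambda>xs. A (map (\<lambda>x. x /\<^sub>R d) xs))" for n
      using A(2)[of n] by (auto simp: madd_def scaleR_add_right)
    have "pr r (map (\<lambda>x. x /\<^sub>R d) xs) = pr (d * r) xs" for xs
      using assms(2) by (induction xs) (auto simp: field_simps)
    then show "norm (A (map (\<lambda>x. x /\<^sub>R d) xs)) \<le> C * wt (length xs) * pr (d * r) xs" for xs
      using A(3)[of "map (\<lambda>x. x /\<^sub>R d) xs"] by simp
    show "(\<lambda>n. A (map (\<lambda>x. x /\<^sub>R d) (replicate n h))) sums G (h /\<^sub>R d)" if "p h < d * r" for h
      using A(4)[of "h /\<^sub>R d"] that assms(2) by (simp add: field_simps)
  qed
qed

end

section \<open>Real multilinear forms and star polynomials\<close>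

text \<open>The defect \<open>g (r *\<^sub>R x) - r *\<^sub>R g x\<close> is multiplied by \<open>N\<close> when \<open>r\<close> is, but splitting \<open>N * r\<close> into
  integer and fractional part shows that it stays bounded.\<close>

lemma additive_real_homogeneous:
  fixes g :: "'a::real_vector \<Rightarrow> 'b::real_normed_vector"
  assumes add: "\<And>x y. g (x + y) = g x + g y"
    and bound: "\<And>u. 0 \<le> u \<Longrightarrow> u \<le> 1 \<Longrightarrow> norm (g (u *\<^sub>R x)) \<le> K"
  shows "g (r *\<^sub>R x) = r *\<^sub>R g x"
proof -
  have g0: "g 0 = 0" using add[of 0 0] by simp
  have gm: "g (- y) = - g y" for y using add[of y "- y"] g0 by (simp add: add_eq_0_iff)
  have gn: "g (real n *\<^sub>R y) = real n *\<^sub>R g y" for n y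
    by (induction n) (auto simp: g0 add scaleR_add_left)
  have gi: "g (real_of_int s *\<^sub>R y) = real_of_int s *\<^sub>R g y" for s y
  proof (cases "0 \<le> s")
    case True
    then show ?thesis using gn[of "nat s" y] by simp
  next
    case False
    then show ?thesis using gn[of "nat (- s)" y] gm[of "real_of_int s *\<^sub>R y"] by simp
  qed
  have le: "real N * norm (g (r *\<^sub>R x) - r *\<^sub>R g x) \<le> K + norm (g x)" for N
  proof -
    define s where "s = \<lfloor>real N * r\<rfloor>"
    define u where "u = real N * r - real_of_int s"
    have u: "0 \<le> u" "u \<le> 1" unfolding u_def s_def by linarith+
    have "real N *\<^sub>R r *\<^sub>R x = real_of_int s *\<^sub>R x + u *\<^sub>R x"
      by (simp add: u_def scaleR_add_left[symmetric])
    then have "real N *\<^sub>R g (r *\<^sub>R x) = real_of_int s *\<^sub>R g x + g (u *\<^sub>R x)"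
      using gn[of N "r *\<^sub>R x"] by (simp add: add gi)
    then have "real N *\<^sub>R (g (r *\<^sub>R x) - r *\<^sub>R g x) = g (u *\<^sub>R x) - u *\<^sub>R g x"
      by (simp add: u_def scaleR_diff_right scaleR_diff_left)
    moreover have "norm (g (u *\<^sub>R x) - u *\<^sub>R g x) \<le> K + 1 * norm (g x)"
      using u by (intro order_trans[OF norm_triangle_ineq4] add_mono bound)
        (auto intro: mult_right_mono simp: mult_left_le_one_le)
    ultimately have "norm (real N *\<^sub>R (g (r *\<^sub>R x) - r *\<^sub>R g x)) \<le> K + norm (g x)" by simp
    then show ?thesis by simp
  qed
  have "norm (g (r *\<^sub>R x) - r *\<^sub>R g x) = 0"
  proof (rule ccontr)
    assume "norm (g (r *\<^sub>R x) - r *\<^sub>R g x) \<noteq> 0"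
    then obtain N where "K + norm (g x) < real N * norm (g (r *\<^sub>R x) - r *\<^sub>R g x)"
      using reals_Archimedean3[of "norm (g (r *\<^sub>R x) - r *\<^sub>R g x)"] by auto
    then show False using le[of N] by simp
  qed
  then show ?thesis by simp
qed

lemma scaleC_zero_right [simp]: "a *\<^sub>C (0::'a::complex_vector) = 0"
  using scaleC_add_right[of a 0 "0::'a"] by simp

lemma scaleC_zero_left [simp]: "0 *\<^sub>C (x::'a::complex_vector) = 0"
  using scaleC_add_left[of 0 0 x] by simp

lemma scaleC_minus_right: "a *\<^sub>C (- x) = - (a *\<^sub>C (x::'a::complex_vector))"
  using scaleC_add_right[of a x "- x"] by (simp add: add_eq_0_iff)

lemma scaleC_minus_left: "(- a) *\<^sub>C x = - (a *\<^sub>C (x::'a::complex_vector))"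
  using scaleC_add_left[of a "- a" x] by (simp add: add_eq_0_iff)

lemma scaleC_diff_right: "a *\<^sub>C (x - y) = a *\<^sub>C x - a *\<^sub>C (y::'a::complex_vector)"
  using scaleC_add_right[of a x "- y"] by (simp add: scaleC_minus_right)

lemma complex_scaleC_eq: "c *\<^sub>C (x::'a::complex_vector) = Re c *\<^sub>R x + Im c *\<^sub>R (\<i> *\<^sub>C x)"
  by (simp add: scaleR_scaleC scaleC_scaleC scaleC_add_left[symmetric] mult.commute flip: complex_eq)

lemma clinear_map_combine: "clinear_map g \<Longrightarrow> clinear_map h \<Longrightarrow> clinear_map (\<lambda>z. a *\<^sub>C g z + b *\<^sub>C h z)"
  by (auto simp: clinear_map_def scaleC_add_right scaleC_scaleC mult.commute)

lemma antilinear_map_combine: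
  "antilinear_map g \<Longrightarrow> antilinear_map h \<Longrightarrow> antilinear_map (\<lambda>z. a *\<^sub>C g z + b *\<^sub>C h z)"
  by (auto simp: antilinear_map_def scaleC_add_right scaleC_scaleC mult.commute)

lemma linear_combine:
  fixes g h :: "'a::complex_vector \<Rightarrow> 'b::complex_vector"
  shows "linear g \<Longrightarrow> linear h \<Longrightarrow> linear (\<lambda>z. a *\<^sub>C g z + b *\<^sub>C h z)"
  by (auto simp: linear_iff scaleC_add_right scaleC_scaleR_commute scaleR_add_right)

lemma clinear_part:
  fixes g :: "'a::complex_vector \<Rightarrow> 'b::complex_vector"
  assumes "linear g" shows "clinear_map (\<lambda>z. (1/2) *\<^sub>C g z + (- \<i>/2) *\<^sub>C g (\<i> *\<^sub>C z))"
proof -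
  interpret linear g by fact
  have ii: "\<i> *\<^sub>C \<i> *\<^sub>C z = - z" for z :: 'a
    by (simp add: scaleC_scaleC scaleC_minus_left scaleC_one)
  let ?L = "\<lambda>z. (1/2) *\<^sub>C g z + (- \<i>/2) *\<^sub>C g (\<i> *\<^sub>C z)"
  have L: "?L (x + y) = ?L x + ?L y" "?L (r *\<^sub>R x) = r *\<^sub>R ?L x" for x y r
    by (simp_all add: add scaleC_add_right scale scaleC_scaleR_commute scaleR_add_right)
  have Li: "?L (\<i> *\<^sub>C x) = \<i> *\<^sub>C ?L x" for x
    by (simp add: ii neg scaleC_minus_right scaleC_minus_left scaleC_add_right scaleC_diff_right
        scaleC_scaleC scaleC_one)
  have "?L (c *\<^sub>C x) = c *\<^sub>C ?L x" for c x
    unfolding complex_scaleC_eq[of c x] L Li complex_scaleC_eq[of c "?L x"] ..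
  then show ?thesis using L(1) unfolding clinear_map_def by blast
qed

lemma antilinear_part:
  fixes g :: "'a::complex_vector \<Rightarrow> 'b::complex_vector"
  assumes "linear g" shows "antilinear_map (\<lambda>z. (1/2) *\<^sub>C g z + (\<i>/2) *\<^sub>C g (\<i> *\<^sub>C z))"
proof -
  interpret linear g by fact
  have ii: "\<i> *\<^sub>C \<i> *\<^sub>C z = - z" for z :: 'a
    by (simp add: scaleC_scaleC scaleC_minus_left scaleC_one)
  let ?L = "\<lambda>z. (1/2) *\<^sub>C g z + (\<i>/2) *\<^sub>C g (\<i> *\<^sub>C z)"
  have L: "?L (x + y) = ?L x + ?L y" "?L (r *\<^sub>R x) = r *\<^sub>R ?L x" for x y r
    by (simp_all add: add scaleC_add_right scale scaleC_scaleR_commute scaleR_add_right)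
  have Li: "?L (\<i> *\<^sub>C x) = - (\<i> *\<^sub>C ?L x)" for x
    by (simp add: ii neg scaleC_minus_right scaleC_minus_left scaleC_add_right scaleC_diff_right
        scaleC_scaleC scaleC_one)
  have "?L (c *\<^sub>C x) = cnj c *\<^sub>C ?L x" for c x
    unfolding complex_scaleC_eq[of c x] L Li complex_scaleC_eq[of "cnj c" "?L x"] by simp
  then show ?thesis using L(1) unfolding antilinear_map_def by blast
qed

lemma finite_degrees: "finite {(k, m). k + m = (n::nat)}"
  by (rule finite_subset[of _ "{..n} \<times> {..n}"]) auto

lemma km_linearD:
  assumes "km_linear k m B" "length xs = k + m"
  shows "i < k \<Longrightarrow> clinear_map (\<lambda>v. B (xs[i := v]))"
    "k \<le> i \<Longrightarrow> i < k + m \<Longrightarrow> antilinear_map (\<lambda>v. B (xs[i := v]))"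
  using assms unfolding km_linear_def by auto

lemma star_polynomial_terms:
  fixes F :: "'a::complex_vector \<Rightarrow> 'b::complex_vector"
  assumes "star_polynomial n F"
  shows "\<exists>K c. (\<forall>k m. k + m = n \<longrightarrow> km_linear k m (K k m)) \<and>
    (\<forall>x. F x = (\<Sum>(k, m) | k + m = n. c k m *\<^sub>C K k m (replicate n x)))"
proof -
  obtain B where B: "star_n_linear n B" "\<forall>x. F x = B (replicate n x)"
    using assms unfolding star_polynomial_def by blast
  obtain c K where
    "(\<forall>k m. k + m = n \<longrightarrow> c k m \<in> {0, 1::complex} \<and> km_linear k m (K k m)) \<and>
      (\<forall>xs. length xs = n \<longrightarrow> B xs = (\<Sum>(k, m) | k + m = n. c k m *\<^sub>C K k m xs))"
    using B(1) unfolding star_n_linear_def by blast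
  then show ?thesis using B(2) by (intro exI[of _ K] exI[of _ c]) auto
qed

lemma star_polynomialI:
  fixes F :: "'a::complex_vector \<Rightarrow> 'b::complex_vector"
  assumes "\<And>k m. k + m = n \<Longrightarrow> km_linear k m (K k m)"
    "\<And>x. F x = (\<Sum>(k, m) | k + m = n. K k m (replicate n x))"
  shows "star_polynomial n F"
  unfolding star_polynomial_def star_n_linear_def
  by (rule exI[of _ "\<lambda>xs. \<Sum>(k, m) | k + m = n. K k m xs"], intro conjI exI[of _ "\<lambda>_ _. 1"] exI[of _ K])
    (auto simp: assms scaleC_one)

lemma star_polynomial_add:
  fixes F G :: "'a::complex_vector \<Rightarrow> 'b::complex_vector"
  assumes "star_polynomial n F" "star_polynomial n G"
  shows "star_polynomial n (\<lambda>x. F x + G x)"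
proof -
  obtain K c where 1: "\<And>k m. k + m = n \<Longrightarrow> km_linear k m (K k m)"
      "\<And>x. F x = (\<Sum>(k, m) | k + m = n. c k m *\<^sub>C K k m (replicate n x))"
    using star_polynomial_terms[OF assms(1)] by blast
  obtain K' c' where 2: "\<And>k m. k + m = n \<Longrightarrow> km_linear k m (K' k m)"
      "\<And>x. G x = (\<Sum>(k, m) | k + m = n. c' k m *\<^sub>C K' k m (replicate n x))"
    using star_polynomial_terms[OF assms(2)] by blast
  show ?thesis
  proof (rule star_polynomialI)
    show "km_linear k m (\<lambda>xs. c k m *\<^sub>C K k m xs + c' k m *\<^sub>C K' k m xs)" if "k + m = n" for k m
      unfolding km_linear_def
      by (intro allI impI conjI ballI clinear_map_combine antilinear_map_combine
          km_linearD[OF 1(1)[OF that]] km_linearD[OF 2(1)[OF that]]) auto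
    show "F x + G x = (\<Sum>(k, m) | k + m = n.
        c k m *\<^sub>C K k m (replicate n x) + c' k m *\<^sub>C K' k m (replicate n x))" for x
      by (simp add: 1 2 sum.distrib[symmetric] case_prod_unfold)
  qed
qed

definition mixed_multilinear ::
    "nat \<Rightarrow> nat \<Rightarrow> nat \<Rightarrow> ('a::complex_vector list \<Rightarrow> 'a list \<Rightarrow> 'a list \<Rightarrow> 'b::complex_vector) \<Rightarrow> bool"
  where "mixed_multilinear k l m A \<longleftrightarrow>
    (\<forall>us vs ws. length us = k \<longrightarrow> length vs = l \<longrightarrow> length ws = m \<longrightarrow>
      (\<forall>i<k. clinear_map (\<lambda>z. A (us[i := z]) vs ws)) \<and>
      (\<forall>i<l. linear (\<lambda>z. A us (vs[i := z]) ws)) \<and>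
      (\<forall>i<m. antilinear_map (\<lambda>z. A us vs (ws[i := z]))))"

lemma mixed_multilinearD:
  assumes "mixed_multilinear k l m A" "length us = k" "length vs = l" "length ws = m"
  shows "i < k \<Longrightarrow> clinear_map (\<lambda>z. A (us[i := z]) vs ws)"
    "i < l \<Longrightarrow> linear (\<lambda>z. A us (vs[i := z]) ws)"
    "i < m \<Longrightarrow> antilinear_map (\<lambda>z. A us vs (ws[i := z]))"
  using assms unfolding mixed_multilinear_def by blast+

text \<open>A real-linear slot is the sum of its complex-linear and its antilinear part. Splitting the first
  real slot turns it into an additional complex-linear or antilinear slot; the three argument lists make
  it possible to move it to its place, which does not matter on the diagonal.\<close>

lemma star_polynomial_mixed:
  assumes "mixed_multilinear k l m A"
  shows "star_polynomial (k + l + m) (\<lambda>x. A (replicate k x) (replicate l x) (replicate m x))"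
  using assms
proof (induction l arbitrary: k m A)
  case 0
  define L where "L k' m' xs = (if k' = k \<and> m' = m then A (take k xs) [] (drop k xs) else 0)"
    for k' m' xs
  have "km_linear k m (\<lambda>xs. A (take k xs) [] (drop k xs))"
    unfolding km_linear_def
  proof (intro allI impI conjI ballI)
    fix xs :: "'a list" and i
    assume len: "length xs = k + m"
    show "clinear_map (\<lambda>v. A (take k (xs[i := v])) [] (drop k (xs[i := v])))" if "i < k"
      using mixed_multilinearD(1)[OF 0, of "take k xs" "[]" "drop k xs" i] that len
      by (simp add: take_update_swap)
    show "antilinear_map (\<lambda>v. A (take k (xs[i := v])) [] (drop k (xs[i := v])))"
      if "i \<in> {k..<k + m}"
      using mixed_multilinearD(3)[OF 0, of "take k xs" "[]" "drop k xs" "i - k"] that len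
      by (simp add: drop_update_swap) (simp add: less_diff_conv2 add.commute)
  qed
  then have "km_linear k' m' (L k' m')" for k' m'
    unfolding L_def by (cases "k' = k \<and> m' = m") (auto simp: km_linear_def clinear_map_def antilinear_map_def)
  moreover have "A (replicate k x) [] (replicate m x) =
      (\<Sum>(k', m') | k' + m' = k + m. L k' m' (replicate (k + m) x))" for x
  proof -
    have "(\<Sum>(k', m') | k' + m' = k + m. L k' m' (replicate (k + m) x)) =
        (\<Sum>q | fst q + snd q = k + m. if q = (k, m) then A (replicate k x) [] (replicate m x) else 0)"
      by (intro sum.cong) (auto simp: L_def min_def split: if_splits)
    also have "\<dots> = A (replicate k x) [] (replicate m x)"
      using finite_degrees[of "k + m"] by (subst sum.delta) (auto simp: case_prod_unfold)
    finally show ?thesis by simp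
  qed
  ultimately show ?case by (intro star_polynomialI[of _ L]) auto
next
  case (Suc l)
  note A = mixed_multilinearD[OF Suc.prems]
  define A1 where "A1 us vs ws = (1/2) *\<^sub>C A (tl us) (hd us # vs) ws +
    (- \<i>/2) *\<^sub>C A (tl us) (\<i> *\<^sub>C hd us # vs) ws" for us vs ws
  define A2 where "A2 us vs ws = (1/2) *\<^sub>C A us (hd ws # vs) (tl ws) +
    (\<i>/2) *\<^sub>C A us (\<i> *\<^sub>C hd ws # vs) (tl ws)" for us vs ws
  have "mixed_multilinear (Suc k) l m A1"
    unfolding mixed_multilinear_def
  proof (intro allI impI conjI)
    fix us vs ws :: "'a list" and i
    assume len: "length us = Suc k" "length vs = l" "length ws = m"
    then obtain u us' where us: "us = u # us'" "length us' = k" by (auto simp: length_Suc_conv)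
    show "clinear_map (\<lambda>z. A1 (us[i := z]) vs ws)" if "i < Suc k"
    proof (cases i)
      case 0
      then show ?thesis
        using clinear_part[OF A(2)[of us' "u # vs" ws 0]] us len by (simp add: A1_def)
    next
      case (Suc j)
      then show ?thesis unfolding A1_def us using that us len
        by (auto intro!: clinear_map_combine A(1))
    qed
    show "linear (\<lambda>z. A1 us (vs[i := z]) ws)" if "i < l"
      using linear_combine[OF A(2)[of us' "u # vs" ws "Suc i"] A(2)[of us' "\<i> *\<^sub>C u # vs" ws "Suc i"],
          of "1/2" "- \<i>/2"] that us len by (simp add: A1_def)
    show "antilinear_map (\<lambda>z. A1 us vs (ws[i := z]))" if "i < m"
      unfolding A1_def us using that us len by (auto intro!: antilinear_map_combine A(3))
  qed
  note 1 = Suc.IH[OF this]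
  have "mixed_multilinear k l (Suc m) A2"
    unfolding mixed_multilinear_def
  proof (intro allI impI conjI)
    fix us vs ws :: "'a list" and i
    assume len: "length us = k" "length vs = l" "length ws = Suc m"
    then obtain w ws' where ws: "ws = w # ws'" "length ws' = m" by (auto simp: length_Suc_conv)
    show "antilinear_map (\<lambda>z. A2 us vs (ws[i := z]))" if "i < Suc m"
    proof (cases i)
      case 0
      then show ?thesis
        using antilinear_part[OF A(2)[of us "w # vs" ws' 0]] ws len by (simp add: A2_def)
    next
      case (Suc j)
      then show ?thesis unfolding A2_def ws using that ws len
        by (auto intro!: antilinear_map_combine A(3))
    qed
    show "linear (\<lambda>z. A2 us (vs[i := z]) ws)" if "i < l"
      using linear_combine[OF A(2)[of us "w # vs" ws' "Suc i"] A(2)[of us "\<i> *\<^sub>C w # vs" ws' "Suc i"],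
          of "1/2" "\<i>/2"] that ws len by (simp add: A2_def)
    show "clinear_map (\<lambda>z. A2 (us[i := z]) vs ws)" if "i < k"
      unfolding A2_def ws using that ws len by (auto intro!: clinear_map_combine A(1))
  qed
  note 2 = Suc.IH[OF this]
  have half: "(1/2) *\<^sub>C y + (- (\<i>/2)) *\<^sub>C z + ((1/2) *\<^sub>C y + (\<i>/2) *\<^sub>C z) = y" for y z :: 'b
  proof -
    have "(1/2) *\<^sub>C y + (- (\<i>/2)) *\<^sub>C z + ((1/2) *\<^sub>C y + (\<i>/2) *\<^sub>C z) =
        (1/2 + 1/2) *\<^sub>C y + (- (\<i>/2) + \<i>/2) *\<^sub>C z"
      unfolding scaleC_add_left by (simp add: algebra_simps)
    then show ?thesis by (simp add: scaleC_one)
  qed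
  show ?case
    using star_polynomial_add[OF 1 2[simplified add_Suc_right add_Suc[symmetric]]]
    by (simp add: A1_def A2_def half)
qed

lemma star_polynomial_diagonal:
  fixes A :: "'a::complex_vector list \<Rightarrow> 'b::complex_vector"
  assumes "madd n A"
    and hom: "\<And>us vs x r. Suc (length us + length vs) = n \<Longrightarrow>
      A (us @ (r *\<^sub>R x) # vs) = r *\<^sub>R A (us @ x # vs)"
  shows "star_polynomial n (\<lambda>x. A (replicate n x))"
proof -
  have "mixed_multilinear 0 n 0 (\<lambda>us vs ws. A vs)"
    unfolding mixed_multilinear_def
  proof (intro allI impI conjI)
    fix vs :: "'a list" and i
    assume *: "length vs = n" "i < n"
    then have "vs[i := z] = take i vs @ z # drop (Suc i) vs" for z by (simp add: upd_conv_take_nth_drop)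
    moreover have "Suc (length (take i vs) + length (drop (Suc i) vs)) = n" using * by auto
    ultimately show "linear (\<lambda>z. A (vs[i := z]))"
      using maddD[OF assms(1)] hom by (intro linearI) auto
  qed auto
  from star_polynomial_mixed[OF this] show ?thesis by simp
qed

lemma star_polynomial_multilinear:
  fixes F :: "'a::complex_vector \<Rightarrow> 'b::complex_vector"
  assumes "star_polynomial n F"
  obtains A where "madd n A" "\<And>x. F x = A (replicate n x)"
    "\<And>us vs x r. Suc (length us + length vs) = n \<Longrightarrow> A (us @ (r *\<^sub>R x) # vs) = r *\<^sub>R A (us @ x # vs)"
proof -
  obtain K c where 1: "\<And>k m. k + m = n \<Longrightarrow> km_linear k m (K k m)"
      "\<And>x. F x = (\<Sum>(k, m) | k + m = n. c k m *\<^sub>C K k m (replicate n x))"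
    using star_polynomial_terms[OF assms(1)] by blast
  have K: "K k m (us @ (x + y) # vs) = K k m (us @ x # vs) + K k m (us @ y # vs)"
     "K k m (us @ (r *\<^sub>R x) # vs) = r *\<^sub>R K k m (us @ x # vs)"
    if "k + m = n" "Suc (length us + length vs) = n" for k m us vs x y r
  proof -
    have *: "clinear_map (\<lambda>v. K k m ((us @ x # vs)[length us := v])) \<or>
        antilinear_map (\<lambda>v. K k m ((us @ x # vs)[length us := v]))"
    proof (cases "length us < k")
      case True
      then show ?thesis using that by (intro disjI1 km_linearD(1)[OF 1(1)[OF that(1)]]) auto
    next
      case False
      then show ?thesis using that by (intro disjI2 km_linearD(2)[OF 1(1)[OF that(1)]]) auto
    qed
    show "K k m (us @ (x + y) # vs) = K k m (us @ x # vs) + K k m (us @ y # vs)"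
      using * by (auto simp: clinear_map_def antilinear_map_def)
    show "K k m (us @ (r *\<^sub>R x) # vs) = r *\<^sub>R K k m (us @ x # vs)"
      using * by (auto simp: clinear_map_def antilinear_map_def scaleR_scaleC)
  qed
  define A where "A xs = (\<Sum>(k, m) | k + m = n. c k m *\<^sub>C K k m xs)" for xs
  show ?thesis
  proof (rule that)
    show "madd n A"
      unfolding madd_def A_def sum.distrib[symmetric]
      by (intro allI impI sum.cong) (auto simp: K scaleC_add_right)
    show "F x = A (replicate n x)" for x by (simp add: 1 A_def)
    show "A (us @ (r *\<^sub>R x) # vs) = r *\<^sub>R A (us @ x # vs)"
      if "Suc (length us + length vs) = n" for us vs x r
      unfolding A_def scaleR_sum_right using that
      by (intro sum.cong) (auto simp: K scaleC_scaleR_commute)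
  qed
qed

context normed_by begin

text \<open>Telescoping over the slots: in each step one entry \<open>h\<close> is replaced by \<open>g\<close>.\<close>

lemma diagonal_lipschitz:
  fixes A :: "'a list \<Rightarrow> 'b::real_normed_vector"
  assumes "madd n A" "\<And>xs. length xs = n \<Longrightarrow> norm (A xs) \<le> K * pr r xs" "0 \<le> K" "0 < r"
    and R: "1 \<le> R" "p g / r \<le> R" "p h / r \<le> R" and "length us + m = n"
  shows "norm (A (us @ replicate m h) - A (us @ replicate m g)) \<le>
    K * pr r us * real m * R ^ m * (p (h - g) / r)"
  using assms(8)
proof (induction m arbitrary: us)
  case (Suc m)
  have "A (us @ (h - g + g) # replicate m h) = A (us @ (h - g) # replicate m h) + A (us @ g # replicate m h)"
    using Suc.prems by (intro maddD[OF assms(1)]) simp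
  then have eq: "A (us @ replicate (Suc m) h) - A (us @ replicate (Suc m) g) =
      A (us @ (h - g) # replicate m h) + (A ((us @ [g]) @ replicate m h) - A ((us @ [g]) @ replicate m g))"
    by simp
  have "norm (A (us @ (h - g) # replicate m h)) \<le> K * pr r us * (p (h - g) / r) * (p h / r) ^ m"
    using assms(2)[of "us @ (h - g) # replicate m h"] Suc.prems by (simp add: mult_ac)
  also have "\<dots> \<le> K * pr r us * (p (h - g) / r) * R ^ Suc m"
  proof (intro mult_left_mono)
    have "(p h / r) ^ m \<le> R ^ m" using R assms(4) by (intro power_mono) auto
    also have "\<dots> \<le> R ^ Suc m" using R(1) by (intro power_increasing) auto
    finally show "(p h / r) ^ m \<le> R ^ Suc m" .
  qed (use assms in auto)
  finally have 1: "norm (A (us @ (h - g) # replicate m h)) \<le> K * pr r us * R ^ Suc m * (p (h - g) / r)"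
    by (simp add: mult_ac)
  have "norm (A ((us @ [g]) @ replicate m h) - A ((us @ [g]) @ replicate m g)) \<le>
      K * pr r (us @ [g]) * real m * R ^ m * (p (h - g) / r)"
    using Suc.prems by (intro Suc.IH) simp
  also have "\<dots> = (K * pr r us * real m * R ^ m * (p (h - g) / r)) * (p g / r)" by simp
  also have "\<dots> \<le> (K * pr r us * real m * R ^ m * (p (h - g) / r)) * R"
    using assms by (intro mult_left_mono R(2)) auto
  finally have 2: "norm (A ((us @ [g]) @ replicate m h) - A ((us @ [g]) @ replicate m g)) \<le>
      K * pr r us * real m * R ^ Suc m * (p (h - g) / r)" by (simp add: mult_ac)
  show ?case
    unfolding eq by (rule order_trans[OF norm_triangle_ineq order_trans[OF add_mono[OF 1 2]]])
      (simp add: algebra_simps)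
qed simp

lemma star_analytic_if_germ:
  fixes F :: "'a \<Rightarrow> 'b::complex_banach"
  assumes T: "\<And>x r. 0 < r \<Longrightarrow> openin T {y. p (y - x) < r}"
    and germ: "\<And>x. \<exists>r C. germ r C (\<lambda>h. F (x + h))"
  shows "star_analytic T F"
  unfolding star_analytic_def
proof
  fix x
  obtain r C where "germ r C (\<lambda>h. F (x + h))" using germ by blast
  then obtain A where A: "0 < r" "\<And>n. madd n A" "\<And>xs. norm (A xs) \<le> C * wt (length xs) * pr r xs"
    "\<And>h. p h < r \<Longrightarrow> (\<lambda>n. A (replicate n h)) sums F (x + h)" "0 \<le> C"
    by (rule germE) blast
  have hom: "A (us @ (s *\<^sub>R x) # vs) = s *\<^sub>R A (us @ x # vs)" for us vs x s
  proof (rule additive_real_homogeneous)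
    show "A (us @ (x + y) # vs) = A (us @ x # vs) + A (us @ y # vs)" for x y
      by (rule maddD[OF A(2) refl])
    fix u :: real assume u: "0 \<le> u" "u \<le> 1"
    let ?xs = "us @ x # vs"
    have "norm (A (us @ (u *\<^sub>R x) # vs)) \<le> C * wt (length (us @ (u *\<^sub>R x) # vs)) * pr r (us @ (u *\<^sub>R x) # vs)"
      by (rule A(3))
    also have "\<dots> = u * (C * wt (length ?xs) * pr r ?xs)" using u by simp
    also have "\<dots> \<le> 1 * (C * wt (length ?xs) * pr r ?xs)"
      using u A(1,5) wt_pos[of "length ?xs"] by (intro mult_right_mono mult_nonneg_nonneg) auto
    finally show "norm (A (us @ (u *\<^sub>R x) # vs)) \<le> 1 * (C * wt (length ?xs) * pr r ?xs)" .
  qed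
  have poly: "star_polynomial n (\<lambda>h. A (replicate n h))" for n
    by (rule star_polynomial_diagonal[OF A(2) hom])
  have cont: "continuous_map T euclidean (\<lambda>h. A (replicate n h))" for n
    unfolding continuous_map_def
  proof (intro conjI allI impI)
    have top: "topspace T = UNIV"
    proof -
      have "y \<in> topspace T" for y using openin_subset[OF T[of 1 y]] by auto
      then show ?thesis by auto
    qed
    fix U :: "'b set" assume "openin euclidean U"
    then have U: "open U" by simp
    show "openin T {h \<in> topspace T. A (replicate n h) \<in> U}"
    proof (subst openin_subopen, intro ballI)
      fix g assume "g \<in> {h \<in> topspace T. A (replicate n h) \<in> U}"
      then obtain e where e: "e > 0" "ball (A (replicate n g)) e \<subseteq> U"
        using U by (auto simp: open_contains_ball)
      define R where "R = 1 + p g / r + 1 / r"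
      define M where "M = C * wt n * real n * R ^ n + 1"
      have R: "1 \<le> R" "p g / r \<le> R" using A(1) by (auto simp: R_def)
      have M: "M > 0" using A(1,5) wt_pos[of n] R(1)
        by (auto simp: M_def intro!: add_nonneg_pos mult_nonneg_nonneg)
      define d where "d = min 1 (e * r / M)"
      have d: "0 < d" using e A(1) M by (simp add: d_def)
      have "A (replicate n h) \<in> U" if h: "p (h - g) < d" for h
      proof -
        have "p h \<le> p (h - g) + p g" using p_triangle[of "h - g" g] by simp
        then have "p h / r \<le> (1 + p g) / r" using h A(1) by (intro divide_right_mono) (auto simp: d_def)
        then have "p h / r \<le> R" by (simp add: R_def add_divide_distrib)
        then have "norm (A ([] @ replicate n h) - A ([] @ replicate n g)) \<le>
            (C * wt n) * pr r [] * real n * R ^ n * (p (h - g) / r)"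
          using A wt_pos[of n] R by (intro diagonal_lipschitz[where n = n]) auto
        also have "\<dots> \<le> M * (p (h - g) / r)"
          using A(1) by (intro mult_right_mono) (auto simp: M_def)
        also have "\<dots> < e" using h M A(1) by (auto simp: d_def field_simps)
        finally show ?thesis using e(2) by (auto simp: dist_norm norm_minus_commute)
      qed
      then show "\<exists>V. openin T V \<and> g \<in> V \<and> V \<subseteq> {h \<in> topspace T. A (replicate n h) \<in> U}"
        using T[OF d, of g] d by (intro exI[of _ "{h. p (h - g) < d}"]) (auto simp: top)
    qed
  qed auto
  have "uniform_limit {h. p h < r} (\<lambda>N h. \<Sum>n<N. A (replicate n h)) (\<lambda>h. \<Sum>n. A (replicate n h)) sequentially"
    by (rule Weierstrass_m_test[OF _ summable_mult[OF summable_wt, of C]])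
      (use diag_bound[OF A(5,3)] in auto)
  then have "uniform_limit {h. p h < r} (\<lambda>N h. \<Sum>n<N. A (replicate n h)) (\<lambda>h. F (x + h)) sequentially"
    by (rule uniform_limit_cong'[THEN iffD1, rotated -1]) (use A(4) in \<open>auto simp: sums_iff\<close>)
  then show "\<exists>V Fn. (\<exists>U. openin T U \<and> 0 \<in> U \<and> U \<subseteq> V) \<and>
      (\<forall>n. star_polynomial n (Fn n) \<and> continuous_map T euclidean (Fn n)) \<and>
      uniform_limit V (\<lambda>N h. \<Sum>n<N. Fn n h) (\<lambda>h. F (x + h)) sequentially"
    using poly cont T[OF A(1), of 0] A(1)
    by (intro exI[of _ "{h. p h < r}"] exI[of _ "\<lambda>n h. A (replicate n h)"]) auto
qed

end

section \<open>Finite differences and polarization\<close>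

definition fdiff :: "'a::ab_group_add \<Rightarrow> ('a \<Rightarrow> 'b::ab_group_add) \<Rightarrow> 'a \<Rightarrow> 'b"
  where "fdiff h F b = F (b + h) - F b"

text \<open>Polynomials of degree less than \<open>n\<close> in the sense of Frechet: all \<open>n\<close>-fold differences vanish.\<close>

primrec degree_less :: "nat \<Rightarrow> ('a::ab_group_add \<Rightarrow> 'b::ab_group_add) \<Rightarrow> bool" where
  "degree_less 0 F \<longleftrightarrow> (\<forall>b. F b = 0)"
| "degree_less (Suc n) F \<longleftrightarrow> (\<forall>h. degree_less n (fdiff h F))"

lemma degree_less_zero: "degree_less n (\<lambda>_. 0)"
  by (induction n) (auto simp: fdiff_def[abs_def])

lemma degree_less_add:
  "degree_less n F \<Longrightarrow> degree_less n G \<Longrightarrow> degree_less n (\<lambda>b. F b + G b)"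
proof (induction n arbitrary: F G)
  case (Suc n)
  have "fdiff h (\<lambda>b. F b + G b) = (\<lambda>b. fdiff h F b + fdiff h G b)" for h
    by (auto simp: fdiff_def)
  then show ?case using Suc by simp
qed simp

lemma degree_less_Suc: "degree_less n F \<Longrightarrow> degree_less (Suc n) F"
proof (induction n arbitrary: F)
  case 0
  then show ?case by (simp add: fdiff_def)
next
  case (Suc n)
  then show ?case by simp
qed

text \<open>Expanding the slots of \<open>G\<close> at \<open>b + h\<close> one at a time, each term that picks \<open>h\<close> somewhere is the
  diagonal of a form with fewer free slots, and the term without any \<open>h\<close> cancels in the difference.\<close>

lemma degree_less_diagonal:
  fixes G :: "'a::ab_group_add list \<Rightarrow> 'b::ab_group_add"
  assumes "madd n G" shows "degree_less (Suc n) (\<lambda>b. G (replicate n b))"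
  using assms
proof (induction n arbitrary: G rule: less_induct)
  case (less n)
  have mixed: "degree_less (l + m)
      (\<lambda>b. G (replicate l b @ replicate m (b + h)) - G (replicate (l + m) b))"
    if "madd (l + m) G" "l + m \<le> n" for l m h and G :: "'a list \<Rightarrow> 'b"
    using that
  proof (induction m arbitrary: l G)
    case 0
    then show ?case by (simp add: degree_less_zero)
  next
    case (Suc m)
    define G' where "G' xs = G (take l xs @ h # drop l xs)" for xs
    have G': "madd (l + m) G'"
      unfolding madd_def
    proof (intro allI impI)
      fix us vs :: "'a list" and x y
      assume len: "Suc (length us + length vs) = l + m"
      show "G' (us @ (x + y) # vs) = G' (us @ x # vs) + G' (us @ y # vs)"
      proof (cases "l \<le> length us")
        case True
        then show ?thesis
          using maddD[OF Suc.prems(1), of "take l us @ h # drop l us" vs x y] len by (simp add: G'_def)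
      next
        case False
        then obtain j where j: "l - length us = Suc j" by (cases "l - length us") auto
        then show ?thesis
          using maddD[OF Suc.prems(1), of us "take j vs @ h # drop j vs" x y] len False
          by (simp add: G'_def)
      qed
    qed
    have split: "G (replicate l b @ replicate (Suc m) (b + h)) - G (replicate (l + Suc m) b) =
        (G (replicate (Suc l) b @ replicate m (b + h)) - G (replicate (Suc l + m) b)) +
        ((G' (replicate l b @ replicate m (b + h)) - G' (replicate (l + m) b)) + G' (replicate (l + m) b))"
      for b
      using maddD[OF Suc.prems(1), of "replicate l b" "replicate m (b + h)" b h]
      by (simp add: G'_def replicate_append_same[symmetric])
    have "degree_less (l + Suc m)
        (\<lambda>b. G (replicate (Suc l) b @ replicate m (b + h)) - G (replicate (Suc l + m) b))"
      using Suc.IH[of "Suc l" G] Suc.prems by simp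
    moreover have "degree_less (l + Suc m)
        (\<lambda>b. G' (replicate l b @ replicate m (b + h)) - G' (replicate (l + m) b))"
      using degree_less_Suc[OF Suc.IH[OF G']] Suc.prems by simp
    moreover have "degree_less (l + Suc m) (\<lambda>b. G' (replicate (l + m) b))"
      using less.IH[OF _ G'] Suc.prems by simp
    ultimately show ?case unfolding split by (intro degree_less_add)
  qed
  show ?case
    using mixed[of 0 n G] less.prems by (simp add: fdiff_def[abs_def])
qed

definition polarize :: "'a::ab_group_add list \<Rightarrow> ('a \<Rightarrow> 'b::ab_group_add) \<Rightarrow> 'a \<Rightarrow> 'b"
  where "polarize = fold fdiff"

lemma polarize_Nil [simp]: "polarize [] F = F"
  and polarize_rec: "polarize (x # xs) F = polarize xs (fdiff x F)"
  by (simp_all add: polarize_def)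

lemma polarize_mset: assumes "mset xs = mset ys" shows "polarize xs F = polarize ys F"
proof -
  have "fdiff x \<circ> fdiff y = fdiff y \<circ> (fdiff x :: ('a \<Rightarrow> 'b) \<Rightarrow> _)" for x y :: 'a
    by (auto simp: fdiff_def fun_eq_iff algebra_simps)
  then show ?thesis using fold_multiset_equiv[of xs "fdiff :: _ \<Rightarrow> ('a \<Rightarrow> 'b) \<Rightarrow> _" ys] assms
    by (metis polarize_def)
qed

lemma polarize_shift: "polarize xs (\<lambda>b. F (b + c)) b = polarize xs F (b + c)"
proof (induction xs arbitrary: F b)
  case (Cons x xs)
  have "fdiff x (\<lambda>b. F (b + c)) = (\<lambda>b. fdiff x F (b + c))" by (auto simp: fdiff_def algebra_simps)
  then show ?case using Cons by (simp add: polarize_rec)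
qed simp

lemma polarize_add: "polarize xs (\<lambda>b. F b + G b) b = polarize xs F b + polarize xs G b"
proof (induction xs arbitrary: F G)
  case (Cons x xs)
  have "fdiff x (\<lambda>b. F b + G b) = (\<lambda>b. fdiff x F b + fdiff x G b)" by (auto simp: fdiff_def)
  then show ?case using Cons by (simp add: polarize_rec)
qed simp

lemma polarize_zero: "polarize xs (\<lambda>_. 0) b = 0"
  using polarize_add[of xs "\<lambda>_. 0" "\<lambda>_. 0" b] by simp

lemma polarize_diff: "polarize xs (\<lambda>b. F b - G b) b = polarize xs F b - polarize xs G b"
  using polarize_add[of xs "\<lambda>b. F b - G b" G b] by simp

lemma polarize_sum: "polarize xs (\<lambda>b. \<Sum>i\<in>I. F i b) b = (\<Sum>i\<in>I. polarize xs (F i) b)"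
  by (induction I rule: infinite_finite_induct) (auto simp: polarize_zero polarize_add)

lemma polarize_Cons: "polarize (x # xs) F b = polarize xs F (b + x) - polarize xs F b"
  using polarize_diff[of xs "\<lambda>b. F (b + x)" F b] polarize_shift[of xs F x b]
  by (simp add: polarize_rec fdiff_def[abs_def])

lemma polarize_eq_0: "degree_less n F \<Longrightarrow> n \<le> length xs \<Longrightarrow> polarize xs F b = 0"
proof (induction n arbitrary: F xs)
  case 0
  then have "F = (\<lambda>_. 0)" by auto
  then show ?case by (simp only: polarize_zero)
next
  case (Suc n)
  then show ?case by (cases xs) (auto simp: polarize_rec)
qed

text \<open>The defect of additivity is a difference of order \<open>n + 1\<close>, and so it vanishes.\<close>

lemma polarize_Cons_add:
  assumes "degree_less (Suc n) F" "Suc (length xs) = n"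
  shows "polarize ((x + y) # xs) F b = polarize (x # xs) F b + polarize (y # xs) F b"
proof -
  have "polarize (y # x # xs) F b = 0" by (rule polarize_eq_0[OF assms(1)]) (use assms(2) in simp)
  then have "polarize (x # xs) F (b + y) = polarize (x # xs) F b" by (subst (asm) polarize_Cons) simp
  then show ?thesis by (simp add: polarize_Cons algebra_simps)
qed

text \<open>Along a line, differences of \<open>F\<close> are differences of a function of one real variable, which reduces
  the normalization of the polarization formula to monomials.\<close>

lemma polarize_line:
  fixes x :: "'a::real_vector"
  shows "polarize (replicate k x) F (t *\<^sub>R x) = polarize (replicate k 1) (\<lambda>s. F (s *\<^sub>R x)) t"
proof (induction k arbitrary: t)
  case (Suc k)
  have "t *\<^sub>R x + x = (t + 1) *\<^sub>R x" by (simp add: scaleR_add_left)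
  then show ?case using Suc by (simp add: polarize_Cons)
qed simp

lemma degree_less_monomial: "degree_less (Suc n) (\<lambda>s::real. a * of_real s ^ n :: complex)"
proof -
  have "madd n (\<lambda>xs. a * of_real (prod_list xs :: real))" by (simp add: madd_def algebra_simps)
  from degree_less_diagonal[OF this] show ?thesis by (simp add: prod_list_replicate)
qed

lemma polarize_monomial:
  "polarize (replicate n 1) (\<lambda>s::real. a * of_real s ^ n :: complex) t = fact n * a"
proof (induction n arbitrary: a t)
  case (Suc n)
  have "fdiff 1 (\<lambda>s::real. a * of_real s ^ Suc n) = (\<lambda>s. \<Sum>k\<le>n. (of_nat (Suc n choose k) * a) * of_real s ^ k)"
  proof
    fix s :: real
    have "(of_real s + 1 :: complex) ^ Suc n =
        (\<Sum>k\<le>n. of_nat (Suc n choose k) * of_real s ^ k) + of_real s ^ Suc n"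
      by (subst binomial_ring) simp
    then show "fdiff 1 (\<lambda>s::real. a * of_real s ^ Suc n) s =
        (\<Sum>k\<le>n. (of_nat (Suc n choose k) * a) * of_real s ^ k)"
      by (simp add: fdiff_def distrib_left sum_distrib_left mult_ac del: power_Suc)
  qed
  then have "polarize (replicate (Suc n) 1) (\<lambda>s::real. a * of_real s ^ Suc n) t =
      (\<Sum>k\<le>n. polarize (replicate n 1) (\<lambda>s::real. (of_nat (Suc n choose k) * a) * of_real s ^ k) t)"
    by (simp del: power_Suc binomial_Suc_Suc add: polarize_sum polarize_rec)
  also have "\<dots> = (\<Sum>k\<le>n. if k = n then fact n * (of_nat (Suc n choose n) * a) else 0)"
  proof (intro sum.cong refl)
    fix k assume k: "k \<in> {..n}"
    show "polarize (replicate n 1) (\<lambda>s::real. (of_nat (Suc n choose k) * a) * of_real s ^ k) t =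
        (if k = n then fact n * (of_nat (Suc n choose n) * a) else 0)"
    proof (cases "k = n")
      case True
      then show ?thesis using Suc.IH[of "of_nat (Suc n choose n) * a" t] by simp
    next
      case False
      then show ?thesis using k polarize_eq_0[OF degree_less_monomial[of k "of_nat (Suc n choose k) * a"]] by simp
    qed
  qed
  also have "\<dots> = fact (Suc n) * a" by (simp add: algebra_simps)
  finally show ?case .
qed simp

fun subsums :: "'a::ab_group_add list \<Rightarrow> 'a set" where
  "subsums [] = {0}"
| "subsums (x # xs) = subsums xs \<union> (+) x ` subsums xs"

text \<open>The polarization is an alternating sum of the values at \<open>b\<close> plus the \<open>2 ^ length xs\<close> partial
  sums of \<open>xs\<close>.\<close>

lemma norm_polarize_le:
  fixes F :: "'a::ab_group_add \<Rightarrow> 'b::real_normed_vector"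
  assumes "\<And>s. s \<in> subsums xs \<Longrightarrow> norm (F (b + s)) \<le> M"
  shows "norm (polarize xs F b) \<le> 2 ^ length xs * M"
  using assms
proof (induction xs arbitrary: b)
  case (Cons x xs)
  have "norm (polarize xs F (b + x)) \<le> 2 ^ length xs * M"
    by (rule Cons.IH) (use Cons.prems in \<open>force simp: add.assoc\<close>)
  moreover have "norm (polarize xs F b) \<le> 2 ^ length xs * M"
    by (rule Cons.IH) (use Cons.prems in auto)
  ultimately show ?case
    unfolding polarize_Cons using norm_triangle_ineq4[of "polarize xs F (b + x)" "polarize xs F b"]
    by (simp add: algebra_simps)
qed simp

lemma subsums_replicate:
  fixes u :: "'a::real_vector"
  shows "s \<in> subsums (replicate m u @ xs) \<Longrightarrow> \<exists>j\<le>m. \<exists>g\<in>subsums xs. s = real j *\<^sub>R u + g"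
proof (induction m arbitrary: s)
  case 0
  then show ?case by simp
next
  case (Suc m)
  then consider "s \<in> subsums (replicate m u @ xs)"
    | s' where "s = u + s'" "s' \<in> subsums (replicate m u @ xs)" by auto
  then show ?case
  proof cases
    case 1
    then show ?thesis using Suc.IH le_SucI by blast
  next
    case 2
    then obtain j g where "j \<le> m" "g \<in> subsums xs" "s' = real j *\<^sub>R u + g" using Suc.IH by blast
    then show ?thesis using 2
      by (intro exI[of _ "Suc j"] conjI bexI[of _ g]) (auto simp: scaleR_add_left add.assoc)
  qed
qed

text \<open>A *-polynomial, seen through its values only: this suffices for polarization, and no multilinear
  form has to be chosen.\<close>

definition homogeneous_polynomial :: "nat \<Rightarrow> ('a::real_vector \<Rightarrow> complex) \<Rightarrow> bool"
  where "homogeneous_polynomial n F \<longleftrightarrow>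
    degree_less (Suc n) F \<and> (\<forall>t x. F (t *\<^sub>R x) = of_real t ^ n * F x)"

lemma degree_less_cmult: "degree_less n G \<Longrightarrow> degree_less n (\<lambda>z. a * (G z :: complex))"
proof (induction n arbitrary: G)
  case (Suc n)
  have "fdiff h (\<lambda>z. a * G z) = (\<lambda>z. a * fdiff h G z)" for h
    by (auto simp: fdiff_def algebra_simps)
  then show ?case using Suc by simp
qed simp

lemma homogeneous_polynomial_cmult:
  "homogeneous_polynomial n F \<Longrightarrow> homogeneous_polynomial n (\<lambda>z. a * F z)"
  unfolding homogeneous_polynomial_def
  by (intro conjI degree_less_cmult) (auto simp del: degree_less.simps)

lemma homogeneous_polynomial_if_star_polynomial:
  assumes "star_polynomial n (F :: 'a::complex_vector \<Rightarrow> complex)"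
  shows "homogeneous_polynomial n F"
proof -
  obtain A where A: "madd n A" "\<And>x. F x = A (replicate n x)"
    "\<And>us vs x r. Suc (length us + length vs) = n \<Longrightarrow> A (us @ (r *\<^sub>R x) # vs) = r *\<^sub>R A (us @ x # vs)"
    using star_polynomial_multilinear[OF assms] by blast
  have "A (replicate j x @ replicate m (t *\<^sub>R x)) = of_real t ^ m * A (replicate (j + m) x)"
    if "j + m = n" for j m t x
    using that
  proof (induction m arbitrary: j)
    case (Suc m)
    have "A (replicate j x @ replicate (Suc m) (t *\<^sub>R x)) =
        t *\<^sub>R A (replicate j x @ x # replicate m (t *\<^sub>R x))"
      using Suc.prems A(3)[of "replicate j x" "replicate m (t *\<^sub>R x)" t x] by simp
    also have "replicate j x @ x # replicate m (t *\<^sub>R x) = replicate (Suc j) x @ replicate m (t *\<^sub>R x)"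
      by (simp add: replicate_app_Cons_same)
    also have "A \<dots> = of_real t ^ m * A (replicate (Suc j + m) x)" using Suc.prems by (intro Suc.IH) simp
    finally show ?case by (simp add: scaleR_conv_of_real)
  qed simp
  from this[of 0 n] show ?thesis
    using degree_less_diagonal[OF A(1)] A(2)
    by (simp add: homogeneous_polynomial_def) (metis (no_types, lifting) ext degree_less.simps(2))
qed

text \<open>The symmetric form of a homogeneous polynomial, defined through its values, so that bounds on the
  polynomial carry over.\<close>

definition sym_form :: "nat \<Rightarrow> ('a::ab_group_add \<Rightarrow> complex) \<Rightarrow> 'a list \<Rightarrow> complex"
  where "sym_form n F xs = polarize xs F 0 / fact n"

lemma sym_form_mset: "mset xs = mset ys \<Longrightarrow> sym_form n F xs = sym_form n F ys"
  by (simp add: sym_form_def polarize_mset[of xs ys])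

lemma madd_sym_form: assumes "homogeneous_polynomial n F" shows "madd n (sym_form n F)"
  unfolding madd_def
proof (intro allI impI)
  fix us vs :: "'a list" and x y
  assume len: "Suc (length us + length vs) = n"
  have m: "sym_form n F (us @ z # vs) = sym_form n F (z # us @ vs)" for z
    by (rule sym_form_mset) simp
  show "sym_form n F (us @ (x + y) # vs) = sym_form n F (us @ x # vs) + sym_form n F (us @ y # vs)"
    unfolding m using assms len polarize_Cons_add[of n F "us @ vs" x y 0]
    by (simp add: sym_form_def homogeneous_polynomial_def add_divide_distrib)
qed

lemma sym_form_diagonal:
  assumes "homogeneous_polynomial n F" shows "sym_form n F (replicate n x) = F x"
proof -
  have "polarize (replicate n x) F 0 = polarize (replicate n 1) (\<lambda>s. F x * of_real s ^ n) 0"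
    using polarize_line[of n x F 0] assms by (simp add: homogeneous_polynomial_def mult.commute)
  then show ?thesis by (simp add: sym_form_def polarize_monomial)
qed

lemma symmetric_binomial:
  fixes S :: "'a::ab_group_add list \<Rightarrow> complex"
  assumes sym: "\<And>xs ys. mset xs = mset ys \<Longrightarrow> S xs = S ys" and "madd (n + length c) S"
  shows "S (replicate n (x + h) @ c) =
    (\<Sum>k\<le>n. of_nat (n choose k) * S (replicate (n - k) x @ replicate k h @ c))"
  using assms(2)
proof (induction n arbitrary: c)
  case (Suc n)
  let ?T = "\<lambda>k. S (replicate (Suc n - k) x @ replicate k h @ c)"
  have IH: "S (replicate n (x + h) @ z # c) =
      (\<Sum>k\<le>n. of_nat (n choose k) * S (replicate (n - k) x @ replicate k h @ z # c))" for z
    using Suc.IH[of "z # c"] Suc.prems by simp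
  have "S (replicate (Suc n) (x + h) @ c) = S (x # replicate n (x + h) @ c) + S (h # replicate n (x + h) @ c)"
    using maddD[OF Suc.prems, of "[]" "replicate n (x + h) @ c" x h] by simp
  also have "\<dots> = S (replicate n (x + h) @ x # c) + S (replicate n (x + h) @ h # c)"
    by (intro arg_cong2[where f = "(+)"] sym) auto
  also have "\<dots> = (\<Sum>k\<le>n. of_nat (n choose k) * ?T k) + (\<Sum>k\<le>n. of_nat (n choose k) * ?T (Suc k))"
    unfolding IH
    by (intro arg_cong2[where f = "(+)"] sum.cong refl arg_cong2[where f = "(*)"] sym)
      (auto simp: Suc_diff_le)
  also have "(\<Sum>k\<le>n. of_nat (n choose k) * ?T k) = (\<Sum>k\<le>Suc n. of_nat (n choose k) * ?T k)" by simp
  also have "\<dots> = ?T 0 + (\<Sum>k\<le>n. of_nat (n choose Suc k) * ?T (Suc k))"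
    by (subst sum.atMost_Suc_shift) simp
  also have "\<dots> + (\<Sum>k\<le>n. of_nat (n choose k) * ?T (Suc k)) =
      ?T 0 + (\<Sum>k\<le>n. of_nat (Suc n choose Suc k) * ?T (Suc k))"
    by (simp add: sum.distrib[symmetric] algebra_simps)
  also have "\<dots> = (\<Sum>k\<le>Suc n. of_nat (Suc n choose k) * ?T k)"
    by (subst sum.atMost_Suc_shift) simp
  finally show ?case .
qed simp

lemma multihomogeneous_map:
  fixes S :: "'a::real_vector list \<Rightarrow> 'b::real_vector"
  assumes hom: "\<And>us vs x r. Suc (length us + length vs) = n \<Longrightarrow> S (us @ (r *\<^sub>R x) # vs) = r *\<^sub>R S (us @ x # vs)"
    and "length us + length xs + length ws = n"
  shows "S (us @ map (\<lambda>x. c x *\<^sub>R x) xs @ ws) = (\<Prod>x\<leftarrow>xs. c x) *\<^sub>R S (us @ xs @ ws)"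
  using assms(2)
proof (induction xs arbitrary: us)
  case (Cons x xs)
  have "S (us @ map (\<lambda>x. c x *\<^sub>R x) (x # xs) @ ws) = c x *\<^sub>R S ((us @ [x]) @ map (\<lambda>x. c x *\<^sub>R x) xs @ ws)"
    using Cons.prems hom[of us "map (\<lambda>x. c x *\<^sub>R x) xs @ ws" "c x" x] by simp
  also have "\<dots> = c x *\<^sub>R (\<Prod>x\<leftarrow>xs. c x) *\<^sub>R S ((us @ [x]) @ xs @ ws)"
    using Cons.prems by (subst Cons.IH) auto
  finally show ?case by simp
qed simp

section \<open>Re-expansion of a series of homogeneous polynomials\<close>

lemma power_self_le: "real n ^ n \<le> 3 ^ n * fact n"
proof -
  have "real n ^ n / fact n \<le> (\<Sum>k. real n ^ k / fact k)"
    using sum_le_suminf[of "\<lambda>k. real n ^ k / fact k" "{n}"] summable_exp[of "real n"]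
    by (simp add: field_simps)
  also have "\<dots> = exp (real n)" by (simp add: exp_def field_simps)
  also have "\<dots> = exp 1 ^ n" by (simp add: exp_of_nat_mult[symmetric])
  also have "\<dots> \<le> 3 ^ n" by (intro power_mono exp_le) auto
  finally show ?thesis by (simp add: field_simps)
qed

lemma half_power_le_wt: "(1/2) ^ n \<le> 32 * wt n"
proof -
  have "(real n + 1)\<^sup>2 \<le> 4 * 2 ^ n"
  proof (induction n)
    case (Suc n)
    show ?case
    proof (cases "n < 2")
      case True
      then consider "n = 0" | "n = 1" by linarith
      then show ?thesis by cases auto
    next
      case False
      then have "2 * 2 \<le> real n * real n" by (intro mult_mono) auto
      then have "(real (Suc n) + 1)\<^sup>2 \<le> 2 * (real n + 1)\<^sup>2" by (simp add: power2_eq_square algebra_simps)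
      then show ?thesis using Suc by simp
    qed
  qed simp
  then show ?thesis by (simp add: wt_def field_simps)
qed

context normed_by begin

lemma p_subsums: "g \<in> subsums xs \<Longrightarrow> p g \<le> (\<Sum>x\<leftarrow>xs. p x)"
proof (induction xs arbitrary: g)
  case (Cons x xs)
  then consider "g \<in> subsums xs" | g' where "g = x + g'" "g' \<in> subsums xs" by auto
  then show ?case
  proof cases
    case 1
    then show ?thesis using Cons.IH[of g] by (simp add: add_increasing)
  next
    case 2
    then show ?thesis using Cons.IH[of g'] p_triangle[of x g'] by simp
  qed
qed simp

lemma homogeneous_bound:
  assumes "homogeneous_polynomial n F" "0 < \<rho>" "\<And>z. p z \<le> \<rho> \<Longrightarrow> cmod (F z) \<le> M" "0 < R" "p z \<le> R"
  shows "cmod (F z) \<le> (R / \<rho>) ^ n * M"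
proof -
  have "z = (R / \<rho>) *\<^sub>R ((\<rho> / R) *\<^sub>R z)" using assms by simp
  then have "F z = of_real (R / \<rho>) ^ n * F ((\<rho> / R) *\<^sub>R z)"
    using assms(1) unfolding homogeneous_polynomial_def by metis
  then have "cmod (F z) = (R / \<rho>) ^ n * cmod (F ((\<rho> / R) *\<^sub>R z))"
    using assms by (simp add: norm_mult norm_power norm_divide)
  moreover have "cmod (F ((\<rho> / R) *\<^sub>R z)) \<le> M"
    using assms by (intro assms(3)) (simp add: field_simps)
  ultimately show ?thesis using assms by (simp add: mult_left_mono)
qed

lemma sym_form_homogeneous:
  assumes F: "homogeneous_polynomial n F" and "0 < \<rho>" "\<And>z. p z \<le> \<rho> \<Longrightarrow> cmod (F z) \<le> M"
    and len: "Suc (length us + length vs) = n"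
  shows "sym_form n F (us @ (r *\<^sub>R x) # vs) = r *\<^sub>R sym_form n F (us @ x # vs)"
proof (rule additive_real_homogeneous)
  show "sym_form n F (us @ (x + y) # vs) = sym_form n F (us @ x # vs) + sym_form n F (us @ y # vs)" for x y
    by (rule maddD[OF madd_sym_form[OF F] len])
  fix u :: real assume u: "0 \<le> u" "u \<le> 1"
  define R where "R = 1 + (\<Sum>x\<leftarrow>us @ x # vs. p x)"
  have R: "0 < R" unfolding R_def by (intro add_pos_nonneg sum_list_nonneg) auto
  have "cmod (F (0 + s)) \<le> (R / \<rho>) ^ n * M" if "s \<in> subsums (us @ (u *\<^sub>R x) # vs)" for s
  proof (rule homogeneous_bound[OF F assms(2,3) R])
    have "p s \<le> (\<Sum>x\<leftarrow>us @ (u *\<^sub>R x) # vs. p x)" by (rule p_subsums[OF that])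
    also have "\<dots> \<le> R" using u mult_right_mono[of u 1 "p x"] by (simp add: R_def)
    finally show "p (0 + s) \<le> R" by simp
  qed
  from norm_polarize_le[where xs = "us @ (u *\<^sub>R x) # vs" and F = F and b = 0, OF this]
  show "cmod (sym_form n F (us @ (u *\<^sub>R x) # vs)) \<le> 2 ^ n * ((R / \<rho>) ^ n * M) / fact n"
    using len by (simp add: sym_form_def norm_divide divide_right_mono)
qed

text \<open>Rescale \<open>y\<close> by \<open>24 / n\<close> and each nonzero entry \<open>x\<close> of \<open>xs\<close> to norm \<open>24 * \<rho> / n\<close>. All partial sums in the
  polarization formula then lie in the tube, and scaling back costs \<open>(n / 24) ^ n\<close>. With
  \<open>n ^ n \<le> 3 ^ n * n!\<close>, the \<open>2 ^ n\<close> terms of the formula and the binomial coefficient, the total is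
  \<open>(2 * 2 * 3 / 24) ^ n\<close>.\<close>

lemma sym_form_tube_bound:
  assumes F: "homogeneous_polynomial n F" and n: "0 < n" and \<rho>: "0 < \<rho>"
    and tube: "\<And>t g. 0 \<le> t \<Longrightarrow> t \<le> 24 \<Longrightarrow> p g \<le> 24 * \<rho> \<Longrightarrow> cmod (F (t *\<^sub>R y + g)) \<le> M"
    and len: "length xs \<le> n"
  shows "real (n choose length xs) * cmod (sym_form n F (replicate (n - length xs) y @ xs)) \<le>
    M * (1/2) ^ n * pr \<rho> xs"
proof -
  define k where "k = length xs"
  let ?S = "sym_form n F"
  have near0: "cmod (F z) \<le> M" if "p z \<le> 24 * \<rho>" for z using tube[of 0 z] that by simp
  have M: "0 \<le> M" using order_trans[OF norm_ge_zero near0[of 0]] \<rho> by simp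
  have hom: "?S (us @ (r *\<^sub>R x) # vs) = r *\<^sub>R ?S (us @ x # vs)"
    if "Suc (length us + length vs) = n" for us vs x r
    by (rule sym_form_homogeneous[OF F _ near0 that]) (use \<rho> in auto)
  have "cmod (?S (replicate (n - k) y @ xs)) \<le> M * (1/4) ^ n * pr \<rho> xs"
  proof (cases "0 \<in> set xs")
    case True
    then obtain us vs where "xs = us @ 0 # vs" by (auto simp: in_set_conv_decomp)
    then have "?S (replicate (n - k) y @ xs) = 0"
      using madd_zero[OF madd_sym_form[OF F], of "replicate (n - k) y @ us" vs] len by (simp add: k_def)
    then show ?thesis using M \<rho> by simp
  next
    case False
    define q where "q = 24 / real n"
    define c where "c x = q * \<rho> / p x" for x
    have q: "0 < q" using n by (simp add: q_def)
    let ?ys = "replicate (n - k) (q *\<^sub>R y) @ map (\<lambda>x. c x *\<^sub>R x) xs"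
    have prod: "(\<Prod>x\<leftarrow>xs. c x) = q ^ k / pr \<rho> xs" unfolding k_def
      by (induction xs) (auto simp: c_def)
    have pr: "0 < pr \<rho> xs" using False \<rho>
    proof (induction xs)
      case (Cons x xs)
      then have "0 < p x" using p_nonneg[of x] p_eq_0[of x] by (metis less_eq_real_def list.set_intros(1))
      then show ?case using Cons by simp
    qed simp
    have "?S ?ys = q ^ (n - k) *\<^sub>R ?S (replicate (n - k) y @ map (\<lambda>x. c x *\<^sub>R x) xs)"
      using multihomogeneous_map[where S = ?S and us = "[]" and xs = "replicate (n - k) y"
          and ws = "map (\<lambda>x. c x *\<^sub>R x) xs" and c = "\<lambda>_. q", OF hom] len
      by (simp add: k_def prod_list_replicate)
    also have "?S (replicate (n - k) y @ map (\<lambda>x. c x *\<^sub>R x) xs) = (q ^ k / pr \<rho> xs) *\<^sub>R ?S (replicate (n - k) y @ xs)"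
      using multihomogeneous_map[where S = ?S and us = "replicate (n - k) y" and xs = xs
          and ws = "[]" and c = c, OF hom] len
      by (simp add: k_def prod[unfolded k_def])
    finally have "?S ?ys = (q ^ n / pr \<rho> xs) *\<^sub>R ?S (replicate (n - k) y @ xs)"
      using len by (simp add: k_def power_add[symmetric])
    then have eq: "cmod (?S (replicate (n - k) y @ xs)) = cmod (?S ?ys) * pr \<rho> xs / q ^ n"
      using q pr by (simp add: field_simps)
    have "cmod (polarize ?ys F 0) \<le> 2 ^ length ?ys * M"
    proof (rule norm_polarize_le)
      fix s assume "s \<in> subsums ?ys"
      then obtain j g where j: "j \<le> n - k" "g \<in> subsums (map (\<lambda>x. c x *\<^sub>R x) xs)" "s = real j *\<^sub>R q *\<^sub>R y + g"
        using subsums_replicate by blast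
      have "real j * q \<le> real n * q" using j(1) q by (intro mult_right_mono) auto
      then have t: "real j * q \<le> 24" using n by (simp add: q_def)
      have "p (c x *\<^sub>R x) \<le> q * \<rho>" for x using q \<rho> by (auto simp: c_def)
      then have "(\<Sum>x\<leftarrow>xs. p (c x *\<^sub>R x)) \<le> (\<Sum>x\<leftarrow>xs. q * \<rho>)" by (intro sum_list_mono)
      then have "p g \<le> real k * (q * \<rho>)"
        using p_subsums[OF j(2)] by (simp add: o_def sum_list_triv k_def)
      also have "\<dots> \<le> real n * (q * \<rho>)" using q \<rho> len by (intro mult_right_mono) (auto simp: k_def)
      also have "\<dots> = 24 * \<rho>" using n by (simp add: q_def)
      finally show "cmod (F (0 + s)) \<le> M" using tube[of "real j * q" g] t q by (simp add: j(3))
    qed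
    then have "cmod (?S ?ys) \<le> 2 ^ n * M / fact n"
      using len by (simp add: sym_form_def norm_divide divide_right_mono k_def)
    then have "cmod (?S (replicate (n - k) y @ xs)) \<le> (2 ^ n * M / fact n) * pr \<rho> xs / q ^ n"
      unfolding eq using q pr by (intro divide_right_mono mult_right_mono) auto
    also have "\<dots> = M * pr \<rho> xs * 2 ^ n / 24 ^ n * (real n ^ n / fact n)"
      using n by (simp add: q_def power_divide mult_ac)
    also have "\<dots> \<le> M * pr \<rho> xs * 2 ^ n / 24 ^ n * 3 ^ n"
      using power_self_le[of n] M pr by (intro mult_left_mono) (auto simp: field_simps)
    also have "\<dots> = M * (1/4) ^ n * pr \<rho> xs"
      using power_mult_distrib[of "2::real" 3 n] power_divide[of "6::real" 24 n]
      by (simp add: mult_ac)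
    finally show ?thesis .
  qed
  moreover have "real (n choose k) \<le> 2 ^ n"
    using binomial_le_pow2[of n k] of_nat_le_iff[where ?'a = real, of "n choose k" "2 ^ n"] by simp
  ultimately have "real (n choose k) * cmod (?S (replicate (n - k) y @ xs)) \<le> 2 ^ n * (M * (1/4) ^ n * pr \<rho> xs)"
    by (intro mult_mono) auto
  also have "\<dots> = M * (2 * (1/4)) ^ n * pr \<rho> xs" by (simp only: power_mult_distrib mult_ac)
  finally show ?thesis by (simp add: k_def)
qed

text \<open>By the binomial theorem the form of degree \<open>k\<close> of the expansion at \<open>y\<close> is
  \<open>\<Sum>n. (n choose k) * sym_form n (F n) (replicate (n - k) y @ xs)\<close>. The radius \<open>\<rho> / 2\<close> depends on
  the width of the tube but not on \<open>y\<close>. The constant \<open>32\<close> turns \<open>2 ^ (- k)\<close> into \<open>wt k\<close>.\<close>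

lemma germ_homogeneous_series:
  assumes F: "\<And>n. 0 < n \<Longrightarrow> homogeneous_polynomial n (F n)" and \<rho>: "0 < \<rho>"
    and tube: "\<And>n t g. 0 < n \<Longrightarrow> 0 \<le> t \<Longrightarrow> t \<le> 24 \<Longrightarrow> p g \<le> 24 * \<rho> \<Longrightarrow> cmod (F n (t *\<^sub>R y + g)) \<le> M"
  shows "germ (\<rho> / 2) (32 * M) (\<lambda>h. \<Sum>i. F (Suc i) (y + h))"
proof -
  define f where "f i xs = (if length xs \<le> Suc i then of_nat (Suc i choose length xs) *
    sym_form (Suc i) (F (Suc i)) (replicate (Suc i - length xs) y @ xs) else 0)" for i xs
  have M: "0 \<le> M" using order_trans[OF norm_ge_zero tube[of 1 0 0]] \<rho> by simp
  have f: "cmod (f i xs) \<le> M * (1/2) ^ Suc i * pr \<rho> xs" for i xs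
  proof (cases "length xs \<le> Suc i")
    case True
    then show ?thesis
      using sym_form_tube_bound[OF F, of "Suc i" \<rho> y M xs] tube[of "Suc i"] \<rho>
      by (simp add: f_def norm_mult del: binomial_Suc_Suc)
  qed (use M \<rho> in \<open>simp add: f_def\<close>)
  have half: "(\<lambda>i. M * (1/2) ^ Suc i) sums M" using sums_mult[OF power_half_series, of M] by simp
  have sc: "summable (\<lambda>i. M * (1/2) ^ Suc i * pr \<rho> xs)" for xs
    using sums_summable[OF half] by (rule summable_mult2)
  have sn: "summable (\<lambda>i. cmod (f i xs))" for xs
    by (rule summable_comparison_test'[OF sc[of xs]]) (use f in simp)
  note sf = summable_norm_cancel[OF sn]
  show ?thesis
  proof (rule germI[where A = "\<lambda>xs. \<Sum>i. f i xs"])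
    show "0 < \<rho> / 2" using \<rho> by simp
    show "madd m (\<lambda>xs. \<Sum>i. f i xs)" for m
      unfolding madd_def
    proof (intro allI impI)
      fix us vs :: "'a list" and x z
      have "f i (us @ (x + z) # vs) = f i (us @ x # vs) + f i (us @ z # vs)" for i
        using maddD[OF madd_sym_form[OF F], of "Suc i" "replicate (i - length us - length vs) y @ us" vs x z]
        by (simp add: f_def distrib_left del: binomial_Suc_Suc)
      then show "(\<Sum>i. f i (us @ (x + z) # vs)) = (\<Sum>i. f i (us @ x # vs)) + (\<Sum>i. f i (us @ z # vs))"
        by (simp add: suminf_add[OF sf sf])
    qed
    show "cmod (\<Sum>i. f i xs) \<le> 32 * M * wt (length xs) * pr (\<rho> / 2) xs" for xs
    proof -
      have "cmod (\<Sum>i. f i xs) \<le> (\<Sum>i. M * (1/2) ^ Suc i * pr \<rho> xs)"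
        by (rule order_trans[OF summable_norm[OF sn]]) (intro suminf_le sn sc f)
      also have "\<dots> = M * pr \<rho> xs" using sums_mult2[OF half, of "pr \<rho> xs"] by (simp add: sums_iff)
      also have "pr \<rho> xs = (1/2) ^ length xs * pr (\<rho> / 2) xs" by (induction xs) auto
      also have "M * \<dots> \<le> M * (32 * wt (length xs) * pr (\<rho> / 2) xs)"
        using M \<rho> by (intro mult_left_mono mult_right_mono half_power_le_wt) auto
      finally show ?thesis by (simp add: mult_ac)
    qed
    show "(\<lambda>k. \<Sum>i. f i (replicate k h)) sums (\<Sum>i. F (Suc i) (y + h))" if h: "p h < \<rho> / 2" for h
    proof (rule double_sums(2)[where c = "\<lambda>i. M * (1/2) ^ Suc i" and d = "\<lambda>k. (p h / \<rho>) ^ k"])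
      show "cmod (f i (replicate k h)) \<le> M * (1/2) ^ Suc i * (p h / \<rho>) ^ k" for i k
        using f[of i "replicate k h"] by simp
      show "summable (\<lambda>i. M * (1/2) ^ Suc i)" by (rule sums_summable[OF half])
      show "summable (\<lambda>k. (p h / \<rho>) ^ k)" using h \<rho> by (intro summable_geometric) (simp add: abs_of_pos)
      show "0 \<le> M * (1/2) ^ Suc i" for i using M by simp
      fix i
      have "(\<lambda>k. f i (replicate k h)) sums (\<Sum>k\<le>Suc i. f i (replicate k h))"
        by (rule sums_finite) (auto simp: f_def)
      also have "(\<Sum>k\<le>Suc i. f i (replicate k h)) =
          (\<Sum>k\<le>Suc i. of_nat (Suc i choose k) *
            sym_form (Suc i) (F (Suc i)) (replicate (Suc i - k) y @ replicate k h @ []))"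
        by (intro sum.cong) (auto simp: f_def)
      also have "\<dots> = sym_form (Suc i) (F (Suc i)) (replicate (Suc i) (y + h) @ [])"
        using madd_sym_form[OF F[of "Suc i"]]
        by (intro symmetric_binomial[symmetric] sym_form_mset) auto
      also have "\<dots> = F (Suc i) (y + h)" using sym_form_diagonal[OF F[of "Suc i"]] by simp
      finally show "(\<lambda>k. f i (replicate k h)) sums F (Suc i) (y + h)" .
    qed
  qed
qed

end

section \<open>Analytic bump functions\<close>

context normed_by begin

lemma continuous_norm_bound_near_zero:
  assumes "continuous_map (mtopology_of (norm_metric p)) euclidean (F :: 'a \<Rightarrow> complex)"
  shows "\<exists>s>0. \<exists>M. \<forall>z. p z \<le> s \<longrightarrow> cmod (F z) \<le> M"
proof -
  interpret M: Metric_space UNIV "\<lambda>x y. p (x - y)" by (rule Metric_space_norm[OF is_norm])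
  have "mtopology_of (norm_metric p) = M.mtopology"
    by (simp add: mtopology_of_def norm_metric_def)
  then have "openin M.mtopology {z. F z \<in> ball (F 0) 1}"
    using assms unfolding continuous_map_def by fastforce
  moreover have "0 \<in> {z. F z \<in> ball (F 0) 1}" by simp
  ultimately obtain r where r: "r > 0" "M.mball 0 r \<subseteq> {z. F z \<in> ball (F 0) 1}"
    unfolding M.openin_mtopology by blast
  have "cmod (F z) \<le> cmod (F 0) + 1" if "p z \<le> r / 2" for z
  proof -
    have "z \<in> M.mball 0 r" using that r(1) by simp
    then have "dist (F 0) (F z) < 1" using r(2) by auto
    then show ?thesis using norm_triangle_ineq2[of "F z" "F 0"] by (simp add: dist_norm norm_minus_commute)
  qed
  then show ?thesis using r(1) by (intro exI[of _ "r / 2"]) auto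
qed

text \<open>Uniform convergence bounds all but finitely many terms on a ball of radius \<open>R\<close>, and the others are
  bounded on bounded sets. The segment from \<open>0\<close> to \<open>24 *\<^sub>R y\<close> is compact, and so finitely many such balls
  suffice; no bound on bounded sets that is uniform in \<open>n\<close> can be expected.\<close>

lemma terms_bounded_on_tube:
  assumes F: "\<And>n. 0 < n \<Longrightarrow> homogeneous_polynomial n (F n)"
    and loc: "\<And>n. 0 < n \<Longrightarrow> \<exists>s>0. \<exists>M. \<forall>z. p z \<le> s \<longrightarrow> cmod (F n z) \<le> M"
    and R: "0 < R" "\<And>c. uniform_limit {x. p (x - c) < R} (\<lambda>N x. \<Sum>n=1..N. F n x) Q sequentially"
  shows "\<exists>M\<ge>0. \<forall>n>0. \<forall>t z. 0 \<le> t \<longrightarrow> t \<le> 24 \<longrightarrow> p (z - t *\<^sub>R y) < R / 2 \<longrightarrow> cmod (F n z) \<le> M"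
proof -
  have "\<exists>M. \<forall>n>0. \<forall>z. p (z - c) < R \<longrightarrow> cmod (F n z) \<le> M" for c
  proof -
    have "\<forall>\<^sub>F N in sequentially. \<forall>x\<in>{x. p (x - c) < R}. dist (\<Sum>n=1..N. F n x) (Q x) < 1/2"
      using R(2)[of c] by (rule uniform_limitD) simp
    then obtain N0 where N0: "\<And>N x. N \<ge> N0 \<Longrightarrow> p (x - c) < R \<Longrightarrow> dist (\<Sum>n=1..N. F n x) (Q x) < 1/2"
      unfolding eventually_sequentially by blast
    have "\<exists>M. \<forall>z. p (z - c) < R \<longrightarrow> cmod (F n z) \<le> M" if "0 < n" for n
    proof -
      obtain s M where s: "0 < s" "\<And>z. p z \<le> s \<Longrightarrow> cmod (F n z) \<le> M"
        using loc[OF \<open>0 < n\<close>] by blast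
      have "cmod (F n z) \<le> ((p c + R) / s) ^ n * M" if z: "p (z - c) < R" for z
      proof (rule homogeneous_bound[OF F[OF \<open>0 < n\<close>] s])
        show "p z \<le> p c + R" using p_triangle[of "z - c" c] z by simp
        show "0 < p c + R" using R(1) by (simp add: add_nonneg_pos)
      qed
      then show ?thesis by blast
    qed
    then obtain M where M: "\<And>n z. 0 < n \<Longrightarrow> p (z - c) < R \<Longrightarrow> cmod (F n z) \<le> M n" by metis
    have "cmod (F n z) \<le> 1 + (\<Sum>n\<le>N0. \<bar>M n\<bar>)" if n: "0 < n" and z: "p (z - c) < R" for n z
    proof (cases "n \<le> N0")
      case True
      have "cmod (F n z) \<le> \<bar>M n\<bar>" using M[OF n z] by linarith
      also have "\<dots> \<le> (\<Sum>n\<le>N0. \<bar>M n\<bar>)" using True by (intro member_le_sum) auto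
      finally show ?thesis by simp
    next
      case False
      then obtain m where m: "n = Suc m" "N0 \<le> m" by (cases n) auto
      have "F n z = (\<Sum>n=1..n. F n z) - (\<Sum>n=1..m. F n z)" by (simp add: m)
      then have "cmod (F n z) \<le> dist (\<Sum>n=1..n. F n z) (Q z) + dist (\<Sum>n=1..m. F n z) (Q z)"
        using dist_triangle2[of "\<Sum>n=1..n. F n z" "\<Sum>n=1..m. F n z" "Q z"] by (simp add: dist_norm)
      also have "\<dots> \<le> 1" using N0[OF _ z, of n] N0[OF _ z, of m] m by simp
      also have "\<dots> \<le> 1 + (\<Sum>n\<le>N0. \<bar>M n\<bar>)" by (simp add: sum_nonneg)
      finally show ?thesis .
    qed
    then show ?thesis by blast
  qed
  then obtain M where M: "\<And>c n z. 0 < n \<Longrightarrow> p (z - c) < R \<Longrightarrow> cmod (F n z) \<le> M c" by metis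
  obtain K where K: "48 * p y / R < real K" using reals_Archimedean2 by blast
  have K0: "0 < real K"
    using K R(1) by (smt (verit) divide_nonneg_pos mult_nonneg_nonneg p_nonneg)
  let ?c = "\<lambda>i. (24 * real i / real K) *\<^sub>R y"
  have "cmod (F n z) \<le> (\<Sum>i\<le>K. \<bar>M (?c i)\<bar>)"
    if n: "0 < n" and t: "0 \<le> t" "t \<le> 24" and z: "p (z - t *\<^sub>R y) < R / 2" for n t z
  proof -
    define i where "i = nat \<lfloor>t * real K / 24\<rfloor>"
    have i: "real i \<le> t * real K / 24" "t * real K / 24 \<le> real i + 1"
      using t K0 unfolding i_def by (auto simp: of_nat_nat) linarith+
    have "t * real K / 24 \<le> real K" using t K0 by (simp add: field_simps)
    then have "i \<le> K" using i(1) by linarith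
    have "\<bar>t - 24 * real i / real K\<bar> = (24 / real K) * \<bar>t * real K / 24 - real i\<bar>"
    proof -
      have "t - 24 * real i / real K = (24 / real K) * (t * real K / 24 - real i)"
        using K0 by (simp add: field_simps)
      then show ?thesis using K0 by (simp only: abs_mult) simp
    qed
    also have "\<dots> \<le> (24 / real K) * 1" using i K0 by (intro mult_left_mono) auto
    finally have "\<bar>t - 24 * real i / real K\<bar> \<le> 24 / real K" by simp
    then have "p ((t - 24 * real i / real K) *\<^sub>R y) \<le> (24 / real K) * p y"
      unfolding p_scaleR by (rule mult_right_mono) simp
    also have "\<dots> \<le> R / 2" using K K0 R(1) by (simp add: field_simps)
    finally have "p (z - t *\<^sub>R y + (t - 24 * real i / real K) *\<^sub>R y) < R"
      using z p_triangle[of "z - t *\<^sub>R y" "(t - 24 * real i / real K) *\<^sub>R y"] by simp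
    then have "p (z - ?c i) < R" by (simp add: scaleR_left_diff_distrib)
    then have "cmod (F n z) \<le> \<bar>M (?c i)\<bar>" using M[OF n] by (smt (verit))
    also have "\<dots> \<le> (\<Sum>i\<le>K. \<bar>M (?c i)\<bar>)" using \<open>i \<le> K\<close> by (intro member_le_sum) auto
    finally show ?thesis .
  qed
  then show ?thesis by (intro exI[of _ "\<Sum>i\<le>K. \<bar>M (?c i)\<bar>"]) (auto intro: sum_nonneg)
qed

text \<open>The bump is \<open>exp (- U z)\<close> with \<open>U z = (\<Sum>l. (cmod (Q (z / 2 ^ l)))\<^sup>2) / \<alpha>\<^sup>2\<close>. One term would
  suffice for separation; the sum over all scales makes \<open>U z\<close> at least \<open>l + 1\<close> once \<open>p z \<ge> 2 ^ l\<close>,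
  which yields the decay. It converges because \<open>Q\<close> has no constant term. The radius \<open>r\<close> of the germs is the same at
  all points, and their constant is locally bounded at the uniform scale \<open>\<eta>\<close>.\<close>

lemma analytic_bump:
  assumes Q: "uniformly_star_analytic_separating p Q"
  obtains v r \<eta> where "0 < r" "0 < \<eta>" "\<And>x. 0 < v x" "\<And>x. v x \<le> 1"
    "\<And>x. p x < \<eta> \<Longrightarrow> 3/4 \<le> v x" "\<And>x. 1 \<le> p x \<Longrightarrow> v x \<le> 2/5" "\<And>x. 1 \<le> p x \<Longrightarrow> v x * p x \<le> 1"
    "\<And>y. \<exists>C. \<forall>x. p (x - y) < \<eta> \<longrightarrow> germ r C (\<lambda>h. of_real (v (x + h)) :: complex)"
proof -
  obtain Qn R \<alpha> where Qn: "\<And>n. 1 \<le> n \<Longrightarrow> star_polynomial n (Qn n)"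
      "\<And>n. 1 \<le> n \<Longrightarrow> continuous_map (mtopology_of (norm_metric p)) euclidean (Qn n)"
      "\<And>x. (\<lambda>N. \<Sum>n=1..N. Qn n x) \<longlonglongrightarrow> Q x"
    and R: "0 < R" "\<And>c. uniform_limit {x. p (x - c) < R} (\<lambda>N x. \<Sum>n=1..N. Qn n x) Q sequentially"
    and \<alpha>: "{x. cmod (Q x) < \<alpha>} \<noteq> {}" "{x. cmod (Q x) < \<alpha>} \<subseteq> {x. p x < 1}"
    using Q unfolding uniformly_star_analytic_separating_def by blast
  have hp: "homogeneous_polynomial n (Qn n)" if "0 < n" for n
    using that by (intro homogeneous_polynomial_if_star_polynomial Qn(1)) simp
  have Q_sums: "(\<lambda>i. Qn (Suc i) x) sums Q x" for x
    using Qn(3)[of x] unfolding sums_def by (simp add: sum.atLeast1_atMost_eq)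
  have \<alpha>_pos: "0 < \<alpha>"
  proof -
    obtain x where "cmod (Q x) < \<alpha>" using \<alpha>(1) by auto
    then show ?thesis using norm_ge_zero le_less_trans by blast
  qed
  \<comment> \<open>For \<open>p (x - y) < \<rho>\<close> the tube of width \<open>24 * \<rho>\<close> around the segment to \<open>24 *\<^sub>R x\<close> lies in the tube
    of width \<open>48 * \<rho> < R / 2\<close> around the segment to \<open>24 *\<^sub>R y\<close>.\<close>
  define \<rho> where "\<rho> = R / 120"
  have \<rho>: "0 < \<rho>" using R(1) by (simp add: \<rho>_def)
  define W where "W l z = Q ((1/2) ^ l *\<^sub>R z) * cnj (Q ((1/2) ^ l *\<^sub>R z))" for l z
  have germ_W: "\<exists>C\<ge>0. \<forall>x. p (x - y) < \<rho> \<longrightarrow>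
      (\<forall>l. germ (\<rho> / 2) (C * (1/4) ^ l) (\<lambda>h. W l (x + h)))" for y
  proof -
    obtain M where M: "0 \<le> M" "\<And>n t z. 0 < n \<Longrightarrow> 0 \<le> t \<Longrightarrow> t \<le> 24 \<Longrightarrow> p (z - t *\<^sub>R y) < R / 2 \<Longrightarrow> cmod (Qn n z) \<le> M"
      using terms_bounded_on_tube[OF hp continuous_norm_bound_near_zero[OF Qn(2)] R(1) R(2), of y] by auto
    have "germ (\<rho> / 2) ((32 * M)\<^sup>2 * (1/4) ^ l) (\<lambda>h. W l (x + h))" if x: "p (x - y) < \<rho>" for x l
    proof -
      define F where "F n z = Qn n ((1/2) ^ l *\<^sub>R z)" for n z
      have F: "F n z = of_real ((1/2) ^ l) ^ n * Qn n z" if "0 < n" for n z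
        using hp[OF that] by (simp add: F_def homogeneous_polynomial_def)
      have hF: "homogeneous_polynomial n (F n)" if "0 < n" for n
      proof -
        have "F n = (\<lambda>z. of_real ((1/2) ^ l) ^ n * Qn n z)" by (rule ext) (rule F[OF that])
        then show ?thesis using homogeneous_polynomial_cmult[OF hp[OF that]] by simp
      qed
      have tube: "cmod (F n (t *\<^sub>R x + g)) \<le> M * (1/2) ^ l"
        if n: "0 < n" and t: "0 \<le> t" "t \<le> 24" and g: "p g \<le> 24 * \<rho>" for n t g
      proof -
        have "p (t *\<^sub>R (x - y) + g) \<le> t * p (x - y) + p g"
          using p_triangle[of "t *\<^sub>R (x - y)" g] t by simp
        also have "\<dots> \<le> 24 * \<rho> + 24 * \<rho>" using t x g by (intro add_mono mult_mono) auto
        also have "\<dots> < R / 2" using R(1) by (simp add: \<rho>_def)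
        finally have "cmod (Qn n (t *\<^sub>R x + g)) \<le> M"
          using t n by (intro M(2)[of n t]) (simp_all add: scaleR_diff_right algebra_simps)
        moreover have "((1/2) ^ l) ^ n \<le> ((1/2::real) ^ l) ^ 1"
          using n by (intro power_decreasing) (auto simp: power_le_one)
        ultimately show ?thesis
          unfolding F[OF n] norm_mult norm_power using M(1)
          by (subst mult.commute) (intro mult_mono, auto simp: norm_power norm_divide)
      qed
      have "germ (\<rho> / 2) (32 * (M * (1/2) ^ l)) (\<lambda>h. \<Sum>i. F (Suc i) (x + h))"
        by (rule germ_homogeneous_series[OF hF \<rho> tube])
      then have g: "germ (\<rho> / 2) (32 * (M * (1/2) ^ l)) (\<lambda>h. Q ((1/2) ^ l *\<^sub>R (x + h)))"
        using sums_unique[OF Q_sums] by (simp add: F_def)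
      have "germ (\<rho> / 2) (32 * (M * (1/2) ^ l) * (32 * (M * (1/2) ^ l))) (\<lambda>h. W l (x + h))"
        unfolding W_def by (intro germ_mult germ_cnj g)
      moreover have "32 * (M * (1/2) ^ l) * (32 * (M * (1/2) ^ l)) = (32 * M)\<^sup>2 * ((1/2) * (1/2)) ^ l"
        by (simp only: power_mult_distrib power2_eq_square mult_ac)
      ultimately show ?thesis by simp
    qed
    then show ?thesis by (intro exI[of _ "(32 * M)\<^sup>2"]) auto
  qed
  have geo: "(\<lambda>l. C * (1/4) ^ l) sums (C * (4/3))" for C :: real
    using sums_mult[OF geometric_sums[of "1/4::real"], of C] by simp
  define u where "u l z = (cmod (Q ((1/2) ^ l *\<^sub>R z)))\<^sup>2 / \<alpha>\<^sup>2" for l z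
  define U where "U z = (\<Sum>l. u l z)" for z
  have u_W: "of_real (u l z) = of_real (1 / \<alpha>\<^sup>2) * W l z" for l z
    by (simp add: u_def W_def complex_norm_square flip: of_real_power)
  have summable_W: "summable (\<lambda>l. W l x)" for x
  proof -
    obtain C where "\<forall>z. p (z - x) < \<rho> \<longrightarrow> (\<forall>l. germ (\<rho> / 2) (C * (1/4) ^ l) (\<lambda>h. W l (z + h)))"
      using germ_W[of x] by blast
    then have "germ (\<rho> / 2) (C * (1/4) ^ l) (\<lambda>h. W l (x + h))" for l
      using \<rho> by (auto dest!: spec[of _ x])
    from germ_suminf(2)[OF this sums_summable[OF geo], of 0] show ?thesis using \<rho> by simp
  qed
  have summable_u: "summable (\<lambda>l. u l z)" for z
    using summable_mult[OF summable_W, of "of_real (1 / \<alpha>\<^sup>2)" z]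
    unfolding u_W[symmetric] by (rule summable_of_real_iff[THEN iffD1])
  have U_W: "of_real (U z) = of_real (1 / \<alpha>\<^sup>2) * (\<Sum>l. W l z)" for z
    unfolding U_def suminf_of_real[OF summable_u] u_W by (rule suminf_mult[OF summable_W])
  have u_nonneg: "0 \<le> u l z" for l z by (simp add: u_def)
  have U_nonneg: "0 \<le> U z" for z unfolding U_def by (intro suminf_nonneg summable_u u_nonneg)
  define v where "v z = exp (- U z)" for z
  have germ_v: "\<exists>C. \<forall>x. p (x - y) < \<rho> \<longrightarrow> germ (\<rho> / 2) C (\<lambda>h. of_real (v (x + h)) :: complex)" for y
  proof -
    obtain C where C: "\<And>x l. p (x - y) < \<rho> \<Longrightarrow> germ (\<rho> / 2) (C * (1/4) ^ l) (\<lambda>h. W l (x + h))"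
      using germ_W[of y] by auto
    have "germ (\<rho> / 2) (8 * exp (cmod (of_real (- 1 / \<alpha>\<^sup>2)) * (\<Sum>l. C * (1/4) ^ l)))
        (\<lambda>h. of_real (v (x + h)) :: complex)" if "p (x - y) < \<rho>" for x
    proof -
      have "(of_real (v z) :: complex) = exp (of_real (- 1 / \<alpha>\<^sup>2) * (\<Sum>l. W l z))" for z
        using U_W[of z] by (simp add: v_def exp_of_real[symmetric])
      then show ?thesis
        by (simp only:) (intro germ_exp germ_cmult germ_suminf(1) C that sums_summable[OF geo])
    qed
    then show ?thesis by blast
  qed
  have far: "v z \<le> exp (- real (Suc n))" if "2 ^ n \<le> p z" for z n
  proof -
    have "1 \<le> u l z" if "l \<in> {..<Suc n}" for l
    proof -
      have "(2::real) ^ l \<le> 2 ^ n" using that by (intro power_increasing) auto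
      then have "(2::real) ^ l \<le> p z" using \<open>2 ^ n \<le> p z\<close> by (rule order_trans)
      then have "1 \<le> p ((1/2) ^ l *\<^sub>R z)" by (simp add: power_divide)
      then have "(1/2) ^ l *\<^sub>R z \<notin> {x. cmod (Q x) < \<alpha>}"
        using subsetD[OF \<alpha>(2), of "(1/2) ^ l *\<^sub>R z"] by (auto simp del: p_scaleR)
      then have "\<alpha> \<le> cmod (Q ((1/2) ^ l *\<^sub>R z))" by (simp only: mem_Collect_eq not_less)
      then have "\<alpha>\<^sup>2 \<le> (cmod (Q ((1/2) ^ l *\<^sub>R z)))\<^sup>2" using \<alpha>_pos by (intro power_mono) auto
      then show ?thesis using \<alpha>_pos by (simp add: u_def)
    qed
    then have "(\<Sum>l<Suc n. 1) \<le> (\<Sum>l<Suc n. u l z)" by (rule sum_mono)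
    also have "\<dots> \<le> U z" unfolding U_def by (intro sum_le_suminf summable_u) (auto simp: u_nonneg)
    finally show ?thesis by (simp add: v_def)
  qed
  obtain \<eta> where \<eta>: "0 < \<eta>" "\<eta> \<le> \<rho>" "\<And>x. p x < \<eta> \<Longrightarrow> 3/4 \<le> v x"
  proof -
    obtain C where "\<forall>x. p (x - 0) < \<rho> \<longrightarrow> germ (\<rho> / 2) C (\<lambda>h. of_real (v (x + h)) :: complex)"
      using germ_v[of 0] by blast
    then have C: "germ (\<rho> / 2) C (\<lambda>h. of_real (v (0 + h)) :: complex)"
      using \<rho> by (auto dest!: spec[of _ 0] simp del: add_0)
    have C0: "0 \<le> C" using C by (rule germE)
    define t where "t = 1 / (4 * (C + 1))"
    have t: "0 < t" "t \<le> 1" "t * C \<le> 1/4" using C0 by (auto simp: t_def field_simps)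
    have "v 0 = 1"
    proof -
      have "Qn (Suc i) 0 = 0" for i
        using hp[of "Suc i"] unfolding homogeneous_polynomial_def
        by (metis mult_zero_left of_real_0 power_0_Suc scaleR_zero_left zero_less_Suc)
      then have "Q 0 = 0" using sums_unique[OF Q_sums[of 0]] by simp
      then show ?thesis by (simp add: v_def U_def u_def)
    qed
    have "3/4 \<le> v x" if "p x < t * (\<rho> / 2)" for x
    proof -
      have "cmod (of_real (v (0 + x)) - of_real (v (0 + 0))) \<le> t * C"
        by (rule germ_norm_le[OF germ_increment[OF C t(1,2)] that])
      then have "cmod (of_real (v x - v 0)) \<le> t * C" by simp
      then have "\<bar>v x - 1\<bar> \<le> 1/4" using t(3) \<open>v 0 = 1\<close> by (simp only: norm_of_real)
      then show ?thesis by linarith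
    qed
    moreover have "t * (\<rho> / 2) \<le> \<rho>" using t \<rho> by (simp add: field_simps)
    ultimately show ?thesis using that[of "t * (\<rho> / 2)"] t \<rho> by simp
  qed
  show ?thesis
  proof (rule that[of "\<rho> / 2" \<eta> v])
    show "v x \<le> 1" for x using U_nonneg[of x] by (simp add: v_def)
    show "v x \<le> 2/5" if "1 \<le> p x" for x
    proof -
      have "v x \<le> exp (- 1)" using far[of 0 x] that by simp
      also have "exp (- 1 :: real) = 1 / exp 1" by (simp add: exp_minus inverse_eq_divide)
      also have "\<dots> \<le> 1 / (5/2)" using exp_lower_Taylor_quadratic[of 1] by (intro divide_left_mono) auto
      finally show ?thesis by simp
    qed
    show "v x * p x \<le> 1" if "1 \<le> p x" for x
    proof -
      obtain m where m: "p x < 2 ^ m" using real_arch_pow[of 2 "p x"] by auto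
      define k where "k = (LEAST m. p x < 2 ^ m)"
      have k: "p x < 2 ^ k" unfolding k_def using m by (rule LeastI)
      then obtain n where n: "k = Suc n" using \<open>1 \<le> p x\<close> by (cases k) auto
      have "\<not> p x < 2 ^ n" using not_less_Least[of n "\<lambda>m. p x < 2 ^ m"] n by (simp add: k_def)
      then have "v x \<le> exp (- real (Suc n))" by (intro far) simp
      then have "v x * p x \<le> exp (- real (Suc n)) * 2 ^ Suc n"
        using k n by (intro mult_mono) auto
      also have "\<dots> \<le> exp (- real (Suc n)) * exp 1 ^ Suc n"
        using exp_ge_add_one_self[of 1] by (intro mult_left_mono power_mono) auto
      also have "\<dots> = 1" by (simp only: exp_of_nat_mult[symmetric] mult_1_right mult_exp_exp) simp
      finally show ?thesis .
    qed
    show "\<exists>C. \<forall>x. p (x - y) < \<eta> \<longrightarrow> germ (\<rho> / 2) C (\<lambda>h. of_real (v (x + h)) :: complex)" for y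
      using germ_v[of y] \<eta>(2) by (meson less_le_trans)
  qed (use \<rho> \<eta> in \<open>auto simp: v_def\<close>)
qed

end

section \<open>A nearly subordinate analytic family\<close>

text \<open>The box consists of the points at which \<open>n\<close> is the first index with coordinate at least \<open>1/2\<close>
  (up to the boundary).\<close>

lemma finite_net:
  fixes a :: "nat \<Rightarrow> real"
  assumes a: "\<And>j. 0 \<le> a j" "\<And>j. a j \<le> 1" and e: "0 < e"
  shows "\<exists>\<Omega>. finite \<Omega> \<and>
    (\<forall>\<omega>\<in>\<Omega>. (\<forall>j\<le>n. 0 \<le> \<omega> j \<and> \<omega> j \<le> 1) \<and> (\<forall>j<n. \<omega> j \<le> 1/2) \<and> 1/2 \<le> \<omega> n) \<and>
    (\<forall>z. (\<forall>j\<le>n. 0 \<le> z j \<and> z j \<le> 1) \<longrightarrow> (\<forall>j<n. z j \<le> 1/2) \<longrightarrow> 1/2 \<le> z n \<longrightarrow>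
      (\<exists>\<omega>\<in>\<Omega>. (\<Sum>j\<le>n. a j * (z j - \<omega> j)\<^sup>2) \<le> e))"
proof -
  obtain N where N: "(real n + 1) / e < real N" using reals_Archimedean2 by blast
  have N0: "0 < real N" by (rule le_less_trans[OF _ N]) (use e in simp)
  then have N1: "1 \<le> real N" by simp
  define \<phi> where "\<phi> s = real (nat \<lfloor>2 * real N * s\<rfloor>) / (2 * real N)" for s
  have \<phi>: "\<phi> s \<le> s" "s \<le> \<phi> s + 1 / (2 * real N)" if "0 \<le> s" for s
  proof -
    have eq: "real (nat \<lfloor>2 * real N * s\<rfloor>) = of_int \<lfloor>2 * real N * s\<rfloor>" using that by simp
    show "\<phi> s \<le> s" using N0 unfolding \<phi>_def eq by (simp add: field_simps of_int_floor_le)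
    have "2 * real N * s \<le> of_int \<lfloor>2 * real N * s\<rfloor> + 1" by linarith
    then show "s \<le> \<phi> s + 1 / (2 * real N)" using N0 unfolding \<phi>_def eq
      by (simp add: add_divide_distrib[symmetric] pos_le_divide_eq mult_ac)
  qed
  have \<phi>_half: "1/2 \<le> \<phi> s" if "1/2 \<le> s" for s
  proof -
    have "of_nat N \<le> 2 * real N * s" using that N0 by (simp add: field_simps)
    then have "int N \<le> \<lfloor>2 * real N * s\<rfloor>" by (simp add: le_floor_iff)
    then have "real N \<le> real (nat \<lfloor>2 * real N * s\<rfloor>)" by linarith
    then show ?thesis using N0 by (simp add: \<phi>_def field_simps)
  qed
  define \<Omega> where "\<Omega> = {\<omega> \<in> (\<Pi>\<^sub>E j\<in>{..n}. (\<lambda>i. real i / (2 * real N)) ` {..2 * N}).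
    (\<forall>j\<le>n. 0 \<le> \<omega> j \<and> \<omega> j \<le> 1) \<and> (\<forall>j<n. \<omega> j \<le> 1/2) \<and> 1/2 \<le> \<omega> n}"
  have "finite \<Omega>"
    unfolding \<Omega>_def
    by (rule finite_subset[of _ "\<Pi>\<^sub>E j\<in>{..n}. (\<lambda>i. real i / (2 * real N)) ` {..2 * N}"])
      (auto intro: finite_PiE)
  moreover have "\<exists>\<omega>\<in>\<Omega>. (\<Sum>j\<le>n. a j * (z j - \<omega> j)\<^sup>2) \<le> e"
    if z: "\<forall>j\<le>n. 0 \<le> z j \<and> z j \<le> 1" "\<forall>j<n. z j \<le> 1/2" "1/2 \<le> z n" for z
  proof
    define \<omega> where "\<omega> = restrict (\<lambda>j. \<phi> (z j)) {..n}"
    have "nat \<lfloor>2 * real N * z j\<rfloor> \<in> {..2 * N}" if "j \<le> n" for j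
    proof -
      have "2 * real N * z j \<le> 2 * real N" using z(1) that N0 by simp
      then show ?thesis by (simp add: nat_le_iff floor_le_iff)
    qed
    then have "\<omega> \<in> (\<Pi>\<^sub>E j\<in>{..n}. (\<lambda>i. real i / (2 * real N)) ` {..2 * N})"
      unfolding \<omega>_def \<phi>_def by auto
    moreover have \<omega>: "0 \<le> \<omega> j" "\<omega> j \<le> z j" if "j \<le> n" for j
      using \<phi>(1)[of "z j"] z(1) that by (auto simp: \<omega>_def) (simp add: \<phi>_def)
    moreover have "\<omega> j \<le> 1" if "j \<le> n" for j
      using \<omega>(2)[OF that] z(1) that by fastforce
    moreover have "\<omega> j \<le> 1/2" if "j < n" for j
      using \<omega>(2)[of j] z(2) that by fastforce
    moreover have "1/2 \<le> \<omega> n" using \<phi>_half[OF z(3)] by (simp add: \<omega>_def)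
    ultimately show "\<omega> \<in> \<Omega>" unfolding \<Omega>_def by blast
    have "a j * (z j - \<omega> j)\<^sup>2 \<le> 1 / real N" if "j \<le> n" for j
    proof -
      have "0 \<le> z j - \<omega> j" "z j - \<omega> j \<le> 1 / (2 * real N)"
        using \<phi>[of "z j"] z(1) that by (auto simp: \<omega>_def)
      then have "(z j - \<omega> j)\<^sup>2 \<le> (1 / (2 * real N))\<^sup>2" by (intro power_mono)
      also have "\<dots> = (1 / real N) * (1 / (4 * real N))" by (simp add: power2_eq_square)
      also have "\<dots> \<le> (1 / real N) * 1" using N1 by (intro mult_left_mono) auto
      finally have "(z j - \<omega> j)\<^sup>2 \<le> 1 / real N" by simp
      then have "a j * (z j - \<omega> j)\<^sup>2 \<le> 1 * (1 / real N)" using a by (intro mult_mono) auto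
      then show ?thesis by simp
    qed
    then have "(\<Sum>j\<le>n. a j * (z j - \<omega> j)\<^sup>2) \<le> (\<Sum>j\<le>n. 1 / real N)" by (intro sum_mono) auto
    also have "\<dots> = (real n + 1) / real N" by simp
    also have "\<dots> \<le> e" using N N0 e by (simp add: field_simps)
    finally show "(\<Sum>j\<le>n. a j * (z j - \<omega> j)\<^sup>2) \<le> e" .
  qed
  ultimately show ?thesis by (intro exI[of _ \<Omega>]) (auto simp: \<Omega>_def)
qed

lemma exp_minus_le: "0 \<le> t \<Longrightarrow> exp (- t) \<le> 1 / (1 + t)" for t :: real
  using exp_ge_add_one_self[of t] by (simp add: exp_minus inverse_eq_divide frac_le)

text \<open>Both requirements ask for \<open>\<kappa> n\<close> to be large. The sequence \<open>\<kappa>\<close> must not depend on \<open>c\<close>,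
  because \<open>c\<close> depends on the point at which a germ is considered.\<close>

lemma exponents_exist:
  fixes b K L :: "nat \<Rightarrow> real"
  assumes b: "\<And>n. 0 < b n" and K: "\<And>n. 0 \<le> K n" and L: "\<And>n. 0 \<le> L n"
  obtains \<kappa> where "\<And>n. 0 \<le> \<kappa> n" "\<And>n. K n * exp (- (\<kappa> n * b n)) \<le> (1/2) ^ n / 8"
    "\<And>c. 0 < c \<Longrightarrow> summable (\<lambda>n. L n * exp (- (\<kappa> n * c)))"
proof
  define \<kappa> where "\<kappa> n = 8 * K n * 2 ^ n / b n + real n * (1 + L n)" for n
  show \<kappa>: "0 \<le> \<kappa> n" for n
    using b[of n] K[of n] L[of n] by (simp add: \<kappa>_def)
  show "K n * exp (- (\<kappa> n * b n)) \<le> (1/2) ^ n / 8" for n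
  proof -
    define t where "t = 8 * K n * 2 ^ n"
    have t: "0 \<le> t" using K[of n] by (simp add: t_def)
    have "t \<le> \<kappa> n * b n"
      using b[of n] L[of n] by (simp add: \<kappa>_def t_def field_simps)
    then have "exp (- (\<kappa> n * b n)) \<le> 1 / (1 + t)"
      using exp_minus_le[OF t] by (meson exp_le_cancel_iff neg_le_iff_le order_trans)
    then have "K n * exp (- (\<kappa> n * b n)) \<le> K n * (1 / (1 + t))" using K by (rule mult_left_mono)
    also have "\<dots> = (t / (1 + t)) * ((1/2) ^ n / 8)" by (simp add: t_def power_divide)
    also have "\<dots> \<le> 1 * ((1/2) ^ n / 8)" using t by (intro mult_right_mono) auto
    finally show ?thesis by simp
  qed
  fix c :: real assume c: "0 < c"
  have le: "L n * exp (- (\<kappa> n * c)) \<le> (1 / c) * exp (- c) ^ n" if "1 \<le> n" for n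
  proof -
    have "exp (- (\<kappa> n * c)) \<le> exp (- (real n * (1 + L n) * c))"
    proof -
      have "real n * (1 + L n) \<le> \<kappa> n" using b[of n] K[of n] by (simp add: \<kappa>_def)
      then show ?thesis using c by (simp add: mult_right_mono)
    qed
    also have "\<dots> = exp (- (real n * L n * c)) * exp (- c) ^ n"
      by (simp add: exp_of_nat_mult[symmetric] mult_exp_exp algebra_simps)
    finally have "L n * exp (- (\<kappa> n * c)) \<le> (L n * exp (- (real n * L n * c))) * exp (- c) ^ n"
      using L[of n] by (simp add: mult_left_mono mult.assoc)
    also have "L n * exp (- (real n * L n * c)) \<le> L n * (1 / (1 + real n * L n * c))"
      using L[of n] c by (intro mult_left_mono exp_minus_le) auto
    also have "\<dots> \<le> 1 / c"
    proof -
      define t where "t = real n * L n * c"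
      have t: "0 \<le> t" using L[of n] c by (simp add: t_def)
      have "L n * c \<le> t" using that L[of n] c mult_right_mono[of 1 "real n" "L n * c"]
        by (simp add: t_def mult.assoc)
      then have "L n \<le> (1 + t) / c" using c by (simp add: pos_le_divide_eq)
      then show ?thesis using t unfolding t_def[symmetric] by (simp add: field_simps)
    qed
    finally show ?thesis by (simp add: mult_right_mono)
  qed
  show "summable (\<lambda>n. L n * exp (- (\<kappa> n * c)))"
  proof (rule summable_comparison_test')
    show "summable (\<lambda>n. (1 / c) * exp (- c) ^ n)"
      by (intro summable_mult summable_geometric) (use c in simp)
    show "norm (L n * exp (- (\<kappa> n * c))) \<le> (1 / c) * exp (- c) ^ n" if "1 \<le> n" for n
      using le[OF that] L[of n] by simp
  qed
qed

context normed_by begin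

text \<open>In the application \<open>C j m\<close> bounds the germ of the bump \<open>V j\<close> at all points near the \<open>m\<close>-th centre.
  These constants may grow arbitrarily with \<open>j\<close>, so the weight \<open>a j\<close> is chosen against all \<open>C j m\<close>
  with \<open>m \<le> j\<close>: for a point near the \<open>m\<close>-th centre all but the first \<open>m\<close> weights are then small enough. The
  sequence \<open>w\<close> is the size of the coefficients that \<open>\<psi>\<close> will be multiplied with.\<close>

lemma analytic_partition:
  fixes V :: "nat \<Rightarrow> 'a \<Rightarrow> real" and C :: "nat \<Rightarrow> nat \<Rightarrow> real" and w :: "nat \<Rightarrow> real"
  assumes V: "\<And>n x. 0 < V n x" "\<And>n x. V n x \<le> 1" and r: "0 < r" and w: "\<And>n. 0 \<le> w n"
    and cover: "\<And>x. \<exists>m. 3/4 \<le> V m x \<and> (\<forall>j. germ r (C j m) (\<lambda>h. of_real (V j (x + h)) :: complex))"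
  obtains \<psi> :: "nat \<Rightarrow> 'a \<Rightarrow> real" where "\<And>n x. 0 \<le> \<psi> n x"
    "\<And>n x. V n x \<le> 2/5 \<Longrightarrow> \<psi> n x \<le> V n x * ((1/2) ^ n / 8)"
    "\<And>x. \<exists>n. 1/2 \<le> \<psi> n x"
    "\<And>x. \<exists>s P. (\<forall>n. germ s (P n) (\<lambda>h. of_real (\<psi> n (x + h)) :: complex)) \<and> summable (\<lambda>n. P n * (1 + w n))"
proof -
  define M where "M n = (\<Sum>m\<le>n. \<bar>C n m\<bar>)" for n
  have M: "C n m \<le> M n" if "m \<le> n" for n m
    using member_le_sum[of m "{..n}" "\<lambda>m. \<bar>C n m\<bar>"] that unfolding M_def by simp
  have M0: "0 \<le> M n" for n by (simp add: M_def sum_nonneg)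
  define a where "a j = (1/2) ^ j / (1 + M j)\<^sup>2" for j
  have a_pos: "0 < a j" for j using M0[of j] by (simp add: a_def)
  have a_half: "a j \<le> (1/2) ^ j" for j
    using M0[of j] by (simp add: a_def divide_le_eq power_le_one_iff mult_left_le_one_le one_le_power)
  have a_le1: "a j \<le> 1" for j using a_half[of j] by (rule order_trans) (simp add: power_le_one)
  define net where "net n \<Omega> \<longleftrightarrow> finite \<Omega> \<and>
    (\<forall>\<omega>\<in>\<Omega>. (\<forall>j\<le>n. 0 \<le> \<omega> j \<and> \<omega> j \<le> 1) \<and> (\<forall>j<n. \<omega> j \<le> 1/2) \<and> 1/2 \<le> \<omega> n) \<and>
    (\<forall>z. (\<forall>j\<le>n. 0 \<le> z j \<and> z j \<le> 1) \<longrightarrow> (\<forall>j<n. z j \<le> 1/2) \<longrightarrow> 1/2 \<le> z n \<longrightarrow>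
      (\<exists>\<omega>\<in>\<Omega>. (\<Sum>j\<le>n. a j * (z j - \<omega> j)\<^sup>2) \<le> a n / 200))" for n and \<Omega> :: "(nat \<Rightarrow> real) set"
  have "\<exists>\<Omega>. net n \<Omega>" for n
    unfolding net_def by (rule finite_net) (use a_pos[of n] in \<open>auto intro: a_le1 less_imp_le[OF a_pos]\<close>)
  then obtain \<Omega> where net: "net n (\<Omega> n)" for n by metis
  have \<Omega>: "\<And>n. finite (\<Omega> n)"
      "\<And>n \<omega> j. \<omega> \<in> \<Omega> n \<Longrightarrow> j \<le> n \<Longrightarrow> 0 \<le> \<omega> j \<and> \<omega> j \<le> 1"
      "\<And>n \<omega> j. \<omega> \<in> \<Omega> n \<Longrightarrow> j < n \<Longrightarrow> \<omega> j \<le> 1/2" "\<And>n \<omega>. \<omega> \<in> \<Omega> n \<Longrightarrow> 1/2 \<le> \<omega> n"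
      "\<And>n z. (\<forall>j\<le>n. 0 \<le> z j \<and> z j \<le> 1) \<Longrightarrow> (\<forall>j<n. z j \<le> 1/2) \<Longrightarrow> 1/2 \<le> z n \<Longrightarrow>
        \<exists>\<omega>\<in>\<Omega> n. (\<Sum>j\<le>n. a j * (z j - \<omega> j)\<^sup>2) \<le> a n / 200"
    using net unfolding net_def by blast+
  define K where "K n = real (card (\<Omega> n))" for n
  define L where "L n = 8 * K n * M n * (1 + w n)" for n
  obtain \<kappa> where \<kappa>: "\<And>n. 0 \<le> \<kappa> n" "\<And>n. K n * exp (- (\<kappa> n * (a n / 200))) \<le> (1/2) ^ n / 8"
    "\<And>c. 0 < c \<Longrightarrow> summable (\<lambda>n. L n * exp (- (\<kappa> n * c)))"
  proof (rule exponents_exist)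
    show "0 < a n / 200" for n using a_pos[of n] by simp
    show "0 \<le> K n" for n by (simp add: K_def)
    show "0 \<le> L n" for n using w[of n] M0[of n] by (simp add: L_def K_def)
  qed (rule that)
  define D where "D n \<omega> x = (\<Sum>j\<le>n. a j * (V j x - \<omega> j)\<^sup>2)" for n \<omega> x
  define g where "g n \<omega> x = exp (\<kappa> n * (a n / 200 - D n \<omega> x))" for n \<omega> x
  define \<psi> where "\<psi> n x = V n x * (\<Sum>\<omega>\<in>\<Omega> n. g n \<omega> x)" for n x
  have D_ge: "a j * (V j x - \<omega> j)\<^sup>2 \<le> D n \<omega> x" if "j \<le> n" for j n \<omega> x
    unfolding D_def using that
    by (intro member_le_sum[of j "{..n}" "\<lambda>j. a j * (V j x - \<omega> j)\<^sup>2"])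
      (auto intro!: mult_nonneg_nonneg less_imp_le[OF a_pos])
  have nonneg: "0 \<le> \<psi> n x" for n x
    unfolding \<psi>_def g_def using V(1)[of n x] by (intro mult_nonneg_nonneg sum_nonneg) auto
  have far: "\<psi> n x \<le> V n x * ((1/2) ^ n / 8)" if "V n x \<le> 2/5" for n x
  proof -
    have "g n \<omega> x \<le> exp (- (\<kappa> n * (a n / 200)))" if \<omega>: "\<omega> \<in> \<Omega> n" for \<omega>
    proof -
      have "1/10 \<le> \<omega> n - V n x" using \<Omega>(4)[OF \<omega>] \<open>V n x \<le> 2/5\<close> by simp
      then have "(1/10)\<^sup>2 \<le> (\<omega> n - V n x)\<^sup>2" by (intro power_mono) auto
      then have "a n * (1/10)\<^sup>2 \<le> a n * (V n x - \<omega> n)\<^sup>2"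
        using a_pos[of n] by (simp add: power2_commute)
      also have "\<dots> \<le> D n \<omega> x" by (rule D_ge) simp
      finally have "\<kappa> n * (a n / 200 - D n \<omega> x) \<le> \<kappa> n * (- (a n / 200))"
        using \<kappa>(1) by (intro mult_left_mono) (auto simp: power2_eq_square)
      then show ?thesis by (simp add: g_def)
    qed
    then have "(\<Sum>\<omega>\<in>\<Omega> n. g n \<omega> x) \<le> K n * exp (- (\<kappa> n * (a n / 200)))"
      unfolding K_def by (rule sum_bounded_above)
    also have "\<dots> \<le> (1/2) ^ n / 8" by (rule \<kappa>(2))
    finally show ?thesis unfolding \<psi>_def using V(1)[of n x] by (intro mult_left_mono) auto
  qed
  have large: "\<exists>n. 1/2 \<le> \<psi> n x" for x
  proof -
    obtain m where "3/4 \<le> V m x" using cover[of x] by blast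
    then have "1/2 \<le> V m x" by linarith
    define n where "n = (LEAST n. 1/2 \<le> V n x)"
    have n: "1/2 \<le> V n x" unfolding n_def using \<open>1/2 \<le> V m x\<close> by (rule LeastI)
    have less: "V j x \<le> 1/2" if "j < n" for j
      using not_less_Least[of j "\<lambda>n. 1/2 \<le> V n x"] that unfolding n_def by simp
    have "\<exists>\<omega>\<in>\<Omega> n. D n \<omega> x \<le> a n / 200"
      unfolding D_def by (rule \<Omega>(5)) (use n less V less_imp_le[OF V(1)] in blast)+
    then obtain \<omega> where \<omega>: "\<omega> \<in> \<Omega> n" "D n \<omega> x \<le> a n / 200" by blast
    have "1 \<le> g n \<omega> x" using \<omega>(2) \<kappa>(1)[of n] by (simp add: g_def)
    also have "\<dots> \<le> (\<Sum>\<omega>\<in>\<Omega> n. g n \<omega> x)"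
      using \<omega>(1) \<Omega>(1) by (intro member_le_sum) (auto simp: g_def)
    finally have "1/2 * 1 \<le> \<psi> n x" unfolding \<psi>_def using n V(1)[of n x] by (intro mult_mono) auto
    then show ?thesis by auto
  qed
  have germs: "\<exists>s P. (\<forall>n. germ s (P n) (\<lambda>h. of_real (\<psi> n (x + h)) :: complex)) \<and>
      summable (\<lambda>n. P n * (1 + w n))" for x
  proof -
    obtain m where m: "3/4 \<le> V m x" "\<And>j. germ r (C j m) (\<lambda>h. of_real (V j (x + h)) :: complex)"
      using cover[of x] by blast
    define B where "B j = C j m" for j
    have B0: "0 \<le> B j" for j using m(2)[of j] unfolding B_def by (rule germE)
    define T where "T j = a j * (B j * B j + 2 * B j)" for j
    have T0: "0 \<le> T j" for j using B0[of j] a_pos[of j] by (simp add: T_def)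
    have T_le: "T j \<le> (1/2) ^ j" if "m \<le> j" for j
    proof -
      have "B j * B j + 2 * B j \<le> (1 + B j)\<^sup>2" by (simp add: power2_eq_square algebra_simps)
      also have "\<dots> \<le> (1 + M j)\<^sup>2" using M[OF that] B0[of j] by (intro power_mono) (auto simp: B_def)
      finally have "T j \<le> a j * (1 + M j)\<^sup>2" using a_pos[of j] by (simp add: T_def)
      also have "\<dots> = (1/2) ^ j" using M0[of j] by (simp add: a_def add_nonneg_eq_0_iff)
      finally show ?thesis .
    qed
    have summable_T: "summable T"
    proof (rule summable_comparison_test')
      show "summable (\<lambda>j. (1/2::real) ^ j)" by (intro summable_geometric) simp
      show "norm (T j) \<le> (1/2) ^ j" if "m \<le> j" for j using T_le[OF that] T0[of j] by simp
    qed
    define S where "S = (\<Sum>j. T j)"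
    have S0: "0 \<le> S" unfolding S_def by (intro suminf_nonneg summable_T T0)
    define c where "c = a m / 16"
    have c: "0 < c" using a_pos by (simp add: c_def)
    \<comment> \<open>Since \<open>m\<close> precedes \<open>n\<close>, the centres \<open>\<omega>\<close> have \<open>\<omega> m \<le> 1/2\<close>, whereas \<open>V m x \<ge> 3/4\<close>.\<close>
    have D_c: "c \<le> D n \<omega> x" if "m < n" "\<omega> \<in> \<Omega> n" for n \<omega>
    proof -
      have "1/4 \<le> V m x - \<omega> m" using m(1) \<Omega>(3)[OF that(2,1)] by simp
      then have "(1/4)\<^sup>2 \<le> (V m x - \<omega> m)\<^sup>2" by (intro power_mono) auto
      then have "a m * (1/4)\<^sup>2 \<le> a m * (V m x - \<omega> m)\<^sup>2"
        by (intro mult_left_mono less_imp_le[OF a_pos])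
      then have "c \<le> a m * (V m x - \<omega> m)\<^sup>2" by (simp add: c_def power_divide)
      also have "\<dots> \<le> D n \<omega> x" using that by (intro D_ge) simp
      finally show ?thesis .
    qed
    define t where "t = min 1 (c / (4 * (S + 1)))"
    have t: "0 < t" "t \<le> 1" using c S0 by (auto simp: t_def)
    have tS: "t * S \<le> c / 4"
    proof -
      have "t * S \<le> (c / (4 * (S + 1))) * (S + 1)" using t S0 c by (intro mult_mono) (auto simp: t_def)
      also have "\<dots> = c / 4" using S0 by (simp add: divide_simps)
      finally show ?thesis .
    qed
    define P where "P n = B n * (\<Sum>\<omega>\<in>\<Omega> n. g n \<omega> x * (8 * exp (\<kappa> n * (t * S))))" for n
    \<comment> \<open>The increment \<open>E\<close> of the quadratic form is a germ of size at most \<open>S\<close>, uniformly in \<open>n\<close> and \<open>\<omega>\<close>,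
      and on the ball of radius \<open>t * r\<close> of size at most \<open>t * S \<le> c / 4\<close>.\<close>
    have germ_g: "germ (t * r) (g n \<omega> x * (8 * exp (\<kappa> n * (t * S)))) (\<lambda>h. of_real (g n \<omega> (x + h)) :: complex)"
      if \<omega>: "\<omega> \<in> \<Omega> n" for n \<omega>
    proof -
      define G where "G j h = (of_real (V j (x + h)) - of_real (V j x) :: complex)" for j h
      have G: "germ r (B j) (G j)" for j
      proof -
        have "germ (1 * r) (1 * C j m) (\<lambda>h. of_real (V j (x + h)) - of_real (V j (x + 0)) :: complex)"
          by (rule germ_increment[OF m(2)]) auto
        then show ?thesis unfolding G_def B_def add_0_right mult_1 .
      qed
      define E where "E h = (\<Sum>j\<le>n. of_real (a j) * (G j h * G j h + of_real (2 * (V j x - \<omega> j)) * G j h))" for h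
      have "germ r (\<Sum>j\<le>n. cmod (of_real (a j)) * (B j * B j + cmod (of_real (2 * (V j x - \<omega> j))) * B j)) E"
        unfolding E_def by (intro germ_sum finite_atMost r germ_cmult germ_add germ_mult G)
      moreover have "(\<Sum>j\<le>n. cmod (of_real (a j)) * (B j * B j + cmod (of_real (2 * (V j x - \<omega> j))) * B j)) \<le> S"
      proof -
        have "cmod (of_real (a j)) * (B j * B j + cmod (of_real (2 * (V j x - \<omega> j))) * B j) \<le> T j" if "j \<le> n" for j
        proof -
          have "\<bar>V j x - \<omega> j\<bar> \<le> 1" using V[of j x] \<Omega>(2)[OF \<omega> that] by (auto simp: abs_le_iff)
          then have "cmod (of_real (2 * (V j x - \<omega> j))) * B j \<le> 2 * B j"
            unfolding norm_of_real abs_mult using B0[of j] by (intro mult_right_mono) auto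
          then show ?thesis using a_pos[of j] by (simp add: T_def)
        qed
        then have "(\<Sum>j\<le>n. cmod (of_real (a j)) * (B j * B j + cmod (of_real (2 * (V j x - \<omega> j))) * B j)) \<le> (\<Sum>j\<le>n. T j)"
          by (intro sum_mono) auto
        also have "\<dots> \<le> S" unfolding S_def by (intro sum_le_suminf summable_T) (auto simp: T0)
        finally show ?thesis .
      qed
      ultimately have "germ r S E" by (rule germ_mono[OF _ r order_refl])
      moreover have "E 0 = 0" by (simp add: E_def G_def)
      ultimately have "germ (t * r) (t * S) E" using germ_increment[of r S E t] t by simp
      from germ_cmult[OF germ_exp[OF germ_cmult[OF this, of "of_real (- \<kappa> n)"]], of "of_real (g n \<omega> x)"]
      have "germ (t * r) (g n \<omega> x * (8 * exp (\<kappa> n * (t * S))))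
          (\<lambda>h. of_real (g n \<omega> x) * exp (of_real (- \<kappa> n) * E h))"
        using \<kappa>(1)[of n] by (simp add: g_def)
      moreover have "of_real (g n \<omega> (x + h)) = of_real (g n \<omega> x) * exp (of_real (- \<kappa> n) * E h)" for h
      proof -
        have "E h = of_real (D n \<omega> (x + h) - D n \<omega> x)"
          unfolding E_def D_def sum_subtractf[symmetric] of_real_sum G_def
          by (intro sum.cong refl) (simp add: power2_eq_square algebra_simps)
        then have "exp (of_real (- \<kappa> n) * E h) = of_real (exp (- \<kappa> n * (D n \<omega> (x + h) - D n \<omega> x)))"
          by (simp only: of_real_mult[symmetric] exp_of_real)
        moreover have "g n \<omega> (x + h) = g n \<omega> x * exp (- \<kappa> n * (D n \<omega> (x + h) - D n \<omega> x))"
          unfolding g_def mult_exp_exp by (rule arg_cong[where f = exp]) (simp add: algebra_simps)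
        ultimately show ?thesis by simp
      qed
      ultimately show ?thesis by simp
    qed
    have "germ (t * r) (P n) (\<lambda>h. of_real (\<psi> n (x + h)) :: complex)" for n
    proof -
      have tr: "t * r \<le> r" "0 < t * r" using t r by (simp_all add: mult_left_le_one_le)
      have "germ (t * r) (B n) (\<lambda>h. of_real (V n (x + h)) :: complex)"
        unfolding B_def by (rule germ_mono[OF m(2) tr(2,1) order_refl])
      moreover have "germ (t * r) (\<Sum>\<omega>\<in>\<Omega> n. g n \<omega> x * (8 * exp (\<kappa> n * (t * S))))
          (\<lambda>h. \<Sum>\<omega>\<in>\<Omega> n. of_real (g n \<omega> (x + h)) :: complex)"
        by (rule germ_sum[OF \<Omega>(1) tr(2) germ_g])
      ultimately show ?thesis
        unfolding P_def \<psi>_def of_real_mult of_real_sum by (rule germ_mult)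
    qed
    moreover have "summable (\<lambda>n. P n * (1 + w n))"
    proof -
      have "(\<lambda>n. (1/2::real) ^ n) \<longlonglongrightarrow> 0" by (intro LIMSEQ_realpow_zero) auto
      then have "\<forall>\<^sub>F n in sequentially. (1/2::real) ^ n < 50 * c"
        using c by (intro order_tendstoD(2)) auto
      then have "\<forall>\<^sub>F n in sequentially. norm (P n * (1 + w n)) \<le> L n * exp (- (\<kappa> n * (c / 2)))"
        using eventually_gt_at_top[of m]
      proof eventually_elim
        case (elim n)
        have "g n \<omega> x * (8 * exp (\<kappa> n * (t * S))) \<le> 8 * exp (- (\<kappa> n * (c / 2)))" if "\<omega> \<in> \<Omega> n" for \<omega>
        proof -
          have "a n / 200 - D n \<omega> x + t * S \<le> - (c / 2)"
            using D_c[OF elim(2) that] a_half[of n] elim(1) tS by simp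
          then have "\<kappa> n * (a n / 200 - D n \<omega> x + t * S) \<le> \<kappa> n * (- (c / 2))"
            using \<kappa>(1) by (rule mult_left_mono)
          moreover have "g n \<omega> x * (8 * exp (\<kappa> n * (t * S))) =
              8 * exp (\<kappa> n * (a n / 200 - D n \<omega> x + t * S))"
            by (simp add: g_def distrib_left exp_add)
          ultimately show ?thesis by simp
        qed
        then have "(\<Sum>\<omega>\<in>\<Omega> n. g n \<omega> x * (8 * exp (\<kappa> n * (t * S)))) \<le> K n * (8 * exp (- (\<kappa> n * (c / 2))))"
          unfolding K_def by (rule sum_bounded_above)
        then have "P n \<le> M n * (K n * (8 * exp (- (\<kappa> n * (c / 2)))))"
          unfolding P_def using M[of m n] elim(2) B0[of n] M0[of n]
          by (intro mult_mono) (auto simp: B_def g_def intro!: sum_nonneg)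
        then have "P n * (1 + w n) \<le> M n * (K n * (8 * exp (- (\<kappa> n * (c / 2))))) * (1 + w n)"
          using w[of n] by (intro mult_right_mono) auto
        moreover have "0 \<le> P n * (1 + w n)"
          unfolding P_def using w[of n] B0[of n]
          by (intro mult_nonneg_nonneg sum_nonneg) (auto simp: g_def)
        moreover have "M n * (K n * (8 * exp (- (\<kappa> n * (c / 2))))) * (1 + w n) =
            L n * exp (- (\<kappa> n * (c / 2)))"
          by (simp only: L_def mult_ac)
        ultimately show ?case by (simp only: real_norm_def abs_of_nonneg)
      qed
      then show ?thesis by (rule summable_comparison_test_ev) (rule \<kappa>(3), use c in simp)
    qed
    ultimately show ?thesis by blast
  qed
  show ?thesis by (rule that[OF nonneg far large germs])
qed

end

section \<open>Approximation of uniformly continuous functions\<close>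

context normed_by begin

text \<open>Subdivide the segment from \<open>y\<close> to \<open>x\<close> into steps shorter than \<open>d\<close>.\<close>

lemma large_scale_lipschitz:
  fixes f :: "'a \<Rightarrow> 'b::real_normed_vector"
  assumes d: "0 < d" and f: "\<And>x y. p (x - y) < d \<Longrightarrow> norm (f x - f y) \<le> e" and e: "0 \<le> e"
  shows "norm (f x - f y) \<le> e * (p (x - y) / d + 1)"
proof -
  define N where "N = nat \<lfloor>p (x - y) / d\<rfloor> + 1"
  have "0 \<le> p (x - y) / d" using d by simp
  then have N: "p (x - y) / d < real N" "real N \<le> p (x - y) / d + 1"
    unfolding N_def by linarith+
  have N0: "0 < real N" by (simp add: N_def)
  define z where "z i = y + (real i / real N) *\<^sub>R (x - y)" for i
  have step: "norm (f (z i) - f y) \<le> real i * e" for i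
  proof (induction i)
    case (Suc i)
    have "z (Suc i) - z i = (real (Suc i) / real N - real i / real N) *\<^sub>R (x - y)"
      by (simp add: z_def scaleR_left_diff_distrib)
    also have "real (Suc i) / real N - real i / real N = 1 / real N"
      by (simp add: diff_divide_distrib[symmetric])
    finally have "p (z (Suc i) - z i) = p (x - y) / real N" by simp
    also have "\<dots> < d" using N(1) N0 d by (simp add: field_simps)
    finally have "norm (f (z (Suc i)) - f (z i)) \<le> e" by (rule f)
    moreover have "norm (f (z (Suc i)) - f y) \<le> norm (f (z (Suc i)) - f (z i)) + norm (f (z i) - f y)"
      using norm_triangle_ineq[of "f (z (Suc i)) - f (z i)" "f (z i) - f y"] by simp
    ultimately show ?case using Suc by (simp add: distrib_right)
  qed (simp add: z_def)
  have "norm (f x - f y) \<le> real N * e" using step[of N] N0 by (simp add: z_def)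
  also have "\<dots> \<le> (p (x - y) / d + 1) * e" using N(2) e by (rule mult_right_mono)
  finally show ?thesis by (simp add: mult.commute)
qed

text \<open>Terms with \<open>V n x > 2/5\<close> come from points \<open>X n\<close> within \<open>d\<close> of \<open>x\<close> and contribute at most
  \<open>\<epsilon> / 4\<close> to the average. For the other terms \<open>\<psi> n x\<close> is bounded by \<open>V n x * 2 ^ (- n) / 8\<close>, and
  \<open>V n x * norm (f x - f (X n)) \<le> \<epsilon> / 2\<close> because \<open>V n\<close> decays at the rate at which \<open>f\<close> can grow.\<close>

lemma germ_approximation:
  fixes f :: "'a \<Rightarrow> 'b::complex_banach" and X :: "nat \<Rightarrow> 'a"
  assumes Q: "uniformly_star_analytic_separating p Q"
    and dense: "\<And>x e. 0 < e \<Longrightarrow> \<exists>n. p (x - X n) < e"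
    and uc: "\<And>e. 0 < e \<Longrightarrow> \<exists>d>0. \<forall>x y. p (x - y) < d \<longrightarrow> norm (f x - f y) < e"
    and \<epsilon>: "0 < \<epsilon>"
  shows "\<exists>H. (\<forall>x. \<exists>r C. germ r C (\<lambda>h. H (x + h))) \<and> (\<forall>x. norm (f x - H x) < \<epsilon>)"
proof -
  obtain v r \<eta> where r: "0 < r" and \<eta>: "0 < \<eta>" and v: "\<And>x. 0 < v x" "\<And>x. v x \<le> 1"
    "\<And>x. p x < \<eta> \<Longrightarrow> 3/4 \<le> v x" "\<And>x. 1 \<le> p x \<Longrightarrow> v x \<le> 2/5" "\<And>x. 1 \<le> p x \<Longrightarrow> v x * p x \<le> 1"
    and germ_v: "\<And>y. \<exists>C. \<forall>x. p (x - y) < \<eta> \<longrightarrow> germ r C (\<lambda>h. of_real (v (x + h)) :: complex)"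
    by (rule analytic_bump[OF Q]) (rule that; assumption)
  obtain d where d: "0 < d" "\<And>x y. p (x - y) < d \<Longrightarrow> norm (f x - f y) < \<epsilon> / 4"
    using uc[of "\<epsilon> / 4"] \<epsilon> by auto
  define V where "V n x = v ((x - X n) /\<^sub>R d)" for n x
  have p_scaled: "p (y /\<^sub>R d) = p y / d" for y using d(1) by (simp add: divide_inverse)
  have "\<forall>y. \<exists>C. \<forall>x. p (x - y) < \<eta> \<longrightarrow> germ r C (\<lambda>h. of_real (v (x + h)) :: complex)"
    using germ_v by (rule allI)
  from choice[OF this] obtain C' where C': "\<forall>y x. p (x - y) < \<eta> \<longrightarrow> germ r (C' y) (\<lambda>h. of_real (v (x + h)) :: complex)"
    ..
  define C where "C n m = C' ((X m - X n) /\<^sub>R d)" for n m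
  have C: "germ r (C n m) (\<lambda>h. of_real (v (x + h)) :: complex)"
    if "p (x - (X m - X n) /\<^sub>R d) < \<eta>" for n m x
    using C'[rule_format, OF that] unfolding C_def .
  have germ_V: "germ (d * r) (C n m) (\<lambda>h. of_real (V n (x + h)) :: complex)"
    if "p (x - X m) < d * \<eta>" for n m x
  proof -
    have "(x - X n) /\<^sub>R d - (X m - X n) /\<^sub>R d = (x - X m) /\<^sub>R d"
      by (simp add: scaleR_diff_right[symmetric])
    then have "p ((x - X n) /\<^sub>R d - (X m - X n) /\<^sub>R d) < \<eta>"
      using that d(1) by (simp only: p_scaled) (simp add: field_simps)
    from germ_rescale[OF C[OF this] d(1)] show ?thesis
      by (simp add: V_def scaleR_add_right[symmetric] add_diff_eq diff_add_eq)
  qed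
  have cover: "\<exists>m. 3/4 \<le> V m x \<and> (\<forall>n. germ (d * r) (C n m) (\<lambda>h. of_real (V n (x + h)) :: complex))" for x
  proof -
    obtain m where m: "p (x - X m) < d * \<eta>" using dense[of "d * \<eta>" x] d(1) \<eta> by auto
    then have "p ((x - X m) /\<^sub>R d) < \<eta>" using d(1) by (simp only: p_scaled) (simp add: field_simps)
    then show ?thesis using v(3) germ_V[OF m] unfolding V_def by blast
  qed
  obtain \<psi> :: "nat \<Rightarrow> 'a \<Rightarrow> real" where \<psi>: "\<And>n x. 0 \<le> \<psi> n x"
    "\<And>n x. V n x \<le> 2/5 \<Longrightarrow> \<psi> n x \<le> V n x * ((1/2) ^ n / 8)"
    "\<And>x. \<exists>n. 1/2 \<le> \<psi> n x"
    "\<And>x. \<exists>s P. (\<forall>n. germ s (P n) (\<lambda>h. of_real (\<psi> n (x + h)) :: complex)) \<and>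
      summable (\<lambda>n. P n * (1 + norm (f (X n))))"
  proof (rule analytic_partition[where V = V and r = "d * r" and C = C and w = "\<lambda>n. norm (f (X n))"])
    show "0 < d * r" using d(1) r by simp
  qed (use v cover in \<open>auto simp: V_def\<close>)
  define \<Psi> where "\<Psi> x = (\<Sum>n. \<psi> n x)" for x
  define H where "H x = (\<Sum>n. (\<psi> n x / \<Psi> x) *\<^sub>R f (X n))" for x
  have local: "summable (\<lambda>n. \<psi> n x) \<and> 1/2 \<le> \<Psi> x \<and> summable (\<lambda>n. (\<psi> n x / \<Psi> x) *\<^sub>R f (X n)) \<and>
      (\<exists>r C. germ r C (\<lambda>h. H (x + h)))" for x
  proof -
    obtain s P where P: "\<And>n. germ s (P n) (\<lambda>h. of_real (\<psi> n (x + h)) :: complex)"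
      and sum: "summable (\<lambda>n. P n * (1 + norm (f (X n))))"
      using \<psi>(4)[of x] by blast
    have s: "0 < s" using P[of 0] by (simp add: germ_def)
    have P0: "0 \<le> P n" for n using P[of n] by (rule germE)
    have sumP: "summable P"
      by (rule summable_comparison_test'[OF sum]) (use P0 in \<open>simp add: distrib_left\<close>)
    have sum_f: "summable (\<lambda>n. norm (f (X n)) * P n)"
      by (rule summable_comparison_test'[OF sum]) (use P0 in \<open>simp add: algebra_simps\<close>)
    have summ: "summable (\<lambda>n. \<psi> n (x + h))" if "p h < s" for h
      using germ_suminf(2)[OF P sumP that] by (rule summable_of_real_iff[THEN iffD1])
    have germ_\<Psi>: "germ s (\<Sum>n. P n) (\<lambda>h. of_real (\<Psi> (x + h)) :: complex)"
      by (rule germ_cong[OF germ_suminf(1)[OF P sumP]]) (simp add: \<Psi>_def suminf_of_real[OF summ])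
    have \<Psi>_half: "1/2 \<le> \<Psi> x"
    proof -
      obtain n where "1/2 \<le> \<psi> n x" using \<psi>(3) by blast
      also have "\<psi> n x \<le> \<Psi> x"
        using sum_le_suminf[of "\<lambda>n. \<psi> n x" "{n}"] summ[of 0] s \<psi>(1) by (simp add: \<Psi>_def)
      finally show ?thesis .
    qed
    \<comment> \<open>The reciprocal of \<open>\<Psi>\<close>: on a smaller ball \<open>\<Psi>\<close> differs from \<open>\<Psi> x\<close> by a germ of size at most
      \<open>1/4 \<le> \<Psi> x / 2\<close>, and the geometric series applies.\<close>
    define SP where "SP = (\<Sum>n. P n)"
    have SP0: "0 \<le> SP" unfolding SP_def by (intro suminf_nonneg sumP P0)
    define t where "t = 1 / (4 * (SP + 1))"
    have t: "0 < t" "t \<le> 1" "t * SP \<le> 1/4" using SP0 by (auto simp: t_def field_simps)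
    have ts: "0 < t * s" "t * s \<le> s" using t s by (simp_all add: mult_left_le_one_le)
    define q where "q = (1 / \<Psi> x) * (t * SP)"
    have "1 / \<Psi> x \<le> 2" using \<Psi>_half by (simp add: divide_le_eq)
    then have "q \<le> 2 * (1/4)" unfolding q_def using t SP0 by (intro mult_mono) auto
    then have q: "q < 1" by simp
    have "germ (t * s) (cmod (of_real (- (1 / \<Psi> x))) * (t * SP))
        (\<lambda>h. of_real (- (1 / \<Psi> x)) * (of_real (\<Psi> (x + h)) - of_real (\<Psi> (x + 0))) :: complex)"
      unfolding SP_def by (intro germ_cmult germ_increment[OF germ_\<Psi>] t)
    moreover have "cmod (of_real (- (1 / \<Psi> x))) * (t * SP) = q"
      using \<Psi>_half by (simp only: q_def norm_of_real abs_minus_cancel) simp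
    ultimately have "germ (t * s) q
        (\<lambda>h. of_real (- (1 / \<Psi> x)) * (of_real (\<Psi> (x + h)) - of_real (\<Psi> (x + 0))) :: complex)" by simp
    from germ_cmult[OF germ_inverse[OF this q], of "of_real (1 / \<Psi> x)"]
    obtain I where I: "germ (t * s) I (\<lambda>h. of_real (1 / \<Psi> x) *
        (1 / (1 - of_real (- (1 / \<Psi> x)) * (of_real (\<Psi> (x + h)) - of_real (\<Psi> (x + 0))))) :: complex)"
      by blast
    have inv: "of_real (1 / \<Psi> x) * (1 / (1 - of_real (- (1 / \<Psi> x)) * (of_real (\<Psi> (x + h)) - of_real (\<Psi> (x + 0))))) =
        (of_real (1 / \<Psi> (x + h)) :: complex)" for h
    proof -
      have "1 - (- (1 / \<Psi> x)) * (\<Psi> (x + h) - \<Psi> (x + 0)) = \<Psi> (x + h) / \<Psi> x"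
        using \<Psi>_half by (simp add: field_simps)
      from arg_cong[OF this, of "of_real :: real \<Rightarrow> complex"]
      have "(1 - of_real (- (1 / \<Psi> x)) * (of_real (\<Psi> (x + h)) - of_real (\<Psi> (x + 0))) :: complex) =
          of_real (\<Psi> (x + h) / \<Psi> x)"
        by (simp only: of_real_1 of_real_diff of_real_mult)
      moreover have "\<Psi> x \<noteq> 0" using \<Psi>_half by linarith
      ultimately show ?thesis by (simp only:) simp
    qed
    have germ_inv: "germ (t * s) I (\<lambda>h. of_real (1 / \<Psi> (x + h)) :: complex)"
      using I unfolding inv .
    have germ_term: "germ (t * s) (norm (f (X n)) * (P n * I)) (\<lambda>h. (\<psi> n (x + h) / \<Psi> (x + h)) *\<^sub>R f (X n))" for n
    proof -
      have "germ (t * s) (norm (f (X n)) * (P n * I))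
          (\<lambda>h. (of_real (\<psi> n (x + h)) * of_real (1 / \<Psi> (x + h))) *\<^sub>C f (X n))"
        by (intro germ_scaleC germ_mult germ_inv germ_mono[OF P ts order_refl])
      then show ?thesis by (simp add: scaleR_scaleC)
    qed
    have sumI: "summable (\<lambda>n. norm (f (X n)) * (P n * I))"
      using summable_mult2[OF sum_f, of I] by (simp add: mult.assoc)
    have "germ (t * s) (\<Sum>n. norm (f (X n)) * (P n * I)) (\<lambda>h. H (x + h))"
      unfolding H_def by (rule germ_suminf(1)[OF germ_term sumI])
    moreover have "summable (\<lambda>n. (\<psi> n x / \<Psi> x) *\<^sub>R f (X n))"
      using germ_suminf(2)[OF germ_term sumI, of 0] ts by simp
    ultimately show ?thesis using \<Psi>_half summ[of 0] s by auto
  qed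
  have "norm (f x - H x) < \<epsilon>" for x
  proof -
    have S\<psi>: "summable (\<lambda>n. \<psi> n x)" and \<Psi>_half: "1/2 \<le> \<Psi> x"
      and SH: "summable (\<lambda>n. (\<psi> n x / \<Psi> x) *\<^sub>R f (X n))" using local[of x] by blast+
    have "\<Psi> x \<noteq> 0" using \<Psi>_half by linarith
    have term_le: "\<psi> n x * norm (f x - f (X n)) \<le> (\<epsilon> / 4) * \<psi> n x + (\<epsilon> / 16) * (1/2) ^ n" for n
    proof (cases "V n x \<le> 2/5")
      case False
      then have "p ((x - X n) /\<^sub>R d) < 1" using v(4)[of "(x - X n) /\<^sub>R d"] by (force simp: V_def)
      then have "p (x - X n) < d" using d(1) by (simp only: p_scaled) (simp add: field_simps)
      then have "norm (f x - f (X n)) \<le> \<epsilon> / 4" using d(2) less_imp_le by blast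
      then have "\<psi> n x * norm (f x - f (X n)) \<le> \<psi> n x * (\<epsilon> / 4)" using \<psi>(1) by (rule mult_left_mono)
      moreover have "0 \<le> (\<epsilon> / 16) * (1/2) ^ n" using \<epsilon> by simp
      ultimately show ?thesis by (simp add: mult.commute)
    next
      case True
      have scale: "V n x * (p (x - X n) / d + 1) \<le> 2"
      proof (cases "1 \<le> p ((x - X n) /\<^sub>R d)")
        case True
        from v(5)[OF this] have "V n x * (p (x - X n) / d) \<le> 1" by (simp only: V_def p_scaled)
        then show ?thesis using v(2)[of "(x - X n) /\<^sub>R d"] by (simp add: distrib_left V_def)
      next
        case False
        then have "p (x - X n) / d + 1 \<le> 2" by (simp only: p_scaled)
        then have "V n x * (p (x - X n) / d + 1) \<le> 1 * 2"
          unfolding V_def by (intro mult_mono v(2)) (use d(1) in auto)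
        then show ?thesis by simp
      qed
      have "norm (f x - f (X n)) \<le> (\<epsilon> / 4) * (p (x - X n) / d + 1)"
        using \<epsilon> by (intro large_scale_lipschitz d(1) less_imp_le[OF d(2)]) auto
      then have "V n x * norm (f x - f (X n)) \<le> V n x * ((\<epsilon> / 4) * (p (x - X n) / d + 1))"
        unfolding V_def by (rule mult_left_mono) (rule less_imp_le[OF v(1)])
      also have "\<dots> = (\<epsilon> / 4) * (V n x * (p (x - X n) / d + 1))" by (simp only: mult_ac)
      also have "\<dots> \<le> (\<epsilon> / 4) * 2" by (intro mult_left_mono scale) (use \<epsilon> in simp)
      finally have Vf: "V n x * norm (f x - f (X n)) \<le> (\<epsilon> / 4) * 2" .
      have "\<psi> n x * norm (f x - f (X n)) \<le> (V n x * ((1/2) ^ n / 8)) * norm (f x - f (X n))"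
        by (rule mult_right_mono[OF \<psi>(2)[OF True] norm_ge_zero])
      also have "\<dots> = ((1/2) ^ n / 8) * (V n x * norm (f x - f (X n)))" by (simp only: mult_ac)
      also have "\<dots> \<le> ((1/2) ^ n / 8) * ((\<epsilon> / 4) * 2)" by (intro mult_left_mono Vf) auto
      also have "\<dots> = (\<epsilon> / 16) * (1/2) ^ n" by simp
      finally have "\<psi> n x * norm (f x - f (X n)) \<le> (\<epsilon> / 16) * (1/2) ^ n" .
      moreover have "0 \<le> (\<epsilon> / 4) * \<psi> n x" using \<psi>(1)[of n x] \<epsilon> by simp
      ultimately show ?thesis by linarith
    qed
    have geo: "(\<lambda>n. (\<epsilon> / 16) * (1/2) ^ n) sums (\<epsilon> / 8)"
      using sums_mult[OF geometric_sums[of "1/2::real"], of "\<epsilon> / 16"] by simp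
    have bound: "(\<lambda>n. (\<epsilon> / 4) * \<psi> n x + (\<epsilon> / 16) * (1/2) ^ n) sums ((\<epsilon> / 4) * \<Psi> x + \<epsilon> / 8)"
      unfolding \<Psi>_def by (intro sums_add sums_mult summable_sums S\<psi> geo)
    have sn: "summable (\<lambda>n. norm (\<psi> n x *\<^sub>R (f x - f (X n))))"
    proof (rule summable_comparison_test'[OF sums_summable[OF bound]])
      show "norm (norm (\<psi> n x *\<^sub>R (f x - f (X n)))) \<le> (\<epsilon> / 4) * \<psi> n x + (\<epsilon> / 16) * (1/2) ^ n" for n
        using term_le[of n] \<psi>(1)[of n x] by simp
    qed
    have "(\<lambda>n. \<psi> n x / \<Psi> x) sums (\<Psi> x / \<Psi> x)"
      using sums_divide[OF summable_sums[OF S\<psi>], of "\<Psi> x"] by (simp only: \<Psi>_def[symmetric])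
    from sums_diff[OF bounded_linear.sums[OF bounded_linear_scaleR_left[of "f x"] this] summable_sums[OF SH]]
    have "(\<lambda>n. (\<psi> n x / \<Psi> x) *\<^sub>R f x - (\<psi> n x / \<Psi> x) *\<^sub>R f (X n)) sums ((\<Psi> x / \<Psi> x) *\<^sub>R f x - H x)"
      unfolding H_def .
    from bounded_linear.sums[OF bounded_linear_scaleR_right[of "\<Psi> x"] this]
    have "(\<lambda>n. \<Psi> x *\<^sub>R ((\<psi> n x / \<Psi> x) *\<^sub>R f x - (\<psi> n x / \<Psi> x) *\<^sub>R f (X n))) sums
        (\<Psi> x *\<^sub>R ((\<Psi> x / \<Psi> x) *\<^sub>R f x - H x))" .
    then have "(\<lambda>n. \<psi> n x *\<^sub>R (f x - f (X n))) sums (\<Psi> x *\<^sub>R (f x - H x))"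
      using \<open>\<Psi> x \<noteq> 0\<close> by (simp add: scaleR_diff_right)
    then have "\<Psi> x *\<^sub>R (f x - H x) = (\<Sum>n. \<psi> n x *\<^sub>R (f x - f (X n)))" by (rule sums_unique)
    then have "norm (\<Psi> x *\<^sub>R (f x - H x)) \<le> (\<Sum>n. norm (\<psi> n x *\<^sub>R (f x - f (X n))))"
      using summable_norm[OF sn] by simp
    also have "\<dots> \<le> (\<Sum>n. (\<epsilon> / 4) * \<psi> n x + (\<epsilon> / 16) * (1/2) ^ n)"
    proof (rule suminf_le[OF _ sn sums_summable[OF bound]])
      show "norm (\<psi> n x *\<^sub>R (f x - f (X n))) \<le> (\<epsilon> / 4) * \<psi> n x + (\<epsilon> / 16) * (1/2) ^ n" for n
        using term_le[of n] \<psi>(1)[of n x] by simp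
    qed
    also have "\<dots> = (\<epsilon> / 4) * \<Psi> x + \<epsilon> / 8" using bound by (simp add: sums_iff)
    also have "\<dots> \<le> (\<epsilon> / 4) * \<Psi> x + (\<epsilon> / 4) * \<Psi> x"
    proof -
      have "(\<epsilon> / 4) * (1/2) \<le> (\<epsilon> / 4) * \<Psi> x"
        by (intro mult_left_mono \<Psi>_half) (use \<epsilon> in simp)
      then show ?thesis by linarith
    qed
    also have "\<dots> = \<Psi> x * (\<epsilon> / 2)" by simp
    finally have "\<Psi> x * norm (f x - H x) \<le> \<Psi> x * (\<epsilon> / 2)"
      using \<Psi>_half by (simp only: norm_scaleR abs_of_nonneg[of "\<Psi> x"])
    then have "norm (f x - H x) \<le> \<epsilon> / 2" using \<Psi>_half by simp
    then show ?thesis using \<epsilon> by simp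
  qed
  then show ?thesis using local by blast
qed

lemma uniformly_continuous_normD:
  fixes f :: "'a \<Rightarrow> 'b::real_normed_vector"
  assumes "uniformly_continuous_map (norm_metric p) euclidean_metric f" "0 < e"
  shows "\<exists>d>0. \<forall>x y. p (x - y) < d \<longrightarrow> norm (f x - f y) < e"
proof -
  interpret M: Metric_space UNIV "\<lambda>x y. p (x - y)" by (rule Metric_space_norm[OF is_norm])
  have "mspace (norm_metric p) = UNIV" "mdist (norm_metric p) = (\<lambda>x y. p (x - y))"
    by (simp_all add: norm_metric_def)
  then obtain d where "d > 0" "\<And>x y. p (y - x) < d \<Longrightarrow> dist (f y) (f x) < e"
    using assms unfolding uniformly_continuous_map_def by auto
  then show ?thesis by (auto simp: dist_norm)
qed

end

theorem mainTheorem4: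
  fixes p :: "nat \<Rightarrow> 'a::complex_vector \<Rightarrow> real"
    and f :: "'a \<Rightarrow> 'b::complex_banach"
  assumes "frechet_norm_system p"
    and "separable_space (norms_topology p)"
    and "\<forall>n. \<exists>Q. uniformly_star_analytic_separating (p n) Q"
    and "uniformly_continuous_map (rho_metric p) euclidean_metric f"
    and "\<exists>k. uniformly_continuous_map (norm_metric (p k)) euclidean_metric f"
  shows "\<forall>\<epsilon>>0. \<exists>H :: 'a \<Rightarrow> 'b. star_analytic (norms_topology p) H \<and>
    (\<forall>x. norm (f x - H x) < \<epsilon>)"
proof (intro allI impI)
  fix \<epsilon> :: real assume \<epsilon>: "0 < \<epsilon>"
  obtain k where k: "uniformly_continuous_map (norm_metric (p k)) euclidean_metric f"
    using assms(5) by blast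
  obtain Q where Q: "uniformly_star_analytic_separating (p k) Q" using assms(3) by blast
  interpret normed_by "p k"
    by unfold_locales (use assms(1) in \<open>simp add: frechet_norm_system_def\<close>)
  have ball: "openin (norms_topology p) {y. p k (y - x) < r}" if "0 < r" for x r
    unfolding norms_topology_def by (rule topology_generated_by_Basis) (use that in blast)
  obtain D where D: "countable D" "norms_topology p closure_of D = topspace (norms_topology p)"
    using assms(2) unfolding separable_space_def by auto
  have dense: "\<exists>y\<in>D. p k (x - y) < e" if "0 < e" for x e
  proof -
    have "x \<in> topspace (norms_topology p)" using openin_subset[OF ball[of 1 x]] by auto
    then have "x \<in> norms_topology p closure_of D" using D(2) by simp
    then have "\<forall>U. x \<in> U \<and> openin (norms_topology p) U \<longrightarrow> (\<exists>y. y \<in> D \<and> y \<in> U)"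
      unfolding in_closure_of by blast
    from this[rule_format, of "{y. p k (y - x) < e}"] ball[OF that, of x] that
    obtain y where "y \<in> D" "p k (y - x) < e" by auto
    then show ?thesis using is_norm_minus_commute[OF is_norm, of x y] by (intro bexI[of _ y]) simp_all
  qed
  then have "D \<noteq> {}" using dense[of 1 0] by auto
  then have range: "range (from_nat_into D) = D" using D(1) by (rule range_from_nat_into)
  have dense_seq: "\<exists>n. p k (x - from_nat_into D n) < e" if "0 < e" for x e
  proof -
    obtain y where y: "y \<in> D" "p k (x - y) < e" using dense[OF \<open>0 < e\<close>, of x] by blast
    then obtain n where "y = from_nat_into D n" using range by (metis imageE)
    then show ?thesis using y(2) by blast
  qed
  have "\<exists>H. (\<forall>x. \<exists>r C. germ r C (\<lambda>h. H (x + h))) \<and> (\<forall>x. norm (f x - H x) < \<epsilon>)"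
    by (rule germ_approximation[OF Q dense_seq uniformly_continuous_normD[OF k] \<epsilon>])
  then obtain H where H: "\<forall>x. \<exists>r C. germ r C (\<lambda>h. H (x + h))" "\<forall>x. norm (f x - H x) < \<epsilon>"
    by blast
  have "star_analytic (norms_topology p) H"
    by (rule star_analytic_if_germ[OF ball spec[OF H(1)]])
  with H(2) show "\<exists>H. star_analytic (norms_topology p) H \<and> (\<forall>x. norm (f x - H x) < \<epsilon>)"
    by blast
qed

end
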